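(* Let $p\leq 23$ be a prime and let $a_p(n)$ be defined by $\sum_{n\ge 0} a_p(n)q^n = \dfrac{1}{(q;q)_\infty (q^p;q^p)_\infty}$. Then for every integer $n\geq 1$ with $24n>p+1$ we have \begin{align*} a_p(n) &= 2\pi\sqrt{p}\left(\dfrac{1+p^{-1}}{24n-p-1}\right)\sum_{j=1}^{p-1}\sum_{\substack{m=1\\ m\equiv j\bmod{p}}}^\infty I_2\left(\dfrac{\pi}{6m}\sqrt{(1+p^{-1})(24n-p-1)}\right)\dfrac{b_m(n)}{m}\\ &\quad+ 2\pi\left(\dfrac{1+p}{24n-p-1}\right)\sum_{\substack{m=1\\ p\mid m}}^\infty I_2\left(\dfrac{\pi}{6m}\sqrt{(1+p)(24n-p-1)}\right)\dfrac{b_m(n)}{m}, \end{align*} where for a positive integer $k$, \[ b_k(n) := \sum_{\substack{0\leq h < k\\ \gcd(h,k)=1}} \exp\left[-\dfrac{2\pi nhi}{k}+\pi s(h,k)i+\pi s\left(\dfrac{ph}{\gcd(p,k)},\dfrac{k}{\gcd(p,k)}\right)i\right]. \]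
   Context: For $a\in\mathbb{C}$ and $|q|<1$, $(a;q)_\infty=\prod_{n\ge 0}(1-aq^n)$. Equivalently, $a_p(n)$ is the number of partitions of $n$ in which parts that are multiples of $p$ come in $2$ colors. For integers $h$ and $k\ge 1$, $s(h,k):=\sum_{j=1}^{k-1}\frac{j}{k}\left(\left\{\frac{hj}{k}\right\}-\frac12\right)$ is the Dedekind sum, where $\{t\}$ denotes the fractional part of $t$ (so $s(h,1)=0$). $I_2$ is the modified Bessel function of the first kind of order $2$: $I_\nu(s)=\sum_{m=0}^\infty \frac{(s/2)^{\nu+2m}}{m!\,\Gamma(\nu+m+1)}$. *)

theory Defs
  imports
    "HOL-Analysis.Analysis"
    "HOL-Number_Theory.Cong"
begin

definition qpoch_inf :: "complex \<Rightarrow> complex \<Rightarrow> complex" where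
  "qpoch_inf a q = (\<Prod>n. 1 - a * q ^ n)"

definition dedekind_sum :: "int \<Rightarrow> nat \<Rightarrow> real" where
  "dedekind_sum h k =
     (\<Sum>j = 1..<k. real j / real k * (frac (real_of_int h * real j / real k) - 1 / 2))"

(* Only for s \<ge> 0, where the real power (s / 2) powr (\<nu> + 2 * m) is the intended one. *)
definition bessel_I :: "real \<Rightarrow> real \<Rightarrow> real" where
  "bessel_I \<nu> s =
     (\<Sum>m. (s / 2) powr (\<nu> + 2 * real m) / (fact m * Gamma (\<nu> + real m + 1)))"

(* The paper's b_k(n), with its dependence on p made explicit.
   Both divisions by gcd p k are exact. *)
definition b_coeff :: "nat \<Rightarrow> nat \<Rightarrow> nat \<Rightarrow> complex" where
  "b_coeff p k n =
     (\<Sum>h | h < k \<and> coprime h k.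
        exp (- (2 * of_real pi * of_nat n * of_nat h * \<i>) / of_nat k
             + of_real pi * of_real (dedekind_sum (int h) k) * \<i>
             + of_real pi
                 * of_real (dedekind_sum (int (p * h div gcd p k)) (k div gcd p k)) * \<i>))"

end

theory Submission
  imports Defs "HOL-Complex_Analysis.Complex_Analysis" "HOL-Real_Asymp.Real_Asymp"
begin

text \<open>
  Rademacher's circle method. With \<open>q = exp (2 \<pi> i \<tau>)\<close>, the coefficient is the integral of
  \<open>exp (- 2 \<pi> i n \<tau>) / ((q; q) (q\<^sup>p; q\<^sup>p))\<close> over a period of the line \<open>Im \<tau> = 1 / N\<^sup>2\<close>, which is cut into
  Farey arcs of order \<open>N\<close>. On the arc around \<open>h / k\<close> both factors are replaced by their images under the
  transformation formula. As \<open>p \<le> 23\<close>, everything except the constant term of the transformed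
  product contributes only \<open>O(1 / N)\<close> in total. The weight is the integer \<open>- 1\<close>, so the remaining
  integrand is single-valued: closing each arc to a rectangle around \<open>h / k\<close> costs again \<open>O(1 / N)\<close>,
  and the residue inside is the \<open>I\<^sub>2\<close> term.

  The transformation formula for \<open>(q; q)\<close> is reduced by the Euclidean algorithm on \<open>(h, k)\<close> and the
  reciprocity law of the Dedekind sums to the inversion \<open>z \<mapsto> 1 / z\<close>. By the identity theorem the
  inversion is needed only for rational \<open>z = M / N > 0\<close>, where it follows from the partial fractions
  of \<open>coth\<close>: the resulting double series is symmetric up to boundary strips that cancel in the limit,
  and \<open>ln z\<close> arises as the difference of the harmonic numbers of \<open>M\<close> and \<open>N\<close>.
\<close>

subsection \<open>Dedekind sums\<close>

text \<open>The bound 23 is exactly where one main term per arc suffices. At a cusp with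
  \<open>g = gcd p k\<close> put \<open>x = g^2 / p\<close>, so \<open>x\<close> is
  \<open>1 / p\<close> or \<open>p\<close>. The kernel grows like
  \<open>exp (2 * pi * X * (1 + x) / 24)\<close>, while the transformed product differs from 1 by a
  multiple of \<open>exp (- 2 * pi * X * min 1 x)\<close>, where \<open>X\<close> is unbounded as
  the line descends towards the cusp. The inequality \<open>1 + x \<le> 24 * min 1 x\<close> holds
  for both values of \<open>x\<close> if and only if \<open>p \<le> 23\<close>; beyond that, further
  terms of the product would grow exponentially as well. The coefficient integral is never cut up as
  an integral. Its integrand has a primitive \<open>P\<close> on the upper half-plane with
  \<open>P (\<tau> + 1) = P \<tau> + a n\<close>, so the Farey dissection is a telescoping of values
  of \<open>P\<close> at mediants, and integrals occur only over single arcs. The inversion is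
  proved with real logarithms; branches enter only through \<open>csqrt\<close> on the right
  half-plane, which the Euclidean step never leaves. Rational arguments are what makes the two
  truncation lengths have ratio exactly \<open>z\<close>.\<close>

lemma dedekind_sum_nat:
  "dedekind_sum (int h) k =
     (\<Sum>r = 1..<k. real r / real k * (real (h * r mod k) / real k - 1 / 2))"
proof -
  have "frac (real h * real r / real k) = real (h * r mod k) / real k" for r
  proof (cases "k = 0")
    case False
    have "real (h * r) = real k * real (h * r div k) + real (h * r mod k)"
      by (metis mult_div_mod_eq of_nat_add of_nat_mult)
    then have "real h * real r / real k = real (h * r mod k) / real k + of_int (int (h * r div k))"
      using False by (simp add: field_simps)
    moreover have "frac (real (h * r mod k) / real k) = real (h * r mod k) / real k"
      using False by (simp add: frac_eq)
    ultimately show ?thesis by (simp only: frac_add_of_int_right)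
  qed auto
  then show ?thesis unfolding dedekind_sum_def by simp
qed

lemma dedekind_sum_cong:
  assumes "[h = h'] (mod int k)"
  shows "dedekind_sum h k = dedekind_sum h' k"
proof (cases "k = 0")
  case False
  obtain c where c: "h = h' + int k * c"
    using assms by (metis cong_iff_lin cong_sym mult.commute)
  have "frac (real_of_int h * real j / real k) = frac (real_of_int h' * real j / real k)" for j
  proof -
    have "real_of_int h * real j / real k = real_of_int h' * real j / real k + of_int (c * int j)"
      using False by (simp add: c field_simps)
    then show ?thesis by (simp only: frac_add_of_int_right)
  qed
  then show ?thesis unfolding dedekind_sum_def by simp
qed (auto simp: dedekind_sum_def)

lemma dedekind_sum_neg:
  assumes "coprime h (int k)"
  shows "dedekind_sum (- h) k = - dedekind_sum h k"
  unfolding dedekind_sum_def sum_negf [symmetric]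
proof (rule sum.cong)
  fix j assume j: "j \<in> {1..<k}"
  \<comment> \<open>At an integer both \<open>frac x\<close> and \<open>frac (- x)\<close> are 0 and
    the summand is not odd; elsewhere they add up to 1.\<close>
  have "real_of_int h * real j / real k \<notin> \<int>"
  proof
    assume "real_of_int h * real j / real k \<in> \<int>"
    then obtain c where "real_of_int h * real j / real k = of_int c" by (elim Ints_cases)
    then have "real_of_int (h * int j) = real_of_int (c * int k)" using j by (simp add: field_simps)
    then have "int k dvd h * int j" by (metis dvd_triv_right of_int_eq_iff)
    then have "k dvd j" using assms by (simp add: coprime_commute coprime_dvd_mult_right_iff)
    then show False using j by (auto dest: dvd_imp_le)
  qed
  then show "real j / real k * (frac (real_of_int (- h) * real j / real k) - 1 / 2) =
        - (real j / real k * (frac (real_of_int h * real j / real k) - 1 / 2))"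
    by (simp add: frac_neg right_diff_distrib)
qed auto

lemma sum_real_upto: "(\<Sum>r = 1..<k. real r) = real k * (real k - 1) / 2"
proof (induction k)
  case (Suc k)
  then show ?case
    by (cases "k = 0") (auto simp: field_simps atLeastLessThanSuc)
qed auto

lemma sum_real_square_upto: "(\<Sum>r = 1..<k. (real r)\<^sup>2) = (real k - 1) * real k * (2 * real k - 1) / 6"
proof (induction k)
  case (Suc k)
  then show ?case
    by (cases "k = 0") (auto simp: field_simps power2_eq_square atLeastLessThanSuc)
qed auto

lemma bij_betw_mult_mod:
  assumes "coprime h (k :: nat)"
  shows "bij_betw (\<lambda>r. h * r mod k) {1..<k} {1..<k}"
proof -
  have inj: "inj_on (\<lambda>r. h * r mod k) {1..<k}"
  proof (rule inj_onI)
    fix x y assume "x \<in> {1..<k}" "y \<in> {1..<k}" "h * x mod k = h * y mod k"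
    then have "[h * x = h * y] (mod k)" by (simp add: cong_def)
    then have "[x = y] (mod k)" using assms cong_mult_lcancel_nat [of h k x y] by simp
    then show "x = y" using \<open>x \<in> _\<close> \<open>y \<in> _\<close> by (auto intro: cong_less_modulus_unique_nat)
  qed
  have "(\<lambda>r. h * r mod k) ` {1..<k} \<subseteq> {1..<k}"
  proof (intro image_subsetI)
    fix r assume r: "r \<in> {1..<k}"
    have "\<not> k dvd r" using r by (auto dest: dvd_imp_le)
    then have "\<not> k dvd h * r"
      using assms by (simp add: coprime_dvd_mult_right_iff coprime_commute)
    then have "h * r mod k \<noteq> 0" by (simp add: dvd_eq_mod_eq_0)
    then show "h * r mod k \<in> {1..<k}" using r by simp
  qed
  then have "(\<lambda>r. h * r mod k) ` {1..<k} = {1..<k}"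
    using inj by (simp add: endo_inj_surj)
  with inj show ?thesis by (simp add: bij_betw_def)
qed

text \<open>Counting the lattice points below the diagonal of a rectangle by columns and by rows.\<close>

lemma sum_floor_square:
  fixes h k :: nat
  assumes "coprime h k" "h > 0" "k > 0"
  shows "(\<Sum>r = 1..<k. (real (h * r div k))\<^sup>2) + (\<Sum>r = 1..<k. real (h * r div k))
       = 2 * (\<Sum>v = 1..<h. real v * (real k - 1 - real (k * v div h)))"
proof -
  have "(real (h * r div k))\<^sup>2 + real (h * r div k)
      = 2 * (\<Sum>v = 1..<h. if k * v div h < r then real v else 0)" if r: "r \<in> {1..<k}" for r
  proof -
    let ?f = "h * r div k"
    have flt: "?f < h" using r assms by (simp add: less_mult_imp_div_less)
    have iff: "k * v div h < r \<longleftrightarrow> v \<le> ?f" if v: "v \<in> {1..<h}" for v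
    proof -
      \<comment> \<open>By coprimality no interior lattice point lies on the diagonal, so the strict
        count by rows and the weak count by columns agree.\<close>
      have ne: "k * v \<noteq> h * r"
      proof
        assume "k * v = h * r"
        then have "h dvd k * v" by simp
        then have "h dvd v" using assms by (simp add: coprime_dvd_mult_right_iff)
        then show False using v by (auto dest: dvd_imp_le)
      qed
      have "k * v div h < r \<longleftrightarrow> k * v < r * h" using assms by (simp add: div_less_iff_less_mult)
      also have "\<dots> \<longleftrightarrow> v * k \<le> h * r" using ne by (auto simp: mult.commute)
      also have "\<dots> \<longleftrightarrow> v \<le> ?f" using assms by (simp add: less_eq_div_iff_mult_less_eq)
      finally show ?thesis .
    qed
    have "(\<Sum>v = 1..<h. if k * v div h < r then real v else 0)
        = (\<Sum>v = 1..<h. if v \<le> ?f then real v else 0)"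
      by (rule sum.cong) (simp_all add: iff)
    also have "\<dots> = (\<Sum>v \<in> {1..<Suc ?f}. real v)"
      by (rule sum.mono_neutral_cong_right) (use flt in auto)
    also have "\<dots> = real ?f * (real ?f + 1) / 2" by (subst sum_real_upto) simp
    finally show ?thesis by (simp add: power2_eq_square field_simps)
  qed
  then have "(\<Sum>r = 1..<k. (real (h * r div k))\<^sup>2) + (\<Sum>r = 1..<k. real (h * r div k))
      = 2 * (\<Sum>r = 1..<k. \<Sum>v = 1..<h. if k * v div h < r then real v else 0)"
    by (simp add: sum.distrib [symmetric] sum_distrib_left)
  also have "(\<Sum>r = 1..<k. \<Sum>v = 1..<h. if k * v div h < r then real v else 0)
      = (\<Sum>v = 1..<h. \<Sum>r = 1..<k. if k * v div h < r then real v else 0)"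
    by (rule sum.swap)
  also have "\<dots> = (\<Sum>v = 1..<h. real v * (real k - 1 - real (k * v div h)))"
  proof (rule sum.cong)
    fix v assume v: "v \<in> {1..<h}"
    have lt: "k * v div h < k" using v assms by (simp add: less_mult_imp_div_less)
    have "(\<Sum>r = 1..<k. if k * v div h < r then real v else 0)
        = (\<Sum>r \<in> {Suc (k * v div h)..<k}. real v)"
      by (rule sum.mono_neutral_cong_right) auto
    then show "(\<Sum>r = 1..<k. if k * v div h < r then real v else 0)
        = real v * (real k - 1 - real (k * v div h))"
      using lt by (simp add: of_nat_diff algebra_simps)
  qed auto
  finally show ?thesis .
qed

text \<open>Writing the floor as \<open>h * r / k\<close> minus the fractional part
  \<open>m r\<close> and squaring, the cross term is the sum of \<open>r * m r\<close>, which
  carries the Dedekind sum. All other moments are explicit, and the double count in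
  \<open>sum_floor_square\<close> supplies the corresponding cross term for the exchanged
  pair.\<close>

theorem dedekind_sum_reciprocity:
  fixes h k :: nat
  assumes "coprime h k" "h > 0" "k > 0"
  shows "dedekind_sum (int h) k + dedekind_sum (int k) h
       = - 1 / 4 + (real h / real k + real k / real h + 1 / (real h * real k)) / 12"
proof -
  define s where "s = dedekind_sum (int h) k"
  define t where "t = dedekind_sum (int k) h"
  define m where "m r = real (h * r mod k) / real k" for r
  define f where "f r = real (h * r div k)" for r
  define m' where "m' v = real (k * v mod h) / real h" for v
  define g where "g v = real (k * v div h)" for v
  have fm: "f r = real h * real r / real k - m r" for r
  proof -
    have "real (h * r) = real k * f r + real (h * r mod k)"
      unfolding f_def by (metis mult_div_mod_eq of_nat_add of_nat_mult)
    then show ?thesis using assms by (simp add: m_def field_simps)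
  qed
  have gm: "g v = real k * real v / real h - m' v" for v
  proof -
    have "real (k * v) = real h * g v + real (k * v mod h)"
      unfolding g_def by (metis mult_div_mod_eq of_nat_add of_nat_mult)
    then show ?thesis using assms by (simp add: m'_def field_simps)
  qed
  have s: "s = (\<Sum>r = 1..<k. real r * m r) / k - (real k - 1) / 4"
  proof -
    have "s = (\<Sum>r = 1..<k. real r * m r) / k - (\<Sum>r = 1..<k. real r) / (2 * real k)"
      unfolding s_def dedekind_sum_nat m_def
      by (simp del: One_nat_def add: right_diff_distrib sum_subtractf sum_divide_distrib mult_ac)
    then show ?thesis using assms unfolding sum_real_upto by (simp del: One_nat_def add: field_simps)
  qed
  have t: "t = (\<Sum>v = 1..<h. real v * m' v) / h - (real h - 1) / 4"
  proof -
    have "t = (\<Sum>v = 1..<h. real v * m' v) / h - (\<Sum>v = 1..<h. real v) / (2 * real h)"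
      unfolding t_def dedekind_sum_nat m'_def
      by (simp del: One_nat_def add: right_diff_distrib sum_subtractf sum_divide_distrib mult_ac)
    then show ?thesis using assms unfolding sum_real_upto by (simp del: One_nat_def add: field_simps)
  qed
  \<comment> \<open>Multiplication by \<open>h\<close> permutes the nonzero residues, so the pure
    moments of \<open>m\<close> do not depend on \<open>h\<close>.\<close>
  have perm: "(\<Sum>r = 1..<k. F (real (h * r mod k) / real k)) = (\<Sum>r = 1..<k. F (real r / real k))"
    for F :: "real \<Rightarrow> real"
    using sum.reindex_bij_betw [OF bij_betw_mult_mod [OF assms(1)], of "\<lambda>r. F (real r / real k)"] .
  have m1: "(\<Sum>r = 1..<k. m r) = (real k - 1) / 2"
    unfolding m_def using perm [of "\<lambda>x. x"] assms
    by (simp del: One_nat_def add: sum_divide_distrib [symmetric] sum_real_upto)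
  have m2: "(\<Sum>r = 1..<k. (m r)\<^sup>2) = (real k - 1) * (2 * real k - 1) / (6 * real k)"
    unfolding m_def using perm [of "\<lambda>x. x\<^sup>2"] assms
    by (simp del: One_nat_def add: power_divide sum_divide_distrib [symmetric] sum_real_square_upto)
       (simp add: power2_eq_square)
  have f1: "(\<Sum>r = 1..<k. f r) = (real h - 1) * (real k - 1) / 2"
    using assms by (simp del: One_nat_def add: fm sum_subtractf m1 sum_divide_distrib [symmetric]
        sum_distrib_left [symmetric] sum_real_upto) (simp add: field_simps)
  have f2: "(\<Sum>r = 1..<k. (f r)\<^sup>2) = (\<Sum>r = 1..<k. (m r)\<^sup>2) - 2 * real h / real k * (\<Sum>r = 1..<k. real r * m r)
      + (real h)\<^sup>2 / (real k)\<^sup>2 * ((real k - 1) * real k * (2 * real k - 1) / 6)"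
    unfolding sum_real_square_upto [symmetric] sum_distrib_left sum_subtractf [symmetric] sum.distrib [symmetric]
    by (rule sum.cong) (auto simp: fm power2_eq_square field_simps)
  have v: "(\<Sum>v = 1..<h. real v * (real k - 1 - g v))
     = (real k - 1) * (real h * (real h - 1) / 2) - real k / real h * ((real h - 1) * real h * (2 * real h - 1) / 6)
        + (\<Sum>v = 1..<h. real v * m' v)"
    unfolding sum_real_square_upto [symmetric] sum_real_upto [symmetric] sum_distrib_left
      sum_subtractf [symmetric] sum.distrib [symmetric]
    by (rule sum.cong) (auto simp: gm power2_eq_square field_simps)
  define X where "X = (\<Sum>r = 1..<k. real r * m r)"
  define Y where "Y = (\<Sum>v = 1..<h. real v * m' v)"
  have X: "X = real k * (s + (real k - 1) / 4)" using s assms by (simp add: X_def field_simps)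
  have Y: "Y = real h * (t + (real h - 1) / 4)" using t assms by (simp add: Y_def field_simps)
  have main: "(real k - 1) * (2 * real k - 1) / (6 * real k) - 2 * real h / real k * X
      + (real h)\<^sup>2 / (real k)\<^sup>2 * ((real k - 1) * real k * (2 * real k - 1) / 6)
      + (real h - 1) * (real k - 1) / 2
    = 2 * ((real k - 1) * (real h * (real h - 1) / 2)
        - real k / real h * ((real h - 1) * real h * (2 * real h - 1) / 6) + Y)"
    using sum_floor_square [OF assms] f1 f2 v m2 unfolding f_def g_def X_def Y_def by simp
  define a b P where "a = real h" and "b = real k" and "P = (b - 1) * (2 * b - 1) / (6 * b)"
  have ab: "a \<noteq> 0" "b \<noteq> 0" using assms by (auto simp: a_def b_def)
  have P: "6 * b * P = (b - 1) * (2 * b - 1)" using ab by (simp add: P_def)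
  have "P - 2 * a * (s + (b - 1) / 4) + a\<^sup>2 * P + (a - 1) * (b - 1) / 2
      = 2 * ((b - 1) * (a * (a - 1) / 2) - b * ((a - 1) * (2 * a - 1) / 6) + a * (t + (a - 1) / 4))"
    using main ab unfolding X Y a_def [symmetric] b_def [symmetric]
    by (simp add: P_def power2_eq_square)
  \<comment> \<open>The factor \<open>12 * b\<close> clears all denominators, with \<open>P\<close>
    appearing only as \<open>6 * b * P\<close>; what remains is polynomial arithmetic.\<close>
  then have "12 * b * (P - 2 * a * (s + (b - 1) / 4) + a\<^sup>2 * P + (a - 1) * (b - 1) / 2)
      = 12 * b * (2 * ((b - 1) * (a * (a - 1) / 2) - b * ((a - 1) * (2 * a - 1) / 6) + a * (t + (a - 1) / 4)))"
    by (rule arg_cong)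
  then have "2 * (1 + a\<^sup>2) * (6 * b * P) - 6 * a * b * (4 * s + (b - 1)) + 6 * b * (a - 1) * (b - 1)
      = 12 * a * (a - 1) * b * (b - 1) - 4 * b * b * (a - 1) * (2 * a - 1) + 6 * a * b * (4 * t + (a - 1))"
    by (simp add: field_simps power2_eq_square)
  then have "12 * a * b * (s + t) = - 3 * a * b + a\<^sup>2 + b\<^sup>2 + 1"
    unfolding P by (simp add: algebra_simps power2_eq_square)
  then have "s + t = (- 3 * a * b + a\<^sup>2 + b\<^sup>2 + 1) / (12 * a * b)"
    using ab by (simp add: eq_divide_eq mult_ac)
  also have "\<dots> = - 1 / 4 + (a / b + b / a + 1 / (a * b)) / 12"
    using ab by (simp add: field_simps power2_eq_square)
  finally show ?thesis by (simp add: s_def t_def a_def b_def)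
qed

subsection \<open>The inversion formula at rational arguments\<close>

text \<open>Euler's product for the sine at \<open>\<i> * x\<close>: the value is
  \<open>\<i>\<close> times a hyperbolic sine and every factor is real, so imaginary parts give a
  real statement.\<close>

lemma sinh_product_formula:
  "(\<lambda>n. pi * x * (\<Prod>k=1..n. 1 + x\<^sup>2 / (real k)\<^sup>2)) \<longlonglongrightarrow> (exp (pi * x) - exp (- (pi * x))) / 2"
proof -
  have lim: "(\<lambda>n. Im (of_real pi * (\<i> * of_real x) * (\<Prod>k=1..n. 1 - (\<i> * of_real x)\<^sup>2 / of_nat k ^ 2)))
      \<longlonglongrightarrow> Im (sin (of_real pi * (\<i> * of_real x)))"
    by (intro tendsto_Im sin_product_formula_complex)
  have eq: "Im (of_real pi * (\<i> * of_real x) * (\<Prod>k=1..n. 1 - (\<i> * of_real x)\<^sup>2 / of_nat k ^ 2))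
      = pi * x * (\<Prod>k=1..n. 1 + x\<^sup>2 / (real k)\<^sup>2)" for n
  proof -
    have "(\<Prod>k=1..n. 1 - (\<i> * of_real x)\<^sup>2 / of_nat k ^ 2)
        = (of_real (\<Prod>k=1..n. 1 + x\<^sup>2 / (real k)\<^sup>2) :: complex)"
      by (simp add: power_mult_distrib)
    then show ?thesis by (simp del: of_real_prod)
  qed
  show ?thesis using lim unfolding eq by (simp add: Im_sin)
qed

lemma ln_sinh_series:
  assumes "x > 0"
  shows "(\<lambda>n. ln (1 + x\<^sup>2 / (real (Suc n))\<^sup>2)) sums ln ((exp (pi * x) - exp (- (pi * x))) / (2 * pi * x))"
proof -
  have "(\<lambda>n. pi * x * (\<Prod>k=1..n. 1 + x\<^sup>2 / (real k)\<^sup>2) / (pi * x))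
      \<longlonglongrightarrow> (exp (pi * x) - exp (- (pi * x))) / 2 / (pi * x)"
    using assms by (intro tendsto_divide sinh_product_formula tendsto_const) auto
  then have "(\<lambda>n. \<Prod>k=1..n. 1 + x\<^sup>2 / (real k)\<^sup>2) \<longlonglongrightarrow> (exp (pi * x) - exp (- (pi * x))) / (2 * pi * x)"
    using assms by (simp add: field_simps)
  then have "(\<lambda>n. ln (\<Prod>k=1..n. 1 + x\<^sup>2 / (real k)\<^sup>2)) \<longlonglongrightarrow> ln ((exp (pi * x) - exp (- (pi * x))) / (2 * pi * x))"
    using assms by (intro tendsto_ln) auto
  moreover have "ln (\<Prod>k=1..n. 1 + x\<^sup>2 / (real k)\<^sup>2) = (\<Sum>k<n. ln (1 + x\<^sup>2 / (real (Suc k))\<^sup>2))" for n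
  proof -
    have pos: "(1 + x\<^sup>2 / (real k)\<^sup>2) > 0" for k
      by (smt (verit) zero_le_divide_iff zero_le_power2)
    have "1 + x\<^sup>2 / (real k)\<^sup>2 \<noteq> 0" for k using pos [of k] by linarith
    then have "ln (\<Prod>k=1..n. 1 + x\<^sup>2 / (real k)\<^sup>2) = (\<Sum>k=1..n. ln (1 + x\<^sup>2 / (real k)\<^sup>2))"
      by (intro ln_prod) auto
    also have "\<dots> = (\<Sum>k<n. ln (1 + x\<^sup>2 / (real (Suc k))\<^sup>2))"
      using sum.atLeast_Suc_atMost_Suc_shift [of "\<lambda>k. ln (1 + x\<^sup>2 / (real k)\<^sup>2)" 0 "n - 1"]
      by (cases n) (auto simp: atLeast0AtMost lessThan_Suc_atMost)
    finally show ?thesis .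
  qed
  ultimately show ?thesis by (simp add: sums_def)
qed

text \<open>This is pi * coth (pi * x), written so that dividing by \<open>k\<close> and summing
  over \<open>x = k * y\<close> shows a harmonic number and a Lambert series.\<close>

definition pi_coth :: "real \<Rightarrow> real" where
  "pi_coth x = pi * (1 + 2 / (exp (2 * pi * x) - 1))"

lemma summable_inverse_square: "summable (\<lambda>n. c / (real (Suc n))\<^sup>2)"
  using summable_mult [OF sums_summable [OF inverse_squares_sums], of c] by (simp add: add.commute)

text \<open>The logarithmic derivative of the product for sinh, taken termwise. On
  \<open>{0..x+1}\<close> the derivatives have a common majorant of order \<open>1 / n^2\<close>,
  and \<open>x\<close> is an interior point.\<close>

lemma pi_coth_series:
  assumes x: "x > 0"
  shows "(\<lambda>n. 2 * x / (x\<^sup>2 + (real (Suc n))\<^sup>2)) sums (pi_coth x - 1 / x)"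
proof -
  define f where "f n x = ln (1 + x\<^sup>2 / (real (Suc n))\<^sup>2)" for n x
  define f' where "f' n x = 2 * x / (x\<^sup>2 + (real (Suc n))\<^sup>2)" for n x
  define L where "L x = ln ((exp (pi * x) - exp (- (pi * x))) / (2 * pi * x))" for x :: real
  have bound: "\<bar>f' n t\<bar> \<le> 2 * (x + 1) / (real (Suc n))\<^sup>2" if "t \<in> {0..x+1}" for n t
    unfolding f'_def using that x by (auto simp: abs_div_pos intro!: frac_le add_nonneg_nonneg)
  have "(f n has_field_derivative f' n t) (at t within {0..x+1})" for n t
  proof -
    have *: "((\<lambda>t. ln (1 + t\<^sup>2 / c)) has_real_derivative 2 * t / (t\<^sup>2 + c)) (at t within {0..x+1})"
      if c: "c > 0" for c
    proof -
      have "0 < c + t\<^sup>2" using c by (simp add: add_pos_nonneg)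
      moreover have "0 < 1 + t\<^sup>2 / c" using c by (simp add: add_pos_nonneg)
      ultimately show ?thesis using c by (auto intro!: derivative_eq_intros simp: field_simps)
    qed
    show ?thesis unfolding f_def f'_def by (rule *) simp
  qed
  moreover have "uniformly_convergent_on {0..x+1} (\<lambda>n t. \<Sum>i<n. f' i t)"
    by (rule Weierstrass_m_test' [where M = "\<lambda>n. 2 * (x + 1) / (real (Suc n))\<^sup>2"])
       (use bound summable_inverse_square [of "2 * (x + 1)"] in auto)
  \<comment> \<open>Termwise differentiation asks for convergence at one point; at 0 every term is
    \<open>ln 1\<close>.\<close>
  moreover have "summable (\<lambda>n. f n 0)" by (simp add: f_def)
  ultimately have D: "((\<lambda>t. \<Sum>n. f n t) has_field_derivative (\<Sum>n. f' n x)) (at x)"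
    using x by (intro has_field_derivative_series' [of "{0..x+1}" f f' 0 x]) auto
  have "(L has_field_derivative (pi_coth x - 1 / x)) (at x)"
  proof -
    have e: "exp (- (pi * x)) < exp (pi * x)" using x by simp
    have e1: "exp (pi * x) * exp (pi * x) = exp (2 * pi * x)" by (simp add: exp_add [symmetric])
    have e2: "exp (- (pi * x)) = 1 / exp (pi * x)" by (simp add: exp_minus inverse_eq_divide)
    have e3: "exp (2 * pi * x) > 1" using x by simp
    have e4: "exp (pi * x) * exp (pi * x) > 1" using e1 e3 by simp
    have "(L has_field_derivative
       ((pi * exp (pi * x) + pi * exp (- (pi * x))) / (exp (pi * x) - exp (- (pi * x))) - 1 / x)) (at x)"
      unfolding L_def using x e by (auto intro!: derivative_eq_intros simp: field_simps)
    moreover have "(pi * exp (pi * x) + pi * exp (- (pi * x))) / (exp (pi * x) - exp (- (pi * x))) = pi_coth x"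
      unfolding pi_coth_def e1 [symmetric] e2 using e4 by (simp add: field_simps)
    ultimately show ?thesis by simp
  qed
  moreover have "eventually (\<lambda>t. (\<Sum>n. f n t) = L t) (nhds x)"
  proof -
    have "eventually (\<lambda>t. t \<in> {0<..}) (nhds x)" using x by (intro eventually_nhds_in_open) auto
    then show ?thesis
      
      by eventually_elim (use ln_sinh_series in \<open>simp add: f_def L_def sums_iff del: of_nat_Suc\<close>)
  qed
  ultimately have "((\<lambda>t. \<Sum>n. f n t) has_field_derivative (pi_coth x - 1 / x)) (at x)"
    by (subst DERIV_cong_ev [OF refl _ refl]) auto
  then have "(\<Sum>n. f' n x) = pi_coth x - 1 / x" using D by (rule DERIV_unique [rotated])
  moreover have "summable (\<lambda>n. f' n x)"
    by (rule summable_comparison_test' [OF summable_inverse_square [of "2 * (x + 1)"], of 0])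
       (use bound [of x] x in auto)
  ultimately show ?thesis unfolding f'_def by (metis summable_sums)
qed

section \<open>Tails of the partial fractions and their Riemann sums\<close>

text \<open>An integral test: the derivative of \<open>arctan (a / t)\<close> is
  \<open>- a / (a^2 + t^2)\<close>, so \<open>arctan (a / M)\<close> is the integral of the summand
  over all \<open>t \<ge> M\<close>. It lies between two sums that differ by one term; the mean
  value theorem on unit steps replaces the improper integral by a telescoping series.\<close>

lemma arctan_tail_bounds:
  fixes a :: real
  assumes a: "a > 0" and M: "M \<ge> 1"
  shows "summable (\<lambda>m. a / (a\<^sup>2 + (real (M + Suc m))\<^sup>2))" (is "summable ?g")
    and "\<bar>arctan (a / real M) - (\<Sum>m. a / (a\<^sup>2 + (real (M + Suc m))\<^sup>2))\<bar> \<le> a / (real M)\<^sup>2"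
proof -
  define h where "h m = arctan (a / real (M + m))" for m
  have step: "a / (a\<^sup>2 + (real (M + Suc m))\<^sup>2) \<le> h m - h (Suc m)
      \<and> h m - h (Suc m) \<le> a / (a\<^sup>2 + (real (M + m))\<^sup>2)" for m
  proof -
    have "\<exists>z. real (M + m) < z \<and> z < real (M + Suc m) \<and>
        arctan (a / real (M + Suc m)) - arctan (a / real (M + m))
        = (real (M + Suc m) - real (M + m)) * (- (a / (a\<^sup>2 + z\<^sup>2)))"
    proof (rule MVT2)
      fix t assume t: "real (M + m) \<le> t"
      then have "t > 0" using M by simp
      then show "((\<lambda>t. arctan (a / t)) has_real_derivative - (a / (a\<^sup>2 + t\<^sup>2))) (at t)"
        using a by (auto intro!: derivative_eq_intros simp: field_simps power2_eq_square add_nonneg_pos)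
    qed simp
    then obtain z where z: "real (M + m) < z" "z < real (M + Suc m)"
      "h m - h (Suc m) = a / (a\<^sup>2 + z\<^sup>2)" by (auto simp: h_def)
    have "z\<^sup>2 \<le> (real (M + Suc m))\<^sup>2" "(real (M + m))\<^sup>2 \<le> z\<^sup>2"
      using z by (auto intro!: power_mono)
    then show ?thesis unfolding z(3) using a z
      by (intro conjI divide_left_mono mult_pos_pos) (auto intro: add_pos_nonneg)
  qed
  have "h \<longlonglongrightarrow> 0" 
  proof -
    have "(\<lambda>m. a / real (M + m)) \<longlonglongrightarrow> 0" by real_asymp
    then show ?thesis unfolding h_def using tendsto_arctan by fastforce
  qed
  then have h: "(\<lambda>m. h m - h (Suc m)) sums h 0" using telescope_sums' by fastforce
  show sg: "summable ?g"
    by (rule summable_comparison_test' [OF sums_summable [OF h], of 0])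
       (use step a in \<open>auto simp: abs_div_pos add_pos_nonneg\<close>)
  have 1: "suminf ?g \<le> h 0"
    using sums_le [OF _ summable_sums [OF sg] h] step by auto
  let ?g' = "\<lambda>m. a / (a\<^sup>2 + (real (M + m))\<^sup>2)"
  have sg': "summable ?g'" using sg summable_Suc_iff [of ?g'] by simp
  have "h 0 \<le> suminf ?g'"
    using sums_le [OF _ h summable_sums [OF sg']] step by auto
  also have "suminf ?g' = suminf ?g + a / (a\<^sup>2 + (real M)\<^sup>2)"
    using suminf_split_head [OF sg'] by simp
  also have "a / (a\<^sup>2 + (real M)\<^sup>2) \<le> a / (real M)\<^sup>2"
    using a M by (intro divide_left_mono) (auto intro!: mult_pos_pos add_pos_nonneg)
  finally show "\<bar>arctan (a / real M) - suminf ?g\<bar> \<le> a / (real M)\<^sup>2"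
    using 1 by (simp add: h_def abs_le_iff)
qed

text \<open>On each cell a decreasing function errs by at most its drop divided by \<open>N\<close>,
  and the drops telescope. Upper and lower bounds are carried together along the grid, up to an
  arbitrary grid point, so that the induction closes.\<close>

lemma antimono_riemann_sum:
  fixes G :: "real \<Rightarrow> real"
  assumes anti: "antimono_on {0..1} G" and int: "G integrable_on {0..1}" and N: "N \<ge> 1"
  shows "\<bar>(\<Sum>k=1..N. G (real k / real N)) / real N - integral {0..1} G\<bar> \<le> (G 0 - G 1) / real N"
proof -
  let ?x = "\<lambda>k. real k / real N"
  have A: "integral {0..?x m} G \<ge> (\<Sum>k=1..m. G (?x k)) / real N \<and>
        integral {0..?x m} G \<le> (\<Sum>k=1..m. G (?x k)) / real N + (G 0 - G (?x m)) / real N" if "m \<le> N" for m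
    using that
  proof (induction m)
    case (Suc m)
    have le: "0 \<le> ?x m" "?x m \<le> ?x (Suc m)" "?x (Suc m) \<le> 1"
      using Suc.prems N by (auto simp: field_simps)
    have i: "G integrable_on {0..?x (Suc m)}" "G integrable_on {?x m..?x (Suc m)}"
      by (rule integrable_on_subinterval [OF int], use le in \<open>simp del: of_nat_Suc\<close>)+
    have eq: "integral {0..?x m} G + integral {?x m..?x (Suc m)} G = integral {0..?x (Suc m)} G"
      using le i by (intro Henstock_Kurzweil_Integration.integral_combine) auto
    have w: "?x (Suc m) - ?x m = 1 / real N" using N by (simp add: field_simps)
    have bd: "G (?x (Suc m)) \<le> G t \<and> G t \<le> G (?x m)" if t: "t \<in> {?x m..?x (Suc m)}" for t
    proof -
      have "?x m \<in> {0..1}" "?x (Suc m) \<in> {0..1}" "t \<in> {0..1}" "?x m \<le> t" "t \<le> ?x (Suc m)"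
        using le t unfolding atLeastAtMost_iff by linarith+
      then show ?thesis using anti unfolding monotone_on_def by blast
    qed
    have "integral {?x m..?x (Suc m)} G \<ge> integral {?x m..?x (Suc m)} (\<lambda>_. G (?x (Suc m)))"
      by (rule integral_le) (use i bd in auto)
    moreover have "integral {?x m..?x (Suc m)} G \<le> integral {?x m..?x (Suc m)} (\<lambda>_. G (?x m))"
      by (rule integral_le) (use i bd in auto)
    ultimately have "G (?x (Suc m)) / real N \<le> integral {?x m..?x (Suc m)} G"
      "integral {?x m..?x (Suc m)} G \<le> G (?x m) / real N"
      using le w by auto
    then show ?case using Suc eq by (auto simp: add_divide_distrib diff_divide_distrib)
  qed auto
  show ?thesis using A [of N] N by (auto simp: abs_le_iff diff_divide_distrib)
qed

lemma arctan_over_antimono: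
  assumes "0 < x" "x \<le> y"
  shows "arctan y / y \<le> arctan x / x"
proof (rule DERIV_nonpos_imp_nonincreasing [OF assms(2)])
  fix t assume "x \<le> t" "t \<le> y"
  then have t: "t > 0" using assms by simp
  obtain z where z: "0 < z" "z < t" "arctan t - arctan 0 = (t - 0) * (1 / (1 + z\<^sup>2))"
    using MVT2 [of 0 t arctan "\<lambda>z. 1 / (1 + z\<^sup>2)"] t DERIV_arctan by (auto simp: inverse_eq_divide)
  have "t / (1 + t\<^sup>2) \<le> t / (1 + z\<^sup>2)"
    using t z by (intro divide_left_mono) (auto intro!: power_mono mult_pos_pos add_pos_nonneg)
  then have "t / (1 + t\<^sup>2) - arctan t \<le> 0" using z by simp
  moreover have "((\<lambda>t. arctan t / t) has_real_derivative (t / (1 + t\<^sup>2) - arctan t) / t\<^sup>2) (at t)"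
    using t by (auto intro!: derivative_eq_intros simp: field_simps power2_eq_square)
  ultimately show "\<exists>y. ((\<lambda>t. arctan t / t) has_real_derivative y) (at t) \<and> y \<le> 0"
    by (auto simp: divide_nonpos_nonneg)
qed

text \<open>Since \<open>1 / k = (1 / (k / N)) / N\<close>, this is a Riemann sum of
  \<open>arctan x / x\<close> over the unit interval. The limit (Catalan's constant) later cancels
  between the row strip and the column strip.\<close>

lemma arctan_riemann_sum_convergent:
  "convergent (\<lambda>N. \<Sum>k=1..N. arctan (real k / real N) / real k)"
proof -
  define G :: "real \<Rightarrow> real" where "G x = (if x = 0 then 1 else arctan x / x)" for x
  have lim: "((\<lambda>x. arctan x / x) \<longlongrightarrow> (1 :: real)) (at 0)" by real_asymp
  have contG: "continuous_on UNIV G"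
  proof -
    have "isCont G x" for x
    proof (cases "x = 0")
      case True
      have "(G \<longlongrightarrow> 1) (at 0)"
        using lim by (rule Lim_transform_eventually) (auto simp: G_def eventually_at_filter)
      then show ?thesis using True by (simp add: isCont_def G_def)
    next
      case False
      have "isCont (\<lambda>x. arctan x / x) x" using False by (intro continuous_intros) auto
      moreover have "eventually (\<lambda>t. G t = arctan t / t) (nhds x)"
      proof -
        have "eventually (\<lambda>t. t \<in> - {0}) (nhds x)" using False by (intro eventually_nhds_in_open) auto
        then show ?thesis by eventually_elim (auto simp: G_def)
      qed
      ultimately show ?thesis using isCont_cong [of G "\<lambda>t. arctan t / t" x] by blast
    qed
    then show ?thesis by (simp add: continuous_at_imp_continuous_on)
  qed
  have le1: "arctan y / y \<le> 1" if "0 < y" for y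
    using arctan_le_self [of y] that by simp
  have "antimono_on {0..1} G"
    by (auto simp: monotone_on_def G_def intro: arctan_over_antimono le1 arctan_le_self)
  moreover have "G integrable_on {0..1}"
    by (intro integrable_continuous_interval continuous_on_subset [OF contG]) auto
  ultimately have R: "\<bar>(\<Sum>k=1..N. G (real k / real N)) / real N - integral {0..1} G\<bar> \<le> (G 0 - G 1) / real N"
    if "N \<ge> 1" for N using antimono_riemann_sum that by blast
  have eq: "(\<Sum>k=1..N. G (real k / real N)) / real N = (\<Sum>k=1..N. arctan (real k / real N) / real k)" for N
    unfolding sum_divide_distrib by (rule sum.cong) (auto simp: G_def)
  have "(\<lambda>N. (\<Sum>k=1..N. arctan (real k / real N) / real k) - integral {0..1} G) \<longlonglongrightarrow> 0"
  proof (rule Lim_null_comparison)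
    show "eventually (\<lambda>N. norm ((\<Sum>k=1..N. arctan (real k / real N) / real k) - integral {0..1} G)
        \<le> (G 0 - G 1) / real N) sequentially"
      using eventually_ge_at_top [of 1] by eventually_elim (use R eq in auto)
    show "(\<lambda>N. (G 0 - G 1) / real N) \<longlonglongrightarrow> 0" by real_asymp
  qed
  then show ?thesis unfolding convergent_def by (auto simp: LIM_zero_iff)
qed

lemma sum_1_to_n_shift: "(\<Sum>k=1..n. f k) = (\<Sum>k<n. f (Suc k))"
  by (simp add: sum.atLeast1_atMost_eq)

definition arctan_tail :: "real \<Rightarrow> nat \<Rightarrow> real" where
  "arctan_tail a M = (\<Sum>m. a / (a\<^sup>2 + (real (M + Suc m))\<^sup>2))"

lemma pi_coth_split:
  assumes a: "a > 0"
  shows "pi_coth a = 1 / a + 2 * (\<Sum>m=1..M. a / (a\<^sup>2 + (real m)\<^sup>2)) + 2 * arctan_tail a M"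
proof -
  let ?f = "\<lambda>n. 2 * (a / (a\<^sup>2 + (real (Suc n))\<^sup>2))"
  have s: "?f sums (pi_coth a - 1 / a)" using pi_coth_series [OF a] by simp
  then have "pi_coth a - 1 / a = (\<Sum>n. ?f (n + M)) + (\<Sum>n<M. ?f n)"
    using suminf_split_initial_segment [OF sums_summable [OF s], of M] sums_unique [OF s] by simp
  moreover have "summable (\<lambda>n. ?f (n + M))"
    using sums_summable [OF s] by (subst summable_iff_shift)
  then have "summable (\<lambda>n. 1 / 2 * ?f (n + M))" by (rule summable_mult)
  then have "summable (\<lambda>m. a / (a\<^sup>2 + (real (M + Suc m))\<^sup>2))" by (simp add: add.commute)
  then have "(\<Sum>n. ?f (n + M)) = 2 * arctan_tail a M"
    unfolding arctan_tail_def by (subst suminf_mult [symmetric]) (simp_all add: add.commute)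
  moreover have "(\<Sum>n<M. ?f n) = 2 * (\<Sum>m=1..M. a / (a\<^sup>2 + (real m)\<^sup>2))"
    unfolding sum_1_to_n_shift sum_distrib_left by simp
  ultimately show ?thesis by simp
qed

text \<open>
  Writing the two sums as double series over the strips \<open>k \<le> N\<close> and \<open>m \<le> M\<close> of the same function,
  the common square cancels; what remains are the tails of the two strips.
\<close>

lemma pi_coth_sum_difference:
  fixes M N :: nat
  assumes M: "M \<ge> 1" and N: "N \<ge> 1"
  defines "y \<equiv> real M / real N"
  shows "\<bar>(\<Sum>k=1..N. pi_coth (real k * y) / real k) - (\<Sum>m=1..M. pi_coth (real m / y) / real m)
     - ((1 / y) * (\<Sum>k=1..N. 1 / (real k)\<^sup>2) - y * (\<Sum>m=1..M. 1 / (real m)\<^sup>2))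
     - 2 * ((\<Sum>k=1..N. arctan (real k / real N) / real k) - (\<Sum>m=1..M. arctan (real m / real M) / real m))\<bar>
     \<le> 2 / real M + 2 / real N"
proof -
  have y: "y > 0" using M N by (simp add: y_def)
  \<comment> \<open>The common summand: the partial fraction at \<open>a = k * y\<close> divided by
    \<open>k\<close>, and equally the one at \<open>a = m / y\<close>, with \<open>k\<close> as
    running index, divided by \<open>m\<close>.\<close>
  define g where "g k m = y / ((real k * y)\<^sup>2 + (real m)\<^sup>2)" for k m :: nat
  have 1: "(\<Sum>k=1..N. pi_coth (real k * y) / real k)
     = (1 / y) * (\<Sum>k=1..N. 1 / (real k)\<^sup>2) + 2 * (\<Sum>k=1..N. \<Sum>m=1..M. g k m)
      + 2 * (\<Sum>k=1..N. arctan_tail (real k * y) M / real k)"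
  proof -
    have "pi_coth (real k * y) / real k = (1 / y) * (1 / (real k)\<^sup>2) + 2 * (\<Sum>m=1..M. g k m)
       + 2 * (arctan_tail (real k * y) M / real k)" if k: "k \<in> {1..N}" for k
    proof -
      have "(\<Sum>m=1..M. real k * y / ((real k * y)\<^sup>2 + (real m)\<^sup>2)) = real k * (\<Sum>m=1..M. g k m)"
        unfolding sum_distrib_left g_def by simp
      moreover have "real k * y > 0" using k y by simp
      ultimately show ?thesis using k y
        unfolding pi_coth_split [of "real k * y" M, OF \<open>real k * y > 0\<close>]
        by (simp add: add_divide_distrib power2_eq_square mult_ac)
    qed
    then show ?thesis by (simp add: sum.distrib sum_distrib_left)
  qed
  have 2: "(\<Sum>m=1..M. pi_coth (real m / y) / real m)
     = y * (\<Sum>m=1..M. 1 / (real m)\<^sup>2) + 2 * (\<Sum>m=1..M. \<Sum>k=1..N. g k m)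
      + 2 * (\<Sum>m=1..M. arctan_tail (real m / y) N / real m)"
  proof -
    have "pi_coth (real m / y) / real m = y * (1 / (real m)\<^sup>2) + 2 * (\<Sum>k=1..N. g k m)
       + 2 * (arctan_tail (real m / y) N / real m)" if m: "m \<in> {1..M}" for m
    proof -
      have "(real m / y) / ((real m / y)\<^sup>2 + (real k)\<^sup>2) = real m * g k m" for k :: nat
      proof -
        have "(real m / y)\<^sup>2 + (real k)\<^sup>2 = ((real k * y)\<^sup>2 + (real m)\<^sup>2) / y\<^sup>2"
          using y by (simp add: field_simps)
        then show ?thesis using y by (simp add: g_def power2_eq_square)
      qed
      then have "(\<Sum>k=1..N. real m / y / ((real m / y)\<^sup>2 + (real k)\<^sup>2)) = real m * (\<Sum>k=1..N. g k m)"
        unfolding sum_distrib_left by simp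
      moreover have "real m / y > 0" using m y by simp
      ultimately show ?thesis using m y
        unfolding pi_coth_split [of "real m / y" N, OF \<open>real m / y > 0\<close>]
        by (simp add: add_divide_distrib power2_eq_square mult_ac)
    qed
    then show ?thesis by (simp add: sum.distrib sum_distrib_left)
  qed
  have 3: "(\<Sum>m=1..M. \<Sum>k=1..N. g k m) = (\<Sum>k=1..N. \<Sum>m=1..M. g k m)" by (rule sum.swap)
  have 4: "\<bar>(\<Sum>k=1..N. arctan (real k / real N) / real k) - (\<Sum>k=1..N. arctan_tail (real k * y) M / real k)\<bar> \<le> 1 / real M"
  proof -
    have "\<bar>arctan (real k / real N) / real k - arctan_tail (real k * y) M / real k\<bar> \<le> y / (real M)\<^sup>2"
      if k: "k \<in> {1..N}" for k
    proof -
      have "\<bar>arctan (real k * y / real M) - arctan_tail (real k * y) M\<bar> \<le> real k * y / (real M)\<^sup>2"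
        unfolding arctan_tail_def using k y M by (intro arctan_tail_bounds) auto
      moreover have "real k * y / real M = real k / real N" using M N by (simp add: y_def)
      ultimately have "\<bar>arctan (real k / real N) - arctan_tail (real k * y) M\<bar> / real k
          \<le> real k * y / (real M)\<^sup>2 / real k"
        by (intro divide_right_mono) auto
      then show ?thesis using k by (simp add: abs_divide flip: diff_divide_distrib)
    qed
    then have "\<bar>\<Sum>k=1..N. arctan (real k / real N) / real k - arctan_tail (real k * y) M / real k\<bar>
        \<le> (\<Sum>k=1..N. y / (real M)\<^sup>2)"
      by (intro order_trans [OF sum_abs] sum_mono) auto
    \<comment> \<open>There are \<open>N\<close> terms of size \<open>y / M^2\<close>, and
      \<open>N * y = M\<close>.\<close>
    also have "\<dots> = 1 / real M" using M N by (simp add: y_def power2_eq_square)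
    finally show ?thesis by (simp add: sum_subtractf)
  qed
  have 5: "\<bar>(\<Sum>m=1..M. arctan (real m / real M) / real m) - (\<Sum>m=1..M. arctan_tail (real m / y) N / real m)\<bar> \<le> 1 / real N"
  proof -
    have "\<bar>arctan (real m / real M) / real m - arctan_tail (real m / y) N / real m\<bar> \<le> (1 / y) / (real N)\<^sup>2"
      if m: "m \<in> {1..M}" for m
    proof -
      have "\<bar>arctan (real m / y / real N) - arctan_tail (real m / y) N\<bar> \<le> real m / y / (real N)\<^sup>2"
        unfolding arctan_tail_def using m y N by (intro arctan_tail_bounds) auto
      moreover have "real m / y / real N = real m / real M" using M N by (simp add: y_def)
      ultimately have "\<bar>arctan (real m / real M) - arctan_tail (real m / y) N\<bar> / real m
          \<le> real m / y / (real N)\<^sup>2 / real m"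
        by (intro divide_right_mono) auto
      then show ?thesis using m by (simp add: abs_divide flip: diff_divide_distrib)
    qed
    then have "\<bar>\<Sum>m=1..M. arctan (real m / real M) / real m - arctan_tail (real m / y) N / real m\<bar>
        \<le> (\<Sum>m=1..M. (1 / y) / (real N)\<^sup>2)"
      by (intro order_trans [OF sum_abs] sum_mono) auto
    also have "\<dots> = 1 / real N" using M N by (simp add: y_def power2_eq_square)
    finally show ?thesis by (simp add: sum_subtractf)
  qed
  have "\<bar>a - b - (u - v) - 2 * (r - r')\<bar> \<le> 2 * m + 2 * n"
    if "a = u + 2 * g + 2 * t" "b = v + 2 * g' + 2 * t'" "g' = g" "\<bar>r - t\<bar> \<le> m" "\<bar>r' - t'\<bar> \<le> n"
    for a b u v g g' t t' r r' m n :: real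
    using that by (smt (verit))
  from this [OF 1 2 3 4 5] show ?thesis by simp
qed

text \<open>The negative logarithm of Euler's product at \<open>exp (- 2 * pi * y)\<close>, with the
  series of the logarithms already summed over the other index.\<close>

definition euler_log :: "real \<Rightarrow> real" where
  "euler_log y = (\<Sum>k. 1 / (real (Suc k) * (exp (2 * pi * real (Suc k) * y) - 1)))"

lemma summable_euler_log:
  assumes y: "y > 0"
  shows "summable (\<lambda>k. 1 / (real (Suc k) * (exp (2 * pi * real (Suc k) * y) - 1)))"
proof (rule summable_comparison_test' [OF summable_inverse_square [of "1 / (2 * pi * y)"], of 0])
  fix k
  define c where "c = real (Suc k)"
  have c: "c > 0" by (simp add: c_def)
  have "2 * pi * c * y \<le> exp (2 * pi * c * y) - 1"
    using exp_ge_add_one_self [of "2 * pi * c * y"] by linarith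
  then have "c * (2 * pi * c * y) \<le> c * (exp (2 * pi * c * y) - 1)"
    using c by (intro mult_left_mono) auto
  moreover have "0 < c * (2 * pi * c * y)" using c y by simp
  ultimately have "\<bar>1 / (c * (exp (2 * pi * c * y) - 1))\<bar> \<le> 1 / (c * (2 * pi * c * y))"
    using c y by (auto intro!: divide_left_mono mult_pos_pos simp: abs_div_pos)
  then show "norm (1 / (real (Suc k) * (exp (2 * pi * real (Suc k) * y) - 1))) \<le> 1 / (2 * pi * y) / (real (Suc k))\<^sup>2"
    unfolding c_def [symmetric] by (simp add: power2_eq_square mult_ac)
qed

lemma pi_coth_sum_euler_log:
  "(\<Sum>k=1..N. pi_coth (real k * y) / real k)
   = pi * harm N + 2 * pi * (\<Sum>k<N. 1 / (real (Suc k) * (exp (2 * pi * real (Suc k) * y) - 1)))"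
  unfolding harm_def sum_1_to_n_shift sum_distrib_left sum.distrib [symmetric] pi_coth_def
proof (rule sum.cong)
  fix k
  have "exp (2 * pi * (real (Suc k) * y)) = exp (2 * pi * real (Suc k) * y)" by (simp only: mult.assoc)
  then show "pi * (1 + 2 / (exp (2 * pi * (real (Suc k) * y)) - 1)) / real (Suc k)
      = pi * inverse (of_nat (Suc k)) + 2 * pi * (1 / (real (Suc k) * (exp (2 * pi * real (Suc k) * y) - 1)))"
    by (simp add: distrib_left add_divide_distrib inverse_eq_divide mult.commute)
qed auto

text \<open>The truncations \<open>M = r * Suc j\<close> and \<open>N = s * Suc j\<close> keep
  \<open>M / N\<close> equal to \<open>y\<close> for every \<open>j\<close>. As \<open>j\<close>
  grows, the inverse squares give \<open>pi^2 / 6\<close> twice, the Euler constants in the harmonic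
  numbers cancel and leave \<open>- ln y\<close>, and the two arctangent sums share one
  limit.\<close>

lemma euler_log_inverse_rat:
  fixes r s :: nat
  assumes r: "r \<ge> 1" and s: "s \<ge> 1"
  defines "y \<equiv> real r / real s"
  shows "euler_log y - euler_log (1 / y) = ln y / 2 + pi / 12 * (1 / y - y)"
proof -
  have y: "y > 0" using r s by (simp add: y_def)
  define A where "A z N = (\<Sum>k<N. 1 / (real (Suc k) * (exp (2 * pi * real (Suc k) * z) - 1)))" for z N
  define Q where "Q N = (\<Sum>k=1..N. 1 / (real k)\<^sup>2)" for N
  define R where "R N = (\<Sum>k=1..N. arctan (real k / real N) / real k)" for N
  have sub: "strict_mono (\<lambda>j. r * Suc j)" "strict_mono (\<lambda>j. s * Suc j)"
    using r s by (auto intro!: strict_monoI_Suc)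
  have A: "A z \<longlonglongrightarrow> euler_log z" if "z > 0" for z
    using summable_LIMSEQ [OF summable_euler_log [OF that]] unfolding A_def euler_log_def .
  have Q: "Q \<longlonglongrightarrow> pi\<^sup>2 / 6"
    using inverse_squares_sums unfolding sums_def Q_def sum_1_to_n_shift by (simp add: add.commute)
  obtain c where R: "R \<longlonglongrightarrow> c"
    using arctan_riemann_sum_convergent unfolding R_def convergent_def by blast
  define D where "D j = (pi * harm (s * Suc j) + 2 * pi * A y (s * Suc j))
      - (pi * harm (r * Suc j) + 2 * pi * A (1 / y) (r * Suc j))
      - ((1 / y) * Q (s * Suc j) - y * Q (r * Suc j)) - 2 * (R (s * Suc j) - R (r * Suc j))" for j
  have B: "\<bar>D j\<bar> \<le> 2 / real (r * Suc j) + 2 / real (s * Suc j)" for j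
  proof -
    have y': "real (r * Suc j) / real (s * Suc j) = y"
      unfolding y_def of_nat_mult by (rule mult_divide_mult_cancel_right) simp
    have inv: "real m / y = real m * (1 / y)" for m by simp
    have "r * Suc j \<ge> 1" "s * Suc j \<ge> 1" using r s by auto
    from pi_coth_sum_difference [OF this] show ?thesis
      unfolding y' inv pi_coth_sum_euler_log D_def A_def Q_def R_def .
  qed
  have L: "(\<lambda>j. 2 / real (r * Suc j) + 2 / real (s * Suc j)) \<longlonglongrightarrow> 0"
  proof -
    have "(\<lambda>j. 2 / (real r * real (Suc j)) + 2 / (real s * real (Suc j))) \<longlonglongrightarrow> 0" using r s by real_asymp
    then show ?thesis unfolding of_nat_mult .
  qed
  have D0: "D \<longlonglongrightarrow> 0"
  proof (rule Lim_null_comparison [OF _ L])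
    show "eventually (\<lambda>j. norm (D j) \<le> 2 / real (r * Suc j) + 2 / real (s * Suc j)) sequentially"
      using B by (intro always_eventually allI) (simp only: real_norm_def)
  qed
  have harm: "(\<lambda>j. harm (s * Suc j) - harm (r * Suc j) + ln y) \<longlonglongrightarrow> 0"
  proof -
    have lim: "(\<lambda>j. (harm (s * Suc j) - ln (real (s * Suc j))) - (harm (r * Suc j) - ln (real (r * Suc j))))
        \<longlonglongrightarrow> euler_mascheroni - euler_mascheroni"
      using LIMSEQ_subseq_LIMSEQ [OF euler_mascheroni_LIMSEQ sub(2)]
        LIMSEQ_subseq_LIMSEQ [OF euler_mascheroni_LIMSEQ sub(1)]
      by (intro tendsto_diff) (auto simp: o_def)
    have "ln (real (r * Suc j)) - ln (real (s * Suc j)) = ln y" for j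
    proof -
      have "real (r * Suc j) > 0" "real (s * Suc j) > 0"
        using r s by (simp_all only: of_nat_0_less_iff nat_0_less_mult_iff zero_less_Suc simp_thms)
      then have "ln (real (r * Suc j) / real (s * Suc j)) = ln (real (r * Suc j)) - ln (real (s * Suc j))"
        by (rule ln_divide_pos)
      moreover have "real (r * Suc j) / real (s * Suc j) = y"
        unfolding y_def of_nat_mult by (rule mult_divide_mult_cancel_right) simp
      ultimately show ?thesis by (simp only:)
    qed
    then have eq: "(harm (s * Suc j) - ln (real (s * Suc j))) - (harm (r * Suc j) - ln (real (r * Suc j)))
        = harm (s * Suc j) - harm (r * Suc j) + ln y" for j
      by (metis (no_types, lifting) diff_add_eq diff_diff_eq2 add_diff_eq add.commute)
    show ?thesis using lim unfolding eq by (simp only: diff_self)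
  qed
  have Deq: "D = (\<lambda>j. pi * (harm (s * Suc j) - harm (r * Suc j) + ln y) - pi * ln y
      + 2 * pi * (A y (s * Suc j) - A (1 / y) (r * Suc j))
      - ((1 / y) * Q (s * Suc j) - y * Q (r * Suc j)) - 2 * (R (s * Suc j) - R (r * Suc j)))"
    by (rule ext) (simp add: D_def algebra_simps)
  have "D \<longlonglongrightarrow> pi * 0 - pi * ln y + 2 * pi * (euler_log y - euler_log (1 / y))
      - ((1 / y) * (pi\<^sup>2 / 6) - y * (pi\<^sup>2 / 6)) - 2 * (c - c)"
    unfolding Deq
    using y by (intro tendsto_intros harm
        LIMSEQ_subseq_LIMSEQ [OF A sub(1), unfolded o_def] LIMSEQ_subseq_LIMSEQ [OF A sub(2), unfolded o_def]
        LIMSEQ_subseq_LIMSEQ [OF Q sub(1), unfolded o_def] LIMSEQ_subseq_LIMSEQ [OF Q sub(2), unfolded o_def]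
        LIMSEQ_subseq_LIMSEQ [OF R sub(1), unfolded o_def] LIMSEQ_subseq_LIMSEQ [OF R sub(2), unfolded o_def]) auto
  then have "pi * 0 - pi * ln y + 2 * pi * (euler_log y - euler_log (1 / y))
      - ((1 / y) * (pi\<^sup>2 / 6) - y * (pi\<^sup>2 / 6)) - 2 * (c - c) = 0"
    using D0 LIMSEQ_unique by blast
  moreover have "e = l / 2 + pi / 12 * (u - y)"
    if "pi * 0 - pi * l + 2 * pi * e - (u * (pi\<^sup>2 / 6) - y * (pi\<^sup>2 / 6)) - 2 * (c - c) = 0" for e l u
  proof -
    have "pi * (2 * e - l - (u - y) * (pi / 6)) = 0"
      using that by (simp add: field_simps power2_eq_square)
    then have "2 * e - l - (u - y) * (pi / 6) = 0" by (simp only: mult_eq_0_iff pi_neq_zero simp_thms)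
    then show ?thesis by (simp add: field_simps)
  qed
  ultimately show ?thesis by blast
qed

subsection \<open>Euler's product\<close>

definition euler_fun :: "complex \<Rightarrow> complex" where
  "euler_fun q = qpoch_inf q q"

lemma euler_fun_has_prod:
  assumes "norm q < 1"
  shows "(\<lambda>n. 1 - q ^ Suc n) has_prod euler_fun q"
proof -
  have "summable (\<lambda>n. norm (q ^ Suc n))"
    unfolding norm_power by (subst summable_Suc_iff) (use assms in \<open>simp add: summable_geometric\<close>)
  then have "convergent_prod (\<lambda>n. 1 - q ^ Suc n)"
    by (intro abs_convergent_prod_imp_convergent_prod) (simp add: abs_convergent_prod_conv_summable)
  then show ?thesis unfolding euler_fun_def qpoch_inf_def
    by (simp add: convergent_prod_has_prod_iff)
qed

lemma euler_fun_nonzero: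
  assumes "norm q < 1"
  shows "euler_fun q \<noteq> 0"
proof -
  have "q ^ Suc n \<noteq> 1" for n
  proof
    assume "q ^ Suc n = 1"
    then have "norm q ^ Suc n = 1" by (metis norm_one norm_power)
    moreover have "norm q ^ Suc n \<le> norm q ^ 1" using assms by (intro power_decreasing) auto
    ultimately show False using assms by simp
  qed
  then have "0 \<notin> range (\<lambda>n. 1 - q ^ Suc n)"
    by (smt (verit) eq_iff_diff_eq_0 rangeE)
  then show ?thesis using has_prod_eq_0_iff [OF euler_fun_has_prod [OF assms]] by simp
qed

lemma euler_fun_holomorphic: "euler_fun holomorphic_on ball 0 1"
proof (rule holomorphic_uniform_sequence [OF open_ball])
  show "(\<lambda>q. \<Prod>n<N. 1 - q ^ Suc n) holomorphic_on ball 0 1" for N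
    by (intro holomorphic_intros)
  fix x :: complex assume x: "x \<in> ball 0 1"
  \<comment> \<open>Half the distance to the unit circle: the closed disc stays within radius
    \<open>r < 1\<close>, which gives a geometric majorant.\<close>
  define d where "d = (1 - norm x) / 2"
  define r where "r = norm x + d"
  have d: "d > 0" and r: "0 \<le> r" "r < 1" using x by (auto simp: d_def r_def field_simps add_nonneg_nonneg)
  have nr: "norm q \<le> r" if "q \<in> cball x d" for q
    using that norm_triangle_ineq2 [of q x] by (auto simp: r_def dist_norm norm_minus_commute)
  have "uniformly_convergent_on (cball x d) (\<lambda>N q. \<Prod>n<N. 1 - q ^ Suc n)"
  proof (rule uniformly_convergent_on_prod')
    show "uniformly_convergent_on (cball x d) (\<lambda>N q. \<Sum>n<N. norm (1 - q ^ Suc n - 1))"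
    proof (rule Weierstrass_m_test')
      show "summable (\<lambda>n. r ^ Suc n)" by (subst summable_Suc_iff) (use r in \<open>simp add: summable_geometric\<close>)
      show "norm (norm (1 - q ^ Suc n - 1)) \<le> r ^ Suc n" if "q \<in> cball x d" for q n
        using power_mono [OF nr [OF that], of "Suc n"] by (simp add: norm_power norm_mult)
    qed
  qed (auto intro!: continuous_intros)
  then obtain l where l: "uniform_limit (cball x d) (\<lambda>N q. \<Prod>n<N. 1 - q ^ Suc n) l sequentially"
    by (auto simp: uniformly_convergent_on_def)
  have "l q = euler_fun q" if "q \<in> cball x d" for q
  proof -
    have "(\<lambda>N. \<Prod>n<N. 1 - q ^ Suc n) \<longlonglongrightarrow> l q" using tendsto_uniform_limitI [OF l that] .
    moreover have "(\<lambda>N. \<Prod>n<N. 1 - q ^ Suc n) \<longlonglongrightarrow> euler_fun q"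
      by (rule has_prod_imp_tendsto' [OF euler_fun_has_prod]) (use nr [OF that] r in simp)
    ultimately show ?thesis by (rule LIMSEQ_unique)
  qed
  then have "uniform_limit (cball x d) (\<lambda>N q. \<Prod>n<N. 1 - q ^ Suc n) euler_fun sequentially"
    using l by (metis (mono_tags, lifting) uniform_limit_cong')
  moreover have "cball x d \<subseteq> ball 0 1" using nr r by fastforce
  ultimately show "\<exists>d>0. cball x d \<subseteq> ball 0 1 \<and>
      uniform_limit (cball x d) (\<lambda>N q. \<Prod>n<N. 1 - q ^ Suc n) euler_fun sequentially"
    using d by blast
qed

lemma euler_fun_0: "euler_fun 0 = 1"
proof -
  have "(\<lambda>n. 1 - (0 :: complex) ^ Suc n) = (\<lambda>n. 1)" by simp
  then have "(\<lambda>n. 1 - (0 :: complex) ^ Suc n) has_prod 1" by (simp only: has_prod_one)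
  moreover have "(\<lambda>n. 1 - (0 :: complex) ^ Suc n) has_prod euler_fun 0"
    by (rule euler_fun_has_prod) (simp only: norm_zero zero_less_one)
  ultimately show ?thesis using has_prod_unique2 by blast
qed

lemma has_sum_geometric_real:
  assumes "0 < t" "t < (1::real)"
  shows "((\<lambda>m. t ^ Suc m) has_sum (t / (1 - t))) UNIV"
proof -
  have "(\<lambda>m. t * t ^ m) sums (t * (1 / (1 - t)))" using assms by (intro sums_mult geometric_sums) simp
  then show ?thesis using assms by (intro sums_nonneg_imp_has_sum) (auto)
qed

text \<open>The double series of \<open>x ^ (m * k) / k\<close> has logarithms as sums over
  \<open>k\<close> and geometric series as sums over \<open>m\<close>; all its terms are
  nonnegative, which justifies the exchange.\<close>

lemma sum_ln_eq_euler_log: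
  assumes y: "y > 0"
  defines "x \<equiv> exp (- 2 * pi * y)"
  shows "(\<lambda>m. ln (1 - x ^ Suc m)) sums (- euler_log y)"
proof -
  have x: "0 < x" "x < 1" using y by (auto simp: x_def)
  define F where "F m k = x ^ (Suc m * Suc k) / real (Suc k)" for m k
  have xk: "0 < x ^ Suc k" "x ^ Suc k < 1" for k
    using x power_Suc_less_one [of x k] by auto
  have F0: "F m k \<ge> 0" for m k using x by (simp add: F_def)
  have row: "(F m has_sum (- ln (1 - x ^ Suc m))) UNIV" for m
  proof -
    have "(\<lambda>n. - ((- (- (x ^ Suc m))) ^ n) / of_nat n) sums ln (1 + (- (x ^ Suc m)))"
      using xk [of m] by (intro ln_series') auto
    then have "(\<lambda>n. - (- ((x ^ Suc m) ^ n) / of_nat n)) sums (- ln (1 - x ^ Suc m))"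
      using sums_minus by fastforce
    then have "(\<lambda>n. (x ^ Suc m) ^ Suc n / of_nat (Suc n)) sums (- ln (1 - x ^ Suc m))"
      by (subst sums_Suc_iff) simp
    moreover have "(x ^ Suc m) ^ Suc n / of_nat (Suc n) = F m n" for n
      unfolding F_def power_mult by simp
    ultimately show ?thesis using F0 by (intro sums_nonneg_imp_has_sum) auto
  qed
  have col: "((\<lambda>m. F m k) has_sum (1 / (real (Suc k) * (exp (2 * pi * real (Suc k) * y) - 1)))) UNIV" for k
  proof -
    have A: "((\<lambda>m. (x ^ Suc k) ^ Suc m * (1 / real (Suc k))) has_sum
        (x ^ Suc k / (1 - x ^ Suc k) * (1 / real (Suc k)))) UNIV"
      by (intro has_sum_cmult_left has_sum_geometric_real xk)
    have B: "(\<lambda>m. (x ^ Suc k) ^ Suc m * (1 / real (Suc k))) = (\<lambda>m. F m k)"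
      unfolding F_def power_mult [symmetric] by (simp add: mult.commute)
    have C: "x ^ Suc k / (1 - x ^ Suc k) * (1 / real (Suc k))
        = 1 / (real (Suc k) * (exp (2 * pi * real (Suc k) * y) - 1))"
    proof -
      have *: "1 / E / (1 - 1 / E) * (1 / c) = 1 / (c * (E - 1))" if "E > 1" "c > 0" for E c :: real
        using that by (simp add: field_simps)
      have "x ^ Suc k = exp (real (Suc k) * (- 2 * pi * y))" unfolding x_def by (rule exp_of_nat_mult [symmetric])
      also have "\<dots> = 1 / exp (2 * pi * real (Suc k) * y)"
        by (simp add: exp_minus inverse_eq_divide mult_ac del: of_nat_Suc)
      finally have eq: "x ^ Suc k = 1 / exp (2 * pi * real (Suc k) * y)" .
      show ?thesis unfolding eq by (rule *) (use y in auto)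
    qed
    show ?thesis using A unfolding B C .
  qed
  have S: "(\<lambda>(k, m). F m k) summable_on (UNIV \<times> UNIV)"
  proof (rule summable_on_SigmaI)
    show "((\<lambda>m. case (k, m) of (k, m) \<Rightarrow> F m k) has_sum
       (1 / (real (Suc k) * (exp (2 * pi * real (Suc k) * y) - 1)))) UNIV" for k
      using col unfolding prod.case .
    have "0 \<le> 1 / (real (Suc k) * (exp (2 * pi * real (Suc k) * y) - 1))" for k
      using has_sum_nonneg [OF col [of k]] F0 by simp
    then show "(\<lambda>k. 1 / (real (Suc k) * (exp (2 * pi * real (Suc k) * y) - 1))) summable_on UNIV"
      using summable_euler_log [OF y] by (intro summable_nonneg_imp_summable_on) auto
  qed (use F0 in auto)
  have c: "((\<lambda>k. 1 / (real (Suc k) * (exp (2 * pi * real (Suc k) * y) - 1))) has_sum (\<Sum>\<^sub>\<infinity>(k, m). F m k)) UNIV"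
    using has_sum_SigmaD [OF has_sum_infsum [OF S]] col by simp
  have S': "(\<lambda>(m, k). F m k) summable_on (UNIV \<times> UNIV)"
    using S by (subst (asm) summable_on_swap) simp
  have r: "((\<lambda>m. - ln (1 - x ^ Suc m)) has_sum (\<Sum>\<^sub>\<infinity>(m, k). F m k)) UNIV"
    using has_sum_SigmaD [OF has_sum_infsum [OF S']] row by simp
  have "((\<lambda>(m, k). F m k) has_sum (\<Sum>\<^sub>\<infinity>(k, m). F m k)) UNIV"
    using has_sum_infsum [OF S] has_sum_swap [of "\<lambda>(k, m). F m k" UNIV UNIV] by simp
  then have "(\<Sum>\<^sub>\<infinity>(m, k). F m k) = (\<Sum>\<^sub>\<infinity>(k, m). F m k)" by (rule infsumI)
  moreover have "(\<Sum>\<^sub>\<infinity>(k, m). F m k) = euler_log y"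
    using has_sum_imp_sums [OF c] unfolding euler_log_def by (simp add: sums_iff)
  ultimately have "(\<lambda>m. - ln (1 - x ^ Suc m)) sums euler_log y" using has_sum_imp_sums [OF r] by simp
  then show ?thesis using sums_minus by fastforce
qed

lemma euler_fun_exp_real:
  assumes y: "y > 0"
  shows "euler_fun (of_real (exp (- 2 * pi * y))) = of_real (exp (- euler_log y))"
proof -
  define x where "x = exp (- 2 * pi * y)"
  have x: "0 < x" "x < 1" using y by (auto simp: x_def)
  have xk: "x ^ Suc k < 1" for k
    using x power_Suc_less_one [of x k] by auto
  have "raw_has_prod (\<lambda>m. exp (ln (1 - x ^ Suc m))) 0 (exp (- euler_log y))"
    by (rule sums_imp_has_prod_exp) (use sum_ln_eq_euler_log [OF y] in \<open>simp add: x_def\<close>)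
  moreover have "(\<lambda>m. exp (ln (1 - x ^ Suc m))) = (\<lambda>m. 1 - x ^ Suc m)"
    using xk by (intro ext exp_ln) auto
  ultimately have "(\<lambda>m. 1 - x ^ Suc m) has_prod exp (- euler_log y)"
    unfolding has_prod_def by simp
  then have "(\<lambda>m. complex_of_real (1 - x ^ Suc m)) has_prod of_real (exp (- euler_log y))"
    by (subst has_prod_of_real_iff)
  moreover have "(\<lambda>m. complex_of_real (1 - x ^ Suc m)) has_prod euler_fun (of_real x)"
    using euler_fun_has_prod [of "of_real x"] x by simp
  ultimately show ?thesis unfolding x_def using has_prod_unique2 by blast
qed

lemma norm_exp_less_1: "Re z > 0 \<Longrightarrow> norm (exp (- 2 * of_real pi * z)) < 1"
  by (simp add: norm_exp_eq_Re)

lemma Re_one_divide_pos: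
  assumes "Re z > 0"
  shows "Re (1 / z) > 0"
  unfolding Re_divide using assms by (intro divide_pos_pos) (auto intro: add_pos_nonneg)

text \<open>The law of Dedekind's eta function under the map from \<open>\<tau>\<close> to
  \<open>- 1 / \<tau>\<close>, at \<open>\<tau> = \<i> * z\<close>; the exponential comes from the
  factor \<open>q powr (1 / 24)\<close> that distinguishes eta from Euler's product.\<close>

theorem euler_fun_inversion:
  assumes z: "Re z > 0"
  shows "euler_fun (exp (- 2 * of_real pi / z))
     = csqrt z * exp (of_real pi / 12 * (1 / z - z)) * euler_fun (exp (- 2 * of_real pi * z))"
proof -
  define f where "f z = euler_fun (exp (- 2 * of_real pi / z))
     - csqrt z * exp (of_real pi / 12 * (1 / z - z)) * euler_fun (exp (- 2 * of_real pi * z))" for z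
  define U where "U = {complex_of_real (real r / real s) | r s. r \<ge> 1 \<and> s \<ge> 1}"
  have "f z = 0"
  proof (rule analytic_continuation [of f "{z. Re z > 0}" U 1 z])
    have "(\<lambda>z. euler_fun (exp (- 2 * of_real pi * z))) holomorphic_on {z. Re z > 0}"
      by (rule holomorphic_on_compose_gen [OF _ euler_fun_holomorphic, unfolded o_def])
         (auto intro!: holomorphic_intros)
    moreover have "(\<lambda>z. euler_fun (exp (- 2 * of_real pi / z))) holomorphic_on {z. Re z > 0}"
    proof (rule holomorphic_on_compose_gen [OF _ euler_fun_holomorphic, unfolded o_def])
      show "(\<lambda>z. exp (- 2 * of_real pi / z)) holomorphic_on {z. Re z > 0}"
        by (intro holomorphic_intros) auto
      show "(\<lambda>z. exp (- 2 * of_real pi / z)) ` {z. Re z > 0} \<subseteq> ball 0 1"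
        using norm_exp_less_1 [OF Re_one_divide_pos] by auto
    qed
    moreover have "z \<notin> \<real>\<^sub>\<le>\<^sub>0" if "Re z > 0" for z
      using that by (auto simp: complex_nonpos_Reals_iff)
    ultimately show "f holomorphic_on {z. Re z > 0}" unfolding f_def
      by (intro holomorphic_intros) auto
    show "open {z. Re z > 0}" by (rule open_halfspace_Re_gt)
    show "connected {z. Re z > 0}" by (intro convex_connected convex_halfspace_Re_gt)
    show "U \<subseteq> {z. Re z > 0}" by (auto simp: U_def)
    show "1 \<in> {z. Re z > 0}" by simp
    show "1 islimpt U"
      unfolding islimpt_sequential
    proof (intro exI conjI allI)
      show "complex_of_real (real (n + 2) / real (n + 1)) \<in> U - {1}" for n
      proof -
        have "real (n + 2) / real (n + 1) \<noteq> 1" by (simp add: field_simps)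
        then have "complex_of_real (real (n + 2) / real (n + 1)) \<noteq> 1" by (simp only: of_real_eq_1_iff not_False_eq_True)
        moreover have "n + 2 \<ge> 1" "n + 1 \<ge> 1" by auto
        ultimately show ?thesis unfolding U_def by blast
      qed
      have "(\<lambda>n. real (n + 2) / real (n + 1)) \<longlonglongrightarrow> 1" by real_asymp
      from tendsto_of_real [OF this, where 'a = complex]
      show "(\<lambda>n. complex_of_real (real (n + 2) / real (n + 1))) \<longlonglongrightarrow> 1" by simp
    qed
    show "f u = 0" if "u \<in> U" for u
    proof -
      from that obtain r s where rs: "r \<ge> 1" "s \<ge> 1" and u: "u = of_real (real r / real s)"
        by (auto simp: U_def)
      define y where "y = real r / real s"
      have y: "y > 0" using rs by (simp add: y_def)
      have e: "exp (- euler_log (1 / y)) = sqrt y * exp (pi / 12 * (1 / y - y)) * exp (- euler_log y)"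
      proof -
        have "- euler_log (1 / y) = ln (sqrt y) + pi / 12 * (1 / y - y) + (- euler_log y)"
          using euler_log_inverse_rat [OF rs] y by (simp add: y_def ln_sqrt)
        then show ?thesis unfolding exp_add [symmetric] using y by (simp only: exp_add) simp
      qed
      have "euler_fun (exp (- 2 * of_real pi / u)) = of_real (exp (- euler_log (1 / y)))"
        using euler_fun_exp_real [of "1 / y"] y by (simp add: u y_def [symmetric] exp_of_real [symmetric])
      moreover have "euler_fun (exp (- 2 * of_real pi * u)) = of_real (exp (- euler_log y))"
        using euler_fun_exp_real [of y] y by (simp add: u y_def [symmetric] exp_of_real [symmetric])
      moreover have "csqrt u = of_real (sqrt y)"
        using y by (simp add: u y_def [symmetric] csqrt_of_real)
      moreover have "exp (of_real pi / 12 * (1 / u - u)) = complex_of_real (exp (pi / 12 * (1 / y - y)))"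
        by (simp add: u y_def [symmetric] exp_of_real [symmetric])
      ultimately show ?thesis unfolding f_def e by simp
    qed
    show "z \<in> {z. Re z > 0}" using z by simp
  qed
  then show ?thesis by (simp add: f_def)
qed

subsection \<open>The transformation formula with Dedekind sums\<close>

text \<open>Both arguments are below \<open>pi / 2\<close> in absolute value, so their sum stays in
  the principal range. This is what spares the transformation formula any case distinction on
  branches.\<close>

lemma csqrt_mult_right_halfplane:
  assumes "Re a > 0" "Re b > 0"
  shows "csqrt a * csqrt b = csqrt (a * b)"
proof -
  have nz: "a \<noteq> 0" "b \<noteq> 0" using assms by auto
  have "\<bar>Im (Ln a)\<bar> < pi / 2" "\<bar>Im (Ln b)\<bar> < pi / 2"
    using Re_Ln_pos_lt [OF nz(1)] Re_Ln_pos_lt [OF nz(2)] assms by blast+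
  then have "Ln (a * b) = Ln a + Ln b"
    using nz by (intro Ln_times_simple) auto
  then show ?thesis using nz by (simp add: csqrt_exp_Ln add_divide_distrib exp_add)
qed

lemma csqrt_minus_ii_mult:
  assumes "Re z > 0"
  shows "csqrt (- \<i> * z) = exp (- \<i> * of_real pi / 4) * csqrt z"
proof -
  have nz: "z \<noteq> 0" using assms by auto
  have "\<bar>Im (Ln z)\<bar> < pi / 2" using Re_Ln_pos_lt [OF nz] assms by blast
  then have "Ln (- \<i> * z) = Ln (- \<i>) + Ln z"
    using nz by (intro Ln_times_simple) auto
  then have "Ln (- \<i> * z) / 2 = - \<i> * of_real pi / 4 + Ln z / 2"
    by (simp add: field_simps)
  moreover have "- \<i> * z \<noteq> 0" using nz by simp
  ultimately show ?thesis using nz by (simp only: csqrt_exp_Ln exp_add not_False_eq_True)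
qed

lemma exp_two_pi_ii_int: "exp (2 * of_real pi * \<i> * of_int n) = 1"
proof -
  have "2 * of_real pi * \<i> * of_int n = \<i> * (of_int n * (of_real pi * 2))" by (simp only: mult_ac)
  then show ?thesis by (simp only: exp_2pi_1_int)
qed

lemma exp_two_pi_ii_shift: "exp (2 * of_real pi * \<i> * (w + of_int n)) = exp (2 * of_real pi * \<i> * w)"
  by (simp only: distrib_left exp_add exp_two_pi_ii_int mult_1_right)

text \<open>Strong induction on \<open>k\<close>, with \<open>r = h mod k\<close> as the new
  denominator. The source point \<open>(h + \<i> * z) / k\<close> is shifted to
  \<open>(r + \<i> * z) / k\<close> and inverted; the result has the form
  \<open>(- k + \<i> * z') / r\<close>, to which the induction hypothesis applies. The base case
  \<open>k = 1\<close> is the inversion itself up to integer shifts.\<close>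

theorem euler_fun_modular:
  fixes h H :: int and k :: nat
  assumes "k > 0" "[h * H = - 1] (mod int k)" "Re z > 0"
  shows "euler_fun (exp (2 * of_real pi * \<i> * ((of_int H + \<i> / z) / of_nat k)))
     = exp (of_real pi * \<i> * of_real (dedekind_sum h k)) * csqrt z
       * exp (of_real pi / (12 * of_nat k) * (1 / z - z))
       * euler_fun (exp (2 * of_real pi * \<i> * ((of_int h + \<i> * z) / of_nat k)))"
  using assms
proof (induction k arbitrary: h H z rule: less_induct)
  case (less k)
  note kpos = less.prems(1) and cong = less.prems(2) and z = less.prems(3)
  have znz: "z \<noteq> 0" using z by auto
  show ?case
  proof (cases "k = 1")
    case True
    have "exp (2 * of_real pi * \<i> * ((of_int H + \<i> / z) / of_nat k)) = exp (- 2 * of_real pi / z)"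
      using exp_two_pi_ii_shift [of "\<i> / z" H] True by (simp add: add.commute mult_ac)
    moreover have "exp (2 * of_real pi * \<i> * ((of_int h + \<i> * z) / of_nat k)) = exp (- 2 * of_real pi * z)"
      using exp_two_pi_ii_shift [of "\<i> * z" h] True by (simp add: add.commute mult_ac)
    moreover have "dedekind_sum h k = 0" using True by (simp add: dedekind_sum_def)
    ultimately show ?thesis using euler_fun_inversion [OF z] True by simp
  next
    case False
    define r where "r = nat (h mod int k)"
    have r: "int r = h mod int k" using kpos by (simp add: r_def)
    have rk: "r < k" using kpos r by (metis of_nat_0_less_iff of_nat_less_iff pos_mod_bound)
    have hr: "[h = int r] (mod int k)" by (simp add: r cong_def)
    have cong': "[int r * H = - 1] (mod int k)"
      using cong hr by (metis cong_scalar_right cong_sym cong_trans)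
    have r0: "r > 0"
    proof (rule ccontr)
      assume "\<not> r > 0"
      then have "int k dvd 1" using cong' by (simp add: cong_iff_dvd_diff)
      then show False using False by simp
    qed
    have "int k dvd int r * H + 1" using cong' by (simp add: cong_iff_dvd_diff)
    \<comment> \<open>The cofactor \<open>c\<close> plays the part of \<open>H\<close> for the
      smaller pair: read modulo \<open>r\<close>, the equation says that \<open>- k * c\<close> is
      congruent to \<open>- 1\<close>.\<close>
    then obtain c where c: "int r * H + 1 = int k * c" by (auto simp: dvd_def)
    have cop: "coprime r k"
    proof -
      have "coprime (int r) (int k)"
      proof (rule coprimeI)
        fix d assume "d dvd int r" "d dvd int k"
        then have "d dvd int k * c - int r * H" by (intro dvd_diff dvd_mult2) auto
        then show "is_unit d" using c by (metis add_diff_cancel_left')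
      qed
      then show ?thesis by simp
    qed
    define w where "w = of_nat r + \<i> * z"
    have "Im w > 0" using z by (simp add: w_def)
    then have wnz: "w \<noteq> 0" by auto
    \<comment> \<open>The solution of \<open>(- k + \<i> * z') / r = - k / w\<close>, the right-hand
      side being the inverted source point.\<close>
    define z' where "z' = of_nat k * z / w"
    have zz': "1 / z' = w / (of_nat k * z)" using wnz znz kpos by (simp add: z'_def)
    have "Re z' > 0"
    proof -
      have "Re (1 / z') = Re (of_nat r * (1 / z)) / real k"
      proof -
        have "1 / z' = (of_nat r * (1 / z) + \<i>) / of_nat k"
          unfolding zz' w_def using znz kpos by (simp add: field_simps)
        then show ?thesis by simp
      qed
      also have "\<dots> > 0"
        using z r0 kpos znz by (auto simp: Re_divide intro!: divide_pos_pos mult_pos_pos sum_power2_gt_zero_iff [THEN iffD2])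
      finally have "Re (1 / z') > 0" .
      from Re_one_divide_pos [OF this] show ?thesis by simp
    qed
    have conj': "[- int k * c = - 1] (mod int r)"
    proof -
      have "- int k * c - (- 1) = int r * (- H)" using c by (simp add: algebra_simps)
      then show ?thesis unfolding cong_iff_dvd_diff by simp
    qed
    have IH: "euler_fun (exp (2 * of_real pi * \<i> * ((of_int c + \<i> / z') / of_nat r)))
     = exp (of_real pi * \<i> * of_real (dedekind_sum (- int k) r)) * csqrt z'
       * exp (of_real pi / (12 * of_nat r) * (1 / z' - z'))
       * euler_fun (exp (2 * of_real pi * \<i> * ((of_int (- int k) + \<i> * z') / of_nat r)))"
      by (rule less.IH [OF rk r0 conj' \<open>Re z' > 0\<close>])
    define z0 where "z0 = (z - \<i> * of_nat r) / of_nat k"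
    have w0: "w = \<i> * of_nat k * z0" using kpos by (simp add: w_def z0_def field_simps)
    have z0nz: "z0 \<noteq> 0" using w0 wnz by auto
    have "Re z0 > 0" using z kpos by (simp add: z0_def)
    have e1: "(of_int c + \<i> / z') / of_nat r = (of_int H + \<i> / z) / of_nat k"
    proof -
      have "of_nat r * of_int H + 1 = (of_nat k * of_int c :: complex)"
        using arg_cong [OF c, of "of_int :: int \<Rightarrow> complex"] by simp
      then have cc: "of_int c = (of_nat r * of_int H + 1) / (of_nat k :: complex)"
        using kpos by (simp add: field_simps)
      have "\<i> * (of_nat r + \<i> * z) = \<i> * of_nat r - z" by (simp add: algebra_simps)
      then have eq: "\<i> / z' = (\<i> * of_nat r - z) / (of_nat k * z)"
        using zz' unfolding w_def by (metis times_divide_eq_right mult.right_neutral)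
      show ?thesis unfolding cc eq using r0 kpos znz by (simp add: field_simps)
    qed
    have e2: "2 * of_real pi * \<i> * ((of_int (- int k) + \<i> * z') / of_nat r) = - 2 * of_real pi / z0"
    proof -
      have "(of_int (- int k) + \<i> * z') / of_nat r = - of_nat k / w"
      proof -
        have "- of_nat k * w + \<i> * (of_nat k * z) = - of_nat k * of_nat r"
          by (simp add: w_def algebra_simps)
        moreover have "of_int (- int k) + \<i> * z' = (- of_nat k * w + \<i> * (of_nat k * z)) / w"
          unfolding z'_def using wnz by (simp add: add_divide_distrib diff_divide_distrib)
        ultimately have eq: "of_int (- int k) + \<i> * z' = - of_nat k * of_nat r / w" by (simp only:)
        show ?thesis unfolding eq using r0 by simp
      qed
      also have "\<dots> = \<i> / z0" unfolding w0 using z0nz kpos by (simp add: divide_simps)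
      finally have *: "(of_int (- int k) + \<i> * z') / of_nat r = \<i> / z0" .
      show ?thesis unfolding * using z0nz by (simp add: field_simps)
    qed
    have e3: "exp (- 2 * of_real pi * z0) = exp (2 * of_real pi * \<i> * ((of_int h + \<i> * z) / of_nat k))"
    proof -
      define m where "m = h div int k"
      have m: "h = int r + int k * m" by (simp add: r m_def)
      have "(of_int h + \<i> * z) / of_nat k = (of_nat r + \<i> * z) / of_nat k + of_int m"
        using kpos by (simp add: m field_simps)
      then have "exp (2 * of_real pi * \<i> * ((of_int h + \<i> * z) / of_nat k))
          = exp (2 * of_real pi * \<i> * ((of_nat r + \<i> * z) / of_nat k))"
        by (simp only: exp_two_pi_ii_shift)
      moreover have "2 * of_real pi * \<i> * ((of_nat r + \<i> * z) / of_nat k) = - 2 * of_real pi * z0"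
        using kpos by (simp add: z0_def field_simps)
      ultimately show ?thesis by simp
    qed
    \<comment> \<open>Both \<open>z'\<close> and \<open>z0\<close> lie in the right half-plane and
      their product is \<open>- \<i> * z\<close>; the factor \<open>- \<i>\<close> leaves an eighth
      root of unity.\<close>
    have e4: "csqrt z' * csqrt z0 = exp (- \<i> * of_real pi / 4) * csqrt z"
    proof -
      have "z' * z0 = - \<i> * z" unfolding z'_def w0 using z0nz kpos by (simp add: divide_simps)
      then show ?thesis
        using csqrt_mult_right_halfplane [OF \<open>Re z' > 0\<close> \<open>Re z0 > 0\<close>] csqrt_minus_ii_mult [OF z] by simp
    qed
    \<comment> \<open>The reciprocity law fits exactly: its constant \<open>- 1 / 4\<close> cancels
      the eighth root of unity, and its rational part cancels the purely imaginary terms produced by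
      the change from \<open>z\<close> to \<open>z'\<close> and \<open>z0\<close>.\<close>
    have e5: "of_real pi * \<i> * of_real (dedekind_sum (- int k) r) + - \<i> * of_real pi / 4
        + (of_real pi / (12 * of_nat r) * (1 / z' - z') + of_real pi / 12 * (1 / z0 - z0))
        = of_real pi * \<i> * of_real (dedekind_sum h k) + of_real pi / (12 * of_nat k) * (1 / z - z)"
    proof -
      have "dedekind_sum (- int k) r = - dedekind_sum (int k) r"
        using cop by (intro dedekind_sum_neg) (simp add: coprime_commute)
      moreover have "dedekind_sum h k = dedekind_sum (int r) k" by (rule dedekind_sum_cong [OF hr])
      ultimately have "dedekind_sum (- int k) r = dedekind_sum h k
          - (- 1 / 4 + (real r / real k + real k / real r + 1 / (real r * real k)) / 12)"
        using dedekind_sum_reciprocity [OF cop r0 kpos] by simp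
      then have s: "complex_of_real (dedekind_sum (- int k) r) = of_real (dedekind_sum h k)
          - (- 1 / 4 + (of_nat r / of_nat k + of_nat k / of_nat r + 1 / (of_nat r * of_nat k)) / 12)"
        by simp
      have "1 / z0 - z0 + (1 / z' - z') / of_nat r
          = \<i> * (of_nat r / of_nat k + of_nat k / of_nat r + 1 / (of_nat r * of_nat k)) + (1 / z - z) / of_nat k"
      proof -
        have a: "1 / z0 = \<i> * of_nat k / w" unfolding w0 using z0nz kpos by (simp add: divide_simps)
        have b: "1 / z' / of_nat r = 1 / (of_nat k * z) + \<i> / (of_nat r * of_nat k)"
          unfolding zz' w_def using znz r0 kpos by (simp add: field_simps)
        have "\<i> * of_nat k / w - z' / of_nat r = \<i> * of_nat k / of_nat r"
        proof -
          have "\<i> * of_nat k * of_nat r - of_nat k * z = \<i> * of_nat k * w"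
            by (simp add: w_def algebra_simps)
          then have "\<i> * of_nat k / w - z' / of_nat r = \<i> * of_nat k * w / (w * of_nat r)"
            unfolding z'_def using wnz r0 by (simp add: field_simps)
          then show ?thesis using wnz by simp
        qed
        then have "1 / z0 - z' / of_nat r = \<i> * of_nat k / of_nat r" unfolding a .
        moreover have "z0 = z / of_nat k - \<i> * of_nat r / of_nat k"
          by (simp add: z0_def diff_divide_distrib)
        moreover have "1 / z0 - z0 + (1 / z' - z') / of_nat r = (1 / z0 - z' / of_nat r) - z0 + 1 / z' / of_nat r"
          by (simp add: diff_divide_distrib)
        ultimately have "1 / z0 - z0 + (1 / z' - z') / of_nat r = \<i> * of_nat k / of_nat r
           - (z / of_nat k - \<i> * of_nat r / of_nat k) + (1 / (of_nat k * z) + \<i> / (of_nat r * of_nat k))"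
          using b by (simp only:)
        also have "\<dots> = \<i> * (of_nat r / of_nat k + of_nat k / of_nat r + 1 / (of_nat r * of_nat k)) + (1 / z - z) / of_nat k"
          by (simp add: diff_divide_distrib distrib_left mult.commute)
        finally show ?thesis .
      qed
      moreover define S where "S = of_nat r / of_nat k + of_nat k / of_nat r + 1 / (of_nat r * of_nat k :: complex)"
      ultimately have S: "1 / z0 - z0 + (1 / z' - z') / of_nat r = \<i> * S + (1 / z - z) / of_nat k"
        by (simp only:)
      have "of_real pi / (12 * of_nat r) * (1 / z' - z') + of_real pi / 12 * (1 / z0 - z0)
          = of_real pi / 12 * (1 / z0 - z0 + (1 / z' - z') / of_nat r)"
        by (simp only: distrib_left add.commute times_divide_eq_right times_divide_eq_left divide_divide_eq_left mult.commute)
      also have "\<dots> = of_real pi / 12 * \<i> * S + of_real pi / (12 * of_nat k) * (1 / z - z)"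
        unfolding S by (simp only: distrib_left mult.assoc times_divide_eq_right times_divide_eq_left divide_divide_eq_left)
      finally have T: "of_real pi / (12 * of_nat r) * (1 / z' - z') + of_real pi / 12 * (1 / z0 - z0)
          = of_real pi / 12 * \<i> * S + of_real pi / (12 * of_nat k) * (1 / z - z)" .
      have "of_real pi * \<i> * (d - (- 1 / 4 + S / 12)) + - \<i> * of_real pi / 4 + of_real pi / 12 * \<i> * S
          = of_real pi * \<i> * d" for d
        by (simp add: algebra_simps)
      then show ?thesis unfolding s T S_def [symmetric] by (simp only: add.assoc [symmetric])
    qed
    let ?A = "of_real pi * \<i> * of_real (dedekind_sum (- int k) r)"
    let ?B = "of_real pi / (12 * of_nat r) * (1 / z' - z')"
    let ?C = "of_real pi / 12 * (1 / z0 - z0)"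
    let ?Y = "euler_fun (exp (2 * of_real pi * \<i> * ((of_int h + \<i> * z) / of_nat k)))"
    have "euler_fun (exp (2 * of_real pi * \<i> * ((of_int H + \<i> / z) / of_nat k)))
        = exp ?A * csqrt z' * exp ?B * (csqrt z0 * exp ?C * ?Y)"
      using IH unfolding e1 e2 euler_fun_inversion [OF \<open>Re z0 > 0\<close>] e3 .
    also have "\<dots> = (csqrt z' * csqrt z0) * (exp ?A * (exp ?B * exp ?C)) * ?Y"
      by (simp only: mult_ac)
    also have "\<dots> = csqrt z * exp (?A + - \<i> * of_real pi / 4 + (?B + ?C)) * ?Y"
      by (simp only: e4 exp_add mult_ac)
    also have "\<dots> = exp (of_real pi * \<i> * of_real (dedekind_sum h k)) * csqrt z
        * exp (of_real pi / (12 * of_nat k) * (1 / z - z)) * ?Y"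
      by (simp only: e5) (simp only: exp_add mult_ac)
    finally show ?thesis .
  qed
qed

subsection \<open>Farey dissection\<close>

text \<open>
  The denominator of the right neighbour of \<open>h / k\<close> in the Farey sequence of order \<open>N\<close>; the left
  neighbour has denominator \<open>farey_den N k (- h)\<close>.
\<close>

definition farey_den :: "nat \<Rightarrow> nat \<Rightarrow> int \<Rightarrow> nat" where
  "farey_den N k h = (SOME d. N < d + k \<and> d \<le> N \<and> [int d * h = - 1] (mod int k))"

text \<open>The congruence fixes the number modulo \<open>k\<close>, as it forces \<open>h\<close>
  to be invertible, and the bounds leave a window of \<open>k\<close> consecutive integers.\<close>

lemma farey_den_unique:
  assumes "N < d + k" "d \<le> N" "[int d * h = - 1] (mod int k)"
    and "N < e + k" "e \<le> N" "[int e * h = - 1] (mod int k)"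
  shows "d = e"
proof -
  have "int k dvd int d * h - int e * h"
    using assms(3,6) cong_sym cong_trans by (metis cong_iff_dvd_diff)
  then have "int k dvd (int d - int e) * h" by (simp add: left_diff_distrib)
  moreover have "coprime (int k) h"
  proof (rule coprimeI)
    fix x assume "x dvd int k" "x dvd h"
    moreover from this have "x dvd int d * h + 1"
      using assms(3) by (metis cong_iff_dvd_diff diff_minus_eq_add dvd_trans)
    ultimately show "is_unit x" by (metis dvd_add_right_iff dvd_mult)
  qed
  ultimately have "int k dvd int d - int e" by (simp add: coprime_dvd_mult_left_iff)
  moreover have "\<bar>int d - int e\<bar> < int k" using assms by linarith
  ultimately show ?thesis using dvd_imp_le_int [of "int d - int e" "int k"] by force
qed

lemma farey_den_eq:
  assumes "N < d + k" "d \<le> N" "[int d * h = - 1] (mod int k)"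
  shows "farey_den N k h = d"
  unfolding farey_den_def
  by (rule some_equality) (use assms farey_den_unique in blast)+

lemma farey_den:
  assumes "coprime h (int k)" "0 < k" "k \<le> N"
  shows "N < farey_den N k h + k" "farey_den N k h \<le> N"
proof -
  obtain x where x: "[h * x = 1] (mod int k)" using assms(1) by (metis cong_solve_coprime_int)
  \<comment> \<open>Subtracting this residue from \<open>N\<close> gives the largest integer up to
    \<open>N\<close> that is congruent to \<open>- x\<close>, where \<open>x\<close> inverts
    \<open>h\<close> modulo \<open>k\<close>.\<close>
  define d where "d = int N - (int N + x) mod int k"
  have m: "0 \<le> (int N + x) mod int k" "(int N + x) mod int k < int k" using assms by auto
  have m': "(int N + x) mod int k < int N" using m(2) assms(3) by linarith
  have "int k dvd d + x"
  proof -
    have "d + x = (int N + x) - (int N + x) mod int k" by (simp add: d_def)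
    then show ?thesis by (simp add: minus_mod_eq_mult_div)
  qed
  then have "int k dvd (d + x) * h" by simp
  moreover have "int k dvd h * x - 1" using x by (simp add: cong_iff_dvd_diff)
  ultimately have "int k dvd (d + x) * h - (h * x - 1)" by (rule dvd_diff)
  then have "[d * h = - 1] (mod int k)" by (simp add: cong_iff_dvd_diff algebra_simps)
  moreover have "d \<le> int N" "int N < d + int k" "0 < d"
    using m m' by (auto simp: d_def)
  ultimately have "N < nat d + k \<and> nat d \<le> N \<and> [int (nat d) * h = - 1] (mod int k)"
    by auto
  then have "N < farey_den N k h + k \<and> farey_den N k h \<le> N \<and> [int (farey_den N k h) * h = - 1] (mod int k)"
    unfolding farey_den_def by (rule someI)
  then show "N < farey_den N k h + k" "farey_den N k h \<le> N" by auto
qed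

text \<open>
  The distance from \<open>h / k\<close> to the mediant with its right neighbour; at \<open>- h\<close> it is the distance to the
  mediant with the left neighbour.
\<close>

definition farey_right :: "nat \<Rightarrow> nat \<Rightarrow> int \<Rightarrow> real" where
  "farey_right N k h = 1 / (real k * real (k + farey_den N k h))"

text \<open>The denominator of the mediant exceeds \<open>N\<close> and is at most
  \<open>2 * N\<close>.\<close>

lemma farey_right_bounds:
  assumes "coprime h (int k)" "0 < k" "k \<le> N"
  shows "1 / (2 * real k * real N) \<le> farey_right N k h" "farey_right N k h \<le> 1 / (real k * real N)"
proof -
  have d: "N < farey_den N k h + k" "farey_den N k h \<le> N" using farey_den [OF assms] .
  have "k * (k + farey_den N k h) \<le> k * (2 * N)" "k * N \<le> k * (k + farey_den N k h)"
    using d assms by (intro mult_le_mono2; linarith)+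
  then have "real (k * (k + farey_den N k h)) \<le> real (k * (2 * N))"
    "real (k * N) \<le> real (k * (k + farey_den N k h))" by (simp_all only: of_nat_le_iff)
  then show "1 / (2 * real k * real N) \<le> farey_right N k h" "farey_right N k h \<le> 1 / (real k * real N)"
    unfolding farey_right_def using assms by (auto intro!: divide_left_mono mult_pos_pos simp: mult_ac)
qed

text \<open>Determinant one together with \<open>N < b + d\<close> means adjacency: \<open>d\<close>
  is the \<open>farey_den\<close> of \<open>a / b\<close>, and \<open>b\<close> that of
  \<open>c / d\<close> reflected. Hence the two neighbouring arcs end at the same point.\<close>

lemma farey_mediant:
  fixes a c :: int and b d :: nat
  assumes "int b * c - a * int d = 1" "b > 0" "d > 0" "b \<le> N" "d \<le> N" "N < b + d"
  shows "real_of_int a / real b + farey_right N b a = (real_of_int a + real_of_int c) / (real b + real d)"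
    and "real_of_int c / real d - farey_right N d (- c) = (real_of_int a + real_of_int c) / (real b + real d)"
proof -
  have "[int d * a = - 1] (mod int b)"
  proof -
    have "int d * a - (- 1) = int b * c" using assms(1) by (simp add: algebra_simps)
    then show ?thesis by (simp add: cong_iff_dvd_diff)
  qed
  then have 1: "farey_den N b a = d" using assms by (intro farey_den_eq) auto
  have "[int b * - c = - 1] (mod int d)"
  proof -
    have "int b * - c - (- 1) = int d * (- a)" using assms(1) by (simp add: algebra_simps)
    then show ?thesis by (metis cong_iff_dvd_diff dvd_triv_left)
  qed
  then have 2: "farey_den N d (- c) = b" using assms by (intro farey_den_eq) auto
  have r: "real b * real_of_int c - real_of_int a * real d = 1"
    using arg_cong [OF assms(1), of real_of_int] by simp
  have pos: "real b > 0" "real d > 0" "real b + real d > 0" using assms by auto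
  have add: "x / y + 1 / (y * s) = (x * s + 1) / (y * s)" and sub: "x / y - 1 / (y * s) = (x * s - 1) / (y * s)"
    if "y > 0" "s > 0" for x y s :: real
    using that by (simp_all add: field_simps)
  have "real_of_int a / real b + 1 / (real b * (real b + real d)) = (real_of_int a * (real b + real d) + 1) / (real b * (real b + real d))"
    using pos by (intro add)
  also have "real_of_int a * (real b + real d) + 1 = real b * (real_of_int a + real_of_int c)"
    using r by (simp add: algebra_simps)
  finally show "real_of_int a / real b + farey_right N b a = (real_of_int a + real_of_int c) / (real b + real d)"
    unfolding farey_right_def 1 using pos by simp
  have "real_of_int c / real d - 1 / (real d * (real b + real d)) = (real_of_int c * (real b + real d) - 1) / (real d * (real b + real d))"
    using pos by (intro sub)
  also have "real_of_int c * (real b + real d) - 1 = real d * (real_of_int a + real_of_int c)"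
    using r by (simp add: algebra_simps)
  finally show "real_of_int c / real d - farey_right N d (- c) = (real_of_int a + real_of_int c) / (real b + real d)"
    unfolding farey_right_def 2 using pos by (simp add: add.commute)
qed

section \<open>Farey fractions by repeated insertion of mediants\<close>

definition farey_between :: "nat \<Rightarrow> int \<Rightarrow> nat \<Rightarrow> int \<Rightarrow> nat \<Rightarrow> (int \<times> nat) set" where
  "farey_between N a b c d =
     {(h, k). 0 < k \<and> k \<le> N \<and> coprime h (int k) \<and> a * int k < h * int b \<and> h * int d < c * int k}"

lemma finite_farey_between:
  assumes "b > 0" "d > 0"
  shows "finite (farey_between N a b c d)"
proof (rule finite_subset)
  show "farey_between N a b c d \<subseteq> {- \<bar>a\<bar> * int N..\<bar>c\<bar> * int N} \<times> {..N}"
  proof (clarsimp simp: farey_between_def)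
    fix h k assume k: "0 < k" "k \<le> N" and 1: "a * int k < h * int b" and 2: "h * int d < c * int k"
    have "- (\<bar>a\<bar> * int N) \<le> h"
    proof (rule ccontr)
      assume neg: "\<not> - (\<bar>a\<bar> * int N) \<le> h"
      have "\<bar>a\<bar> * int k \<le> \<bar>a\<bar> * int N" using k by (intro mult_left_mono) auto
      moreover have "- (\<bar>a\<bar> * int k) \<le> a * int k" by (metis abs_ge_minus_self abs_mult abs_of_nat minus_le_iff)
      moreover have "h * int b \<le> h * 1"
      proof -
        have "0 \<le> \<bar>a\<bar> * int N" by simp
        then have "h \<le> 0" using neg by linarith
        then show ?thesis using assms by (intro mult_left_mono_neg) auto
      qed
      ultimately show False using neg 1 by linarith
    qed
    moreover have "h \<le> \<bar>c\<bar> * int N"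
    proof (rule ccontr)
      assume neg: "\<not> h \<le> \<bar>c\<bar> * int N"
      have "\<bar>c\<bar> * int k \<le> \<bar>c\<bar> * int N" using k by (intro mult_left_mono) auto
      moreover have "c * int k \<le> \<bar>c\<bar> * int k" by (intro mult_right_mono) auto
      moreover have "h * 1 \<le> h * int d"
      proof -
        have "0 \<le> \<bar>c\<bar> * int N" by simp
        then have "0 \<le> h" using neg by linarith
        then show ?thesis using assms by (intro mult_left_mono) auto
      qed
      ultimately show False using neg 2 by linarith
    qed
    ultimately show "- (\<bar>a\<bar> * int N) \<le> h \<and> h \<le> \<bar>c\<bar> * int N" by simp
  qed
qed auto

text \<open>By the determinant condition, \<open>k\<close> is \<open>b\<close> times one positive
  integer plus \<open>d\<close> times another, hence at least \<open>b + d\<close>.\<close>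

lemma farey_between_empty:
  assumes "int b * c - a * int d = 1" "b > 0" "d > 0" "N < b + d"
  shows "farey_between N a b c d = {}"
proof -
  have False if k: "k \<le> N" and 1: "a * int k < h * int b" and 2: "h * int d < c * int k" for h k
  proof -
    have "int k = int b * (c * int k - h * int d) + int d * (h * int b - a * int k)"
    proof -
      have "int b * (c * int k - h * int d) + int d * (h * int b - a * int k)
          = int k * (int b * c - a * int d)" by (simp add: algebra_simps)
      then show ?thesis using assms(1) by simp
    qed
    moreover have "int b * 1 \<le> int b * (c * int k - h * int d)" "int d * 1 \<le> int d * (h * int b - a * int k)"
      using 1 2 by (intro mult_left_mono; simp)+
    ultimately show False using assms(4) k by linarith
  qed
  then show ?thesis by (auto simp: farey_between_def)
qed

text \<open>A fraction in the gap lies left of the mediant, right of it, or equals it in value. In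
  the last case both are in lowest terms, the mediant because its determinant with
  \<open>a / b\<close> is again one, so they agree as pairs.\<close>

lemma farey_between_split:
  assumes 1: "int b * c - a * int d = 1" and "b > 0" "d > 0" "b + d \<le> N"
  shows "farey_between N a b c d
     = insert (a + c, b + d) (farey_between N a b (a + c) (b + d) \<union> farey_between N (a + c) (b + d) c d)"
    (is "?S = insert ?m (?S1 \<union> ?S2)")
proof (intro equalityI subsetI)
  fix x assume x: "x \<in> ?S"
  obtain h k where hk: "x = (h, k)" by fastforce
  have S: "0 < k" "k \<le> N" "coprime h (int k)" "a * int k < h * int b" "h * int d < c * int k"
    using x by (auto simp: hk farey_between_def)
  consider "h * int (b + d) < (a + c) * int k" | "h * int (b + d) > (a + c) * int k"
    | "h * int (b + d) = (a + c) * int k" by linarith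
  then show "x \<in> insert ?m (?S1 \<union> ?S2)"
  proof cases
    case 3
    have "coprime (a + c) (int (b + d))"
    proof (rule coprimeI)
      fix y assume "y dvd a + c" "y dvd int (b + d)"
      then have "y dvd int b * (a + c) - a * int (b + d)" by (intro dvd_diff dvd_mult)
      also have "\<dots> = 1" using 1 by (simp add: algebra_simps)
      finally show "is_unit y" .
    qed
    moreover have "int k dvd h * int (b + d)" "int (b + d) dvd (a + c) * int k" using 3 by (metis dvd_triv_right)+
    ultimately have "int k dvd int (b + d)" "int (b + d) dvd int k"
      using S(3) by (simp_all add: coprime_dvd_mult_right_iff coprime_commute)
    then have k: "k = b + d" using assms(2) S by (metis int_dvd_int_iff dvd_antisym)
    then have "h = a + c" using 3 assms(2) by simp
    then show ?thesis using k hk by simp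
  qed (use S in \<open>auto simp: hk farey_between_def algebra_simps\<close>)
next
  fix x assume "x \<in> insert ?m (?S1 \<union> ?S2)"
  then consider "x = ?m" | "x \<in> ?S1" | "x \<in> ?S2" by blast
  then show "x \<in> ?S"
  proof cases
    case 1
    have "coprime (a + c) (int (b + d))"
    proof (rule coprimeI)
      fix y assume "y dvd a + c" "y dvd int (b + d)"
      then have "y dvd int b * (a + c) - a * int (b + d)" by (intro dvd_diff dvd_mult)
      also have "\<dots> = 1" using assms(1) by (simp add: algebra_simps)
      finally show "is_unit y" .
    qed
    moreover have "a * int (b + d) < (a + c) * int b" "(a + c) * int d < c * int (b + d)"
      using assms(1) by (simp_all add: algebra_simps)
    ultimately show ?thesis using 1 assms by (simp add: farey_between_def)
  next
    case 2
    obtain h k where hk: "x = (h, k)" by fastforce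
    have S: "0 < k" "k \<le> N" "coprime h (int k)" "a * int k < h * int b" "h * int (b + d) < (a + c) * int k"
      using 2 by (auto simp: hk farey_between_def)
    have "h * int d < c * int k" using S(4,5) by (simp add: algebra_simps)
    then show ?thesis using S by (simp add: hk farey_between_def)
  next
    case 3
    obtain h k where hk: "x = (h, k)" by fastforce
    have S: "0 < k" "k \<le> N" "coprime h (int k)" "(a + c) * int k < h * int (b + d)" "h * int d < c * int k"
      using 3 by (auto simp: hk farey_between_def)
    have "a * int k < h * int b" using S(4,5) by (simp add: algebra_simps)
    then show ?thesis using S by (simp add: hk farey_between_def)
  qed
qed

text \<open>Induction down the Stern-Brocot tree: inserting a mediant enlarges \<open>b + d\<close>,
  which never exceeds \<open>2 * N\<close>. At a leaf the sum is empty and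
  \<open>farey_mediant\<close> makes the two values of \<open>G\<close> coincide; at a node the arc
  of the mediant fills the gap between the two subsums.\<close>

lemma farey_between_telescope:
  fixes G :: "real \<Rightarrow> 'a :: ab_group_add"
  assumes "int b * c - a * int d = 1" "b > 0" "d > 0" "b \<le> N" "d \<le> N"
  shows "(\<Sum>(h, k) \<in> farey_between N a b c d.
             G (real_of_int h / real k + farey_right N k h) - G (real_of_int h / real k - farey_right N k (- h)))
       = G (real_of_int c / real d - farey_right N d (- c)) - G (real_of_int a / real b + farey_right N b a)"
  using assms
proof (induction "2 * N - (b + d)" arbitrary: a b c d rule: less_induct)
  case less
  let ?F = "\<lambda>(h, k). G (real_of_int h / real k + farey_right N k h) - G (real_of_int h / real k - farey_right N k (- h))"
  show ?case
  proof (cases "N < b + d")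
    case True
    then show ?thesis
      using farey_between_empty [of b c a d N] farey_mediant [of b c a d N] less.prems by simp
  next
    case False
    let ?S1 = "farey_between N a b (a + c) (b + d)" and ?S2 = "farey_between N (a + c) (b + d) c d"
    have fin: "finite ?S1" "finite ?S2" using less.prems by (auto intro!: finite_farey_between)
    have disj: "(a + c, b + d) \<notin> ?S1 \<union> ?S2" "?S1 \<inter> ?S2 = {}" by (auto simp: farey_between_def)
    have eq: "farey_between N a b c d = insert (a + c, b + d) (?S1 \<union> ?S2)"
      using less.prems False by (intro farey_between_split) auto
    have "sum ?F (farey_between N a b c d) = ?F (a + c, b + d) + sum ?F (?S1 \<union> ?S2)"
      unfolding eq using fin disj(1) by (intro sum.insert) auto
    also have "sum ?F (?S1 \<union> ?S2) = sum ?F ?S1 + sum ?F ?S2"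
      using fin disj(2) by (intro sum.union_disjoint) auto
    also have "sum ?F ?S1 = G (real_of_int (a + c) / real (b + d) - farey_right N (b + d) (- (a + c)))
        - G (real_of_int a / real b + farey_right N b a)"
      using less.prems False by (intro less.hyps) (auto simp: algebra_simps)
    also have "sum ?F ?S2 = G (real_of_int c / real d - farey_right N d (- c))
        - G (real_of_int (a + c) / real (b + d) + farey_right N (b + d) (a + c))"
      using less.prems False by (intro less.hyps) (auto simp: algebra_simps)
    finally show ?thesis by simp
  qed
qed

text \<open>\<open>G\<close> stands for a primitive along a horizontal line and \<open>A\<close> for
  its increment over one period. The fractions in the half-open unit interval are 0 and those
  strictly between 0 and 1, so the arcs cover one period.\<close>

theorem farey_dissection:
  fixes G :: "real \<Rightarrow> 'a :: ab_group_add"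
  assumes per: "\<And>x. G (x + 1) = G x + A" and N: "N \<ge> 1"
  shows "(\<Sum>k=1..N. \<Sum>h | h < k \<and> coprime h k.
            G (real h / real k + farey_right N k (int h)) - G (real h / real k - farey_right N k (- int h))) = A"
proof -
  let ?F = "\<lambda>(h, k). G (real_of_int h / real k + farey_right N k h) - G (real_of_int h / real k - farey_right N k (- h))"
  let ?S = "SIGMA k:{1..N}. {h. h < k \<and> coprime h k}"
  let ?B = "farey_between N 0 1 1 1"
  have den: "farey_den N 1 h = N" for h using N by (intro farey_den_eq) auto
  have bij: "bij_betw (\<lambda>(k, h). (int h, k)) ?S (insert (0, 1) ?B)"
  proof (rule bij_betwI [where g = "\<lambda>(h, k). (k, nat h)"])
    show "(\<lambda>(k, h). (int h, k)) \<in> ?S \<rightarrow> insert (0, 1) ?B"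
    proof (intro funcsetI, clarify)
      fix k h assume "k \<in> {1..N}" "h < k" "coprime h k" "(int h, k) \<notin> ?B"
      then show "int h = 0 \<and> k = 1"
        by (cases "h = 0") (auto simp: farey_between_def)
    qed
    show "(\<lambda>(h, k). (k, nat h)) \<in> insert (0, 1) ?B \<rightarrow> ?S"
    proof (rule funcsetI)
      fix x assume "x \<in> insert (0, 1) ?B"
      then consider "x = (0, 1)" | h k where "x = (h, k)" "0 < k" "k \<le> N" "coprime h (int k)" "0 < h" "h < int k"
        by (auto simp: farey_between_def)
      then show "(case x of (h, k) \<Rightarrow> (k, nat h)) \<in> ?S"
      proof cases
        case 1
        then show ?thesis using N by simp
      next
        case 2
        then obtain m where "h = int m" using zero_le_imp_eq_int by (metis less_imp_le)
        then show ?thesis using 2 by simp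
      qed
    qed
  qed (auto simp: farey_between_def)
  have "(\<Sum>k=1..N. \<Sum>h | h < k \<and> coprime h k.
            G (real h / real k + farey_right N k (int h)) - G (real h / real k - farey_right N k (- int h)))
      = (\<Sum>(k, h) \<in> ?S. ?F (int h, k))"
    by (subst sum.Sigma) auto
  also have "\<dots> = sum ?F (insert (0, 1) ?B)"
    using sum.reindex_bij_betw [OF bij, of ?F] by (simp add: case_prod_unfold)
  also have "\<dots> = ?F (0, 1) + sum ?F ?B"
  proof (rule sum.insert)
    show "finite ?B" by (rule finite_farey_between) auto
    show "(0, 1) \<notin> ?B" by (simp add: farey_between_def)
  qed
  also have "sum ?F ?B = G (1 - farey_right N 1 (- 1)) - G (farey_right N 1 0)"
    using farey_between_telescope [of 1 1 0 1 N G] N by simp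
  also have "?F (0, 1) + \<dots> = G (1 - farey_right N 1 (- 1)) - G (- farey_right N 1 0)" by simp
  \<comment> \<open>The left ends of the arcs at 0 and at 1 differ by exactly one period, as
    \<open>farey_den N 1\<close> is constantly \<open>N\<close>.\<close>
  also have "1 - farey_right N 1 (- 1) = - farey_right N 1 0 + 1" by (simp add: farey_right_def den del: One_nat_def)
  finally show ?thesis unfolding per by (simp only: add_diff_cancel_left')
qed

subsection \<open>The Bessel kernel\<close>

lemma power_double_plus_2: "t ^ (2 * m + 2) = t\<^sup>2 * (t\<^sup>2) ^ m" for t :: "'a :: comm_monoid_mult"
  by (subst add.commute) (simp only: power_add power_mult)

lemma bessel_I_2:
  assumes "x \<ge> 0"
  shows "(\<lambda>m. (x / 2) ^ (2 * m + 2) / (fact m * fact (m + 2))) sums bessel_I 2 x"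
proof -
  let ?f = "\<lambda>m. (x / 2) ^ (2 * m + 2) / (fact m * fact (m + 2))"
  have eq: "(x / 2) powr (2 + 2 * real m) / (fact m * Gamma (2 + real m + 1)) = ?f m" for m
  proof -
    have "Gamma (2 + real m + 1) = fact (m + 2)"
      using Gamma_fact [of "m + 2", where 'a = real] by (simp add: add_ac)
    moreover have "(x / 2) powr (2 + 2 * real m) = (x / 2) ^ (2 * m + 2)"
    proof (cases "x = 0")
      case False
      then have "(x / 2) powr real (2 * m + 2) = (x / 2) ^ (2 * m + 2)"
        using assms by (intro powr_realpow) auto
      then show ?thesis by (simp add: add_ac)
    qed auto
    ultimately show ?thesis by (simp only:)
  qed
  have "summable ?f"
  proof (rule summable_comparison_test' [where N = 0])
    have "summable (\<lambda>m. ((x / 2)\<^sup>2) ^ m / fact m)"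
      using summable_exp [of "(x / 2)\<^sup>2"] by (simp add: field_simps)
    then show "summable (\<lambda>m. (x / 2)\<^sup>2 * (((x / 2)\<^sup>2) ^ m / fact m))" by (rule summable_mult)
    fix m
    have "(fact m :: real) * 1 \<le> fact m * fact (m + 2)"
      by (intro mult_left_mono fact_ge_1) auto
    then have "(x / 2) ^ (2 * m + 2) / (fact m * fact (m + 2)) \<le> (x / 2) ^ (2 * m + 2) / (fact m * 1)"
      using assms by (intro divide_left_mono mult_pos_pos) auto
    also have "\<dots> = (x / 2)\<^sup>2 * (((x / 2)\<^sup>2) ^ m / fact m)"
      by (simp only: power_double_plus_2 mult_1_right times_divide_eq_right)
    finally show "norm (?f m) \<le> (x / 2)\<^sup>2 * (((x / 2)\<^sup>2) ^ m / fact m)" using assms by simp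
  qed
  then show ?thesis unfolding bessel_I_def eq by (rule summable_sums)
qed

text \<open>The quadratic vanishing at 0, with a constant uniform up to \<open>c\<close>: at
  \<open>x = c / m\<close> it makes the terms of the final series \<open>O(1 / m^2)\<close>.\<close>

lemma bessel_I_2_bound:
  assumes "0 \<le> x" "x \<le> c"
  shows "\<bar>bessel_I 2 x\<bar> \<le> exp ((c / 2)\<^sup>2) * (x / 2)\<^sup>2"
proof -
  have e: "(\<lambda>m. ((c / 2)\<^sup>2) ^ m / fact m * (x / 2)\<^sup>2) sums (exp ((c / 2)\<^sup>2) * (x / 2)\<^sup>2)"
    using exp_converges [of "(c / 2)\<^sup>2"]
    by (intro sums_mult2) (simp only: real_scaleR_def inverse_eq_divide times_divide_eq_left mult_1)
  have "(x / 2) ^ (2 * m + 2) / (fact m * fact (m + 2)) \<le> ((c / 2)\<^sup>2) ^ m / fact m * (x / 2)\<^sup>2" for m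
  proof -
    have "(fact m :: real) * 1 \<le> fact m * fact (m + 2)"
      by (intro mult_left_mono fact_ge_1) auto
    then have "(x / 2) ^ (2 * m + 2) / (fact m * fact (m + 2)) \<le> (x / 2) ^ (2 * m + 2) / (fact m * 1)"
      using assms by (intro divide_left_mono mult_pos_pos) auto
    also have "\<dots> = ((x / 2)\<^sup>2) ^ m / fact m * (x / 2)\<^sup>2"
      by (simp only: power_double_plus_2 mult_1_right times_divide_eq_left mult.commute [of "(x / 2)\<^sup>2"])
    also have "\<dots> \<le> ((c / 2)\<^sup>2) ^ m / fact m * (x / 2)\<^sup>2"
      using assms by (intro mult_right_mono divide_right_mono power_mono) auto
    finally show ?thesis .
  qed
  then have "bessel_I 2 x \<le> exp ((c / 2)\<^sup>2) * (x / 2)\<^sup>2" by (rule sums_le [OF _ bessel_I_2 [OF assms(1)] e])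
  moreover have "0 \<le> bessel_I 2 x"
    by (rule sums_le [OF _ sums_zero bessel_I_2 [OF assms(1)]]) (use assms in auto)
  ultimately show ?thesis by simp
qed

text \<open>The integrand of the main term on the arc around \<open>h / k\<close>, in the variable \<open>u = \<tau> - h / k\<close>.\<close>

definition bessel_kernel :: "real \<Rightarrow> real \<Rightarrow> complex \<Rightarrow> complex" where
  "bessel_kernel A B u = - \<i> * u * exp (\<i> * of_real A / u - \<i> * of_real B * u)"

text \<open>Only \<open>exp (\<i> * A / u)\<close> is expanded. Its term of index
  \<open>m + 2\<close>, multiplied by \<open>u\<close>, has a pole of order \<open>m + 1\<close> and
  so extracts the coefficient of index \<open>m\<close> of the entire factor; this offset by two is
  the order of the Bessel function.\<close>

lemma residue_bessel_kernel_term: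
  "residue (\<lambda>u. - \<i> * u * ((\<i> * of_real A / u) ^ (m + 2) / fact (m + 2)) * exp (- \<i> * of_real B * u)) 0
     = \<i> * of_real (A\<^sup>2 * ((A * B) ^ m / (fact m * fact (m + 2))))"
proof -
  define C where "C = - \<i> * (\<i> * of_real A) ^ (m + 2) / fact (m + 2)"
  have "residue (\<lambda>u. C * exp (- \<i> * of_real B * u) / u ^ Suc m) 0 = fps_nth (fps_const C * fps_exp (- \<i> * of_real B)) m"
    by (rule residue_fps_expansion_over_power_at_0) (intro fps_expansion_intros)
  also have "\<dots> = C * ((- \<i> * of_real B) ^ m / fact m)" by simp
  also have "\<dots> = \<i> * of_real (A\<^sup>2 * ((A * B) ^ m / (fact m * fact (m + 2))))"
  proof -
    have "(\<i> * of_real A) ^ (m + 2) * (- \<i> * of_real B) ^ m = (\<i> * of_real A)\<^sup>2 * ((\<i> * of_real A) * (- \<i> * of_real B)) ^ m"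
      by (simp only: power_add power_mult_distrib mult_ac)
    also have "(\<i> * of_real A) * (- \<i> * of_real B) = complex_of_real (A * B)"
      by (simp add: algebra_simps)
    also have "(\<i> * of_real A)\<^sup>2 * complex_of_real (A * B) ^ m = - of_real (A\<^sup>2 * (A * B) ^ m)"
      by (simp add: power_mult_distrib)
    finally have eq: "(\<i> * of_real A) ^ (m + 2) * (- \<i> * of_real B) ^ m = - complex_of_real (A\<^sup>2 * (A * B) ^ m)" .
    have "C * ((- \<i> * of_real B) ^ m / fact m) = - \<i> * ((\<i> * of_real A) ^ (m + 2) * (- \<i> * of_real B) ^ m) / (fact m * fact (m + 2))"
      by (simp only: C_def times_divide_times_eq mult_ac)
    then show ?thesis unfolding eq by simp
  qed
  finally have "residue (\<lambda>u. C * exp (- \<i> * of_real B * u) / u ^ Suc m) 0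
      = \<i> * of_real (A\<^sup>2 * ((A * B) ^ m / (fact m * fact (m + 2))))" .
  moreover have "residue (\<lambda>u. - \<i> * u * ((\<i> * of_real A / u) ^ (m + 2) / fact (m + 2)) * exp (- \<i> * of_real B * u)) 0
      = residue (\<lambda>u. C * exp (- \<i> * of_real B * u) / u ^ Suc m) 0"
  proof (rule residue_cong)
    have pd: "(x / u) ^ (m + 2) = x ^ (m + 2) / (u * u ^ Suc m)" for x u :: complex
      by (simp add: power_divide)
    have rearrange: "- \<i> * u * (X / (u * U) / F) * E = (- \<i> * X / F) * E / U" if "u \<noteq> 0" for X U F E u :: complex
      using that by simp
    have "eventually (\<lambda>u. u \<noteq> (0 :: complex)) (at 0)" by (simp add: eventually_at_filter)
    then show "\<forall>\<^sub>F u in at 0. - \<i> * u * ((\<i> * of_real A / u) ^ (m + 2) / fact (m + 2)) * exp (- \<i> * of_real B * u)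
        = C * exp (- \<i> * of_real B * u) / u ^ Suc m"
      by eventually_elim (simp only: C_def pd rearrange not_False_eq_True)
  qed simp
  ultimately show ?thesis by simp
qed

text \<open>The exponential series converges uniformly on the unit circle, so residues may be added.
  With \<open>A^2 * (A * B) ^ m = A / B * (A * B) ^ Suc m\<close> the sum is the Bessel
  series.\<close>

lemma residue_bessel_kernel:
  assumes "A > 0" "B > 0"
  shows "residue (bessel_kernel A B) 0 = \<i> * of_real (A / B * bessel_I 2 (2 * sqrt (A * B)))"
proof -
  define f where "f m u = - \<i> * u * ((\<i> * of_real A / u) ^ m / fact m) * exp (- \<i> * of_real B * u)" for m and u :: complex
  let ?c = "circlepath 0 1"
  have hol: "f m holomorphic_on UNIV - {0}" for m
    unfolding f_def by (intro holomorphic_intros) auto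
  have ci: "(f m has_contour_integral (2 * of_real pi * \<i> * residue (f m) 0)) ?c" for m
    using base_residue [OF open_UNIV _ zero_less_one hol] by simp
  \<comment> \<open>The factor \<open>u\<close> of the kernel absorbs a pole of order at most
    one.\<close>
  have low: "residue (f m) 0 = 0" if "m < 2" for m
  proof -
    from that consider "m = 0" | "m = 1" by linarith
    then show ?thesis
    proof cases
      case 1
      have "f m = (\<lambda>u. - \<i> * u * exp (- \<i> * of_real B * u))"
        by (rule ext) (simp add: f_def 1)
      moreover have "(\<lambda>u. - \<i> * u * exp (- \<i> * of_real B * u)) holomorphic_on UNIV"
        by (intro holomorphic_intros)
      ultimately have "f m holomorphic_on UNIV" by (simp only:)
      then show ?thesis by (intro residue_holo [of UNIV]) auto
    next
      case 2
      have "residue (f m) 0 = residue (\<lambda>u. - \<i> * (\<i> * of_real A) * exp (- \<i> * of_real B * u)) 0"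
      proof (rule residue_cong)
        have "eventually (\<lambda>u. u \<noteq> (0 :: complex)) (at 0)" by (simp add: eventually_at_filter)
        then show "\<forall>\<^sub>F u in at 0. f m u = - \<i> * (\<i> * of_real A) * exp (- \<i> * of_real B * u)"
          by eventually_elim (simp add: f_def 2)
      qed simp
      also have "\<dots> = 0"
        by (rule residue_holo [of UNIV]) (auto intro!: holomorphic_intros)
      finally show ?thesis .
    qed
  qed
  have lim: "uniform_limit (sphere 0 1) (\<lambda>M u. \<Sum>m<M. f m u) (bessel_kernel A B) sequentially"
  proof -
    have "uniform_limit (sphere 0 1) (\<lambda>M u. \<Sum>m<M. f m u) (\<lambda>u. suminf (\<lambda>m. f m u)) sequentially"
    proof (rule Weierstrass_m_test)
      show "norm (f m u) \<le> A ^ m / fact m * exp B" if "u \<in> sphere 0 1" for m u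
      proof -
        have "norm u = 1" using that by simp
        moreover have "B * Im u \<le> B * 1" using abs_Im_le_cmod [of u] \<open>norm u = 1\<close> assms
          by (intro mult_left_mono) auto
        moreover have "norm (f m u) = A ^ m / fact m * exp (B * Im u)"
          using \<open>norm u = 1\<close> assms by (simp add: f_def norm_mult norm_divide norm_power norm_exp_eq_Re)
        ultimately show ?thesis using assms by (auto intro!: mult_left_mono divide_right_mono)
      qed
      have "summable (\<lambda>m. A ^ m / fact m)" using summable_exp [of A] by (simp add: field_simps)
      then show "summable (\<lambda>m. A ^ m / fact m * exp B)" by (rule summable_mult2)
    qed
    moreover have "suminf (\<lambda>m. f m u) = bessel_kernel A B u" for u
    proof -
      have "(\<lambda>m. (\<i> * of_real A / u) ^ m / fact m) sums exp (\<i> * of_real A / u)"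
        using exp_converges [of "\<i> * of_real A / u"] by (simp add: scaleR_conv_of_real field_simps)
      then have "(\<lambda>m. - \<i> * u * ((\<i> * of_real A / u) ^ m / fact m) * exp (- \<i> * of_real B * u))
          sums (- \<i> * u * exp (\<i> * of_real A / u) * exp (- \<i> * of_real B * u))"
        by (intro sums_mult sums_mult2)
      also have "- \<i> * u * exp (\<i> * of_real A / u) * exp (- \<i> * of_real B * u) = bessel_kernel A B u"
        by (simp add: bessel_kernel_def exp_diff exp_minus field_simps)
      finally show ?thesis unfolding f_def by (rule sums_unique [symmetric])
    qed
    ultimately show ?thesis by simp
  qed
  have cont: "(f m) contour_integrable_on ?c" for m using ci by (rule has_contour_integral_integrable)
  have "(\<lambda>M. contour_integral ?c (\<lambda>u. \<Sum>m<M. f m u)) \<longlonglongrightarrow> contour_integral ?c (bessel_kernel A B)"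
  proof (rule contour_integral_uniform_limit_circlepath(2) [OF _ lim])
    show "eventually (\<lambda>M. (\<lambda>u. \<Sum>m<M. f m u) contour_integrable_on ?c) sequentially"
      by (intro always_eventually allI contour_integrable_sum cont) auto
  qed auto
  moreover have "contour_integral ?c (\<lambda>u. \<Sum>m<M. f m u) = (\<Sum>m<M. 2 * of_real pi * \<i> * residue (f m) 0)" for M
    using cont contour_integral_unique [OF ci] by (simp add: contour_integral_sum)
  moreover have "contour_integral ?c (bessel_kernel A B) = 2 * of_real pi * \<i> * residue (bessel_kernel A B) 0"
  proof -
    have "bessel_kernel A B holomorphic_on UNIV - {0}"
      unfolding bessel_kernel_def by (intro holomorphic_intros) auto
    from base_residue [OF open_UNIV _ zero_less_one this] show ?thesis
      by (intro contour_integral_unique) simp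
  qed
  ultimately have "(\<lambda>m. 2 * of_real pi * \<i> * residue (f m) 0) sums (2 * of_real pi * \<i> * residue (bessel_kernel A B) 0)"
    by (simp only: sums_def)
  then have s: "(\<lambda>m. residue (f m) 0) sums residue (bessel_kernel A B) 0"
    by (subst (asm) sums_mult_iff) auto
  have "(\<lambda>m. residue (f (m + 2)) 0) sums (residue (bessel_kernel A B) 0 - (\<Sum>m<2. residue (f m) 0))"
    using s by (subst sums_iff_shift)  simp
  moreover have "(\<Sum>m<2. residue (f m) 0) = 0" by (rule sum.neutral) (use low in auto)
  ultimately have 1: "(\<lambda>m. residue (f (m + 2)) 0) sums residue (bessel_kernel A B) 0" by simp
  have 2: "residue (f (m + 2)) 0 = \<i> * of_real (A\<^sup>2 * ((A * B) ^ m / (fact m * fact (m + 2))))" for m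
    unfolding f_def by (rule residue_bessel_kernel_term)
  have "(\<lambda>m. sqrt (A * B) ^ (2 * m + 2) / (fact m * fact (m + 2))) sums bessel_I 2 (2 * sqrt (A * B))"
    using bessel_I_2 [of "2 * sqrt (A * B)"] assms by simp
  moreover have "sqrt (A * B) ^ (2 * m + 2) = (A * B) ^ Suc m" for m
  proof -
    have "sqrt (A * B) ^ (2 * m + 2) = (sqrt (A * B) ^ 2) ^ Suc m" by (simp only: power_mult [symmetric]) simp
    then show ?thesis using assms by simp
  qed
  ultimately have "(\<lambda>m. A / B * ((A * B) ^ Suc m / (fact m * fact (m + 2)))) sums (A / B * bessel_I 2 (2 * sqrt (A * B)))"
    by (intro sums_mult) simp
  then have "(\<lambda>m. A\<^sup>2 * ((A * B) ^ m / (fact m * fact (m + 2)))) sums (A / B * bessel_I 2 (2 * sqrt (A * B)))"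
    using assms by (simp add: power2_eq_square mult.assoc)
  then have "(\<lambda>m. \<i> * of_real (A\<^sup>2 * ((A * B) ^ m / (fact m * fact (m + 2))))) sums
      (\<i> * of_real (A / B * bessel_I 2 (2 * sqrt (A * B))))"
    by (intro sums_mult sums_of_real)
  with 1 2 show ?thesis by (simp add: sums_iff)
qed

lemma norm_bessel_kernel_le:
  assumes "norm u \<le> r" "A * Im u / (norm u)\<^sup>2 \<le> K" "B * Im u \<le> L"
  shows "norm (bessel_kernel A B u) \<le> r * exp (K + L)"
proof -
  have "Re (\<i> * of_real A / u - \<i> * of_real B * u) = A * Im u / (norm u)\<^sup>2 + B * Im u"
    by (simp add: Re_divide cmod_power2)
  then have "norm (bessel_kernel A B u) = norm u * exp (A * Im u / (norm u)\<^sup>2 + B * Im u)"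
    unfolding bessel_kernel_def norm_mult norm_exp_eq_Re by simp
  also have "\<dots> \<le> r * exp (K + L)"
    using assms by (intro mult_mono) (auto intro: order_trans [OF norm_ge_zero])
  finally show ?thesis .
qed

text \<open>
  The segment is completed to a rectangle around the origin; the three added sides stay away from
  the region where the kernel is large.
\<close>

lemma bessel_kernel_segment:
  assumes AB: "A > 0" "B > 0" and e: "e > 0" and t: "0 < \<eta>" "\<eta> \<le> t1" "t1 \<le> \<Theta>" "\<eta> \<le> t2" "t2 \<le> \<Theta>" "e \<le> \<Theta>"
    and K: "A * e / \<eta>\<^sup>2 \<le> K" and L: "B * e \<le> L"
  shows "norm (contour_integral (linepath (Complex (- t1) e) (Complex t2 e)) (bessel_kernel A B)
            - of_real (2 * pi * (A / B) * bessel_I 2 (2 * sqrt (A * B))))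
       \<le> 12 * \<Theta>\<^sup>2 * exp (K + L)"
proof -
  let ?g = "bessel_kernel A B"
  define a1 a2 a3 a4 where "a1 = Complex (- t1) (- e)" and "a2 = Complex t2 (- e)"
    and "a3 = Complex t2 e" and "a4 = Complex (- t1) e"
  have pos: "t1 > 0" "t2 > 0" "\<Theta> > 0" using t by auto
  have hol: "?g holomorphic_on UNIV - {0}"
    unfolding bessel_kernel_def by (intro holomorphic_intros) auto
  have box: "0 \<in> box a1 a3" using pos e by (simp add: a1_def a3_def in_box_complex_iff)
  have img: "path_image (rectpath a1 a3) = cbox a1 a3 - box a1 a3"
    by (rule path_image_rectpath_cbox_minus_box) (use pos e in \<open>auto simp: a1_def a3_def\<close>)
  have "contour_integral (rectpath a1 a3) ?g
      = 2 * of_real pi * \<i> * (\<Sum>p\<in>{0}. winding_number (rectpath a1 a3) p * residue ?g p)"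
  proof -
    have "path_image (rectpath a1 a3) \<subseteq> UNIV - {0}" using box img by auto
    then show ?thesis
      using Residue_theorem [OF open_UNIV connected_UNIV _ hol, of "rectpath a1 a3"] by simp
  qed
  also have "\<dots> = 2 * of_real pi * \<i> * residue ?g 0"
    using winding_number_rectpath [OF box] by simp
  also have "\<dots> = - of_real (2 * pi * (A / B) * bessel_I 2 (2 * sqrt (A * B)))"
    unfolding residue_bessel_kernel [OF AB] by (simp add: algebra_simps)
  finally have tot: "contour_integral (rectpath a1 a3) ?g = - of_real (2 * pi * (A / B) * bessel_I 2 (2 * sqrt (A * B)))" .
  have path: "rectpath a1 a3 = linepath a1 a2 +++ linepath a2 a3 +++ linepath a3 a4 +++ linepath a4 a1"
    by (simp add: rectpath_def a1_def a2_def a3_def a4_def Let_def)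
  have 0: "0 \<notin> closed_segment a1 a2" "0 \<notin> closed_segment a2 a3" "0 \<notin> closed_segment a3 a4" "0 \<notin> closed_segment a4 a1"
  proof -
    have "0 \<notin> path_image (rectpath a1 a3)" using box img by simp
    then show "0 \<notin> closed_segment a1 a2" "0 \<notin> closed_segment a2 a3" "0 \<notin> closed_segment a3 a4" "0 \<notin> closed_segment a4 a1"
      unfolding path by (auto simp: path_image_join)
  qed
  have int: "?g contour_integrable_on linepath x y" if "0 \<notin> closed_segment x y" for x y
    by (rule contour_integrable_continuous_linepath)
       (use that hol in \<open>auto intro!: holomorphic_on_imp_continuous_on holomorphic_on_subset [OF hol]\<close>)
  have "contour_integral (rectpath a1 a3) ?g
     = contour_integral (linepath a1 a2) ?g + (contour_integral (linepath a2 a3) ?g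
       + (contour_integral (linepath a3 a4) ?g + contour_integral (linepath a4 a1) ?g))"
    unfolding path using int 0 by (simp add: contour_integrable_joinI)
  \<comment> \<open>A counterclockwise rectangle runs along its top from right to left; this sign
    cancels the one from \<open>\<i> * \<i>\<close> in the residue theorem.\<close>
  moreover have "contour_integral (linepath a3 a4) ?g = - contour_integral (linepath a4 a3) ?g"
    using 0(3) by (intro contour_integral_reverse_linepath holomorphic_on_imp_continuous_on
        holomorphic_on_subset [OF hol]) auto
  ultimately have eq: "contour_integral (linepath a4 a3) ?g - of_real (2 * pi * (A / B) * bessel_I 2 (2 * sqrt (A * B)))
     = contour_integral (linepath a1 a2) ?g + contour_integral (linepath a2 a3) ?g + contour_integral (linepath a4 a1) ?g"
    using tot by (simp add: algebra_simps)
  \<comment> \<open>A bound for the kernel on each added side. Three sides of length at most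
    \<open>2 * \<Theta>\<close> then account for the constant 12.\<close>
  define C where "C = 2 * \<Theta> * exp (K + L)"
  have C: "0 \<le> C" using pos by (simp add: C_def)
  have K0: "0 \<le> K" using K AB e t by (smt (verit) divide_nonneg_nonneg mult_nonneg_nonneg zero_le_power2)
  have L0: "0 \<le> L" using L AB e by (smt (verit) mult_nonneg_nonneg)
  have nle: "norm u \<le> 2 * \<Theta>" if "\<bar>Re u\<bar> \<le> \<Theta>" "\<bar>Im u\<bar> \<le> \<Theta>" for u
    using cmod_le [of u] that by linarith
  \<comment> \<open>Below the real axis both parts of the real exponent are nonpositive, however
    close the side is to the origin.\<close>
  have bottom: "norm (contour_integral (linepath a1 a2) ?g) \<le> C * (2 * \<Theta>)"
  proof -
    have "norm (contour_integral (linepath a1 a2) ?g) \<le> C * norm (a2 - a1)"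
    proof (rule contour_integral_bound_linepath [OF int [OF 0(1)] C])
      fix u assume "u \<in> closed_segment a1 a2"
      then have u: "Im u = - e" "- t1 \<le> Re u" "Re u \<le> t2"
        using pos by (auto simp: a1_def a2_def closed_segment_same_Im closed_segment_eq_real_ivl)
      show "norm (?g u) \<le> C" unfolding C_def
      proof (rule norm_bessel_kernel_le)
        show "norm u \<le> 2 * \<Theta>" using u t e by (intro nle) auto
        have "A * Im u / (norm u)\<^sup>2 \<le> 0" using u AB e by (intro divide_nonpos_nonneg) auto
        then show "A * Im u / (norm u)\<^sup>2 \<le> K" using K0 by simp
        have "B * Im u \<le> 0" using u AB e by simp
        then show "B * Im u \<le> L" using L0 by simp
      qed
    qed
    also have "norm (a2 - a1) \<le> 2 * \<Theta>"
      using cmod_le [of "a2 - a1"] t pos by (simp add: a1_def a2_def)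
    finally show ?thesis using C by (simp add: mult_left_mono)
  qed
  \<comment> \<open>On a vertical side \<open>norm u \<ge> \<eta>\<close> at every height, which
    caps the exponent by \<open>A * e / \<eta>^2\<close>.\<close>
  have side: "norm (contour_integral (linepath x y) ?g) \<le> C * (2 * \<Theta>)"
    if xy: "Re x = s" "Re y = s" "Im x = - e \<and> Im y = e \<or> Im x = e \<and> Im y = - e" "\<eta> \<le> \<bar>s\<bar>" "\<bar>s\<bar> \<le> \<Theta>" "0 \<notin> closed_segment x y" for x y s
  proof -
    have "norm (contour_integral (linepath x y) ?g) \<le> C * norm (y - x)"
    proof (rule contour_integral_bound_linepath [OF int [OF xy(6)] C])
      fix u assume "u \<in> closed_segment x y"
      then have u: "Re u = s" "\<bar>Im u\<bar> \<le> e"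
        using xy e by (auto simp: closed_segment_same_Re closed_segment_eq_real_ivl)
      show "norm (?g u) \<le> C" unfolding C_def
      proof (rule norm_bessel_kernel_le)
        show "norm u \<le> 2 * \<Theta>" using u t xy by (intro nle) auto
        have s: "\<eta>\<^sup>2 \<le> (norm u)\<^sup>2"
          using u xy t by (intro power_mono order_trans [OF _ abs_Re_le_cmod]) auto
        have "A * Im u / (norm u)\<^sup>2 \<le> A * e / (norm u)\<^sup>2"
          using u AB by (intro divide_right_mono mult_left_mono) auto
        also have "\<dots> \<le> A * e / \<eta>\<^sup>2"
          using s AB e t by (intro divide_left_mono mult_pos_pos) (auto intro: less_le_trans [of 0 "\<eta>\<^sup>2"])
        finally show "A * Im u / (norm u)\<^sup>2 \<le> K" using K by simp
        have "B * Im u \<le> B * e" using u AB by (intro mult_left_mono) auto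
        then show "B * Im u \<le> L" using L by simp
      qed
    qed
    also have "norm (y - x) \<le> 2 * \<Theta>" using cmod_le [of "y - x"] xy t e by auto
    finally show ?thesis using C by (simp add: mult_left_mono)
  qed
  have right: "norm (contour_integral (linepath a2 a3) ?g) \<le> C * (2 * \<Theta>)"
    by (rule side [of _ t2]) (use t 0 in \<open>auto simp: a2_def a3_def\<close>)
  have left: "norm (contour_integral (linepath a4 a1) ?g) \<le> C * (2 * \<Theta>)"
    by (rule side [of _ "- t1"]) (use t 0 in \<open>auto simp: a1_def a4_def\<close>)
  have "norm (contour_integral (linepath a4 a3) ?g - of_real (2 * pi * (A / B) * bessel_I 2 (2 * sqrt (A * B))))
      \<le> C * (2 * \<Theta>) + C * (2 * \<Theta>) + C * (2 * \<Theta>)"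
    unfolding eq using bottom right left by (intro norm_triangle_le add_mono) auto
  also have "\<dots> = 12 * \<Theta>\<^sup>2 * exp (K + L)" by (simp add: C_def power2_eq_square)
  finally show ?thesis by (simp add: a4_def a3_def)
qed

subsection \<open>Euler's product at a cusp\<close>

text \<open>The upper half-plane is convex, so the integrand of the coefficient formula has a global
  primitive there. Its increment over a period is constant because the integrand is periodic, which
  makes the choice of height free for each \<open>N\<close>.\<close>

lemma power_series_coefficient_primitive:
  fixes a :: "nat \<Rightarrow> complex"
  assumes sums: "\<And>q. norm q < 1 \<Longrightarrow> (\<lambda>k. a k * q ^ k) sums F q"
  obtains P where
    "\<And>\<tau>. Im \<tau> > 0 \<Longrightarrow>
       (P has_field_derivative F (exp (2 * of_real pi * \<i> * \<tau>)) * exp (- 2 * of_real pi * \<i> * of_nat n * \<tau>)) (at \<tau>)"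
    "\<And>\<tau>. Im \<tau> > 0 \<Longrightarrow> P (\<tau> + 1) = P \<tau> + a n"
proof -
  define f where "f \<tau> = F (exp (2 * of_real pi * \<i> * \<tau>)) * exp (- 2 * of_real pi * \<i> * of_nat n * \<tau>)" for \<tau>
  let ?H = "{\<tau>. Im \<tau> > 0}"
  have H: "convex ?H" "open ?H" by (auto intro: convex_halfspace_Im_gt open_halfspace_Im_gt)
  have Fhol: "F holomorphic_on ball 0 1"
    by (rule power_series_holomorphic [of 0 1 a]) (use sums in \<open>simp add: dist_norm\<close>)
  have q: "norm (exp (2 * of_real pi * \<i> * \<tau>)) < 1" if "Im \<tau> > 0" for \<tau>
    using that by (simp add: norm_exp_eq_Re)
  have "(\<lambda>\<tau>. F (exp (2 * of_real pi * \<i> * \<tau>))) holomorphic_on ?H"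
    by (rule holomorphic_on_compose_gen [OF _ Fhol, unfolded o_def])
       (use q in \<open>auto intro!: holomorphic_intros\<close>)
  then have fhol: "f holomorphic_on ?H" unfolding f_def
    by (intro holomorphic_on_mult) (auto intro!: holomorphic_intros)
  obtain P where "\<And>\<tau>. \<tau> \<in> ?H \<Longrightarrow> (P has_field_derivative f \<tau>) (at \<tau> within ?H)"
    using holomorphic_convex_primitive' [OF H fhol] by blast
  then have P: "(P has_field_derivative f \<tau>) (at \<tau>)" if "Im \<tau> > 0" for \<tau>
    using that H(2) by (metis at_within_open mem_Collect_eq)
  have per: "f (\<tau> + 1) = f \<tau>" for \<tau>
  proof -
    have "exp (2 * of_real pi * \<i> * (\<tau> + 1)) = exp (2 * of_real pi * \<i> * \<tau>)"
      using exp_two_pi_ii_shift [of \<tau> 1] by simp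
    moreover have "exp (- 2 * of_real pi * \<i> * of_nat n * (\<tau> + 1)) = exp (- 2 * of_real pi * \<i> * of_nat n * \<tau>)"
    proof -
      have "- 2 * of_real pi * \<i> * of_nat n * (\<tau> + 1)
          = - 2 * of_real pi * \<i> * of_nat n * \<tau> + 2 * of_real pi * \<i> * of_int (- int n)"
        by (simp add: algebra_simps)
      then show ?thesis by (simp only: exp_add exp_two_pi_ii_int mult_1_right)
    qed
    ultimately show ?thesis by (simp only: f_def)
  qed
  have D: "((\<lambda>\<tau>. P (\<tau> + 1) - P \<tau>) has_field_derivative 0) (at \<tau> within ?H)" if "\<tau> \<in> ?H" for \<tau>
  proof -
    have "((\<lambda>\<tau>. P (\<tau> + 1)) has_field_derivative f (\<tau> + 1)) (at \<tau>)"
      using DERIV_shift [of P "f (\<tau> + 1)" \<tau> 1] P [of "\<tau> + 1"] that by simp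
    from DERIV_diff [OF this P] that show ?thesis
      by (auto simp: per intro: has_field_derivative_at_within)
  qed
  obtain c where c: "\<And>\<tau>. \<tau> \<in> ?H \<Longrightarrow> P (\<tau> + 1) - P \<tau> = c"
    using has_field_derivative_zero_constant [OF H(1) D] by blast
  \<comment> \<open>The constant may be computed at height 1, where
    \<open>q = exp (2 * pi * \<i> * \<tau>)\<close> turns the unit segment into a circle of radius
    \<open>exp (- 2 * pi)\<close> and the derivative of \<open>q\<close> contributes the factor that
    lowers the exponent of \<open>1 / q ^ Suc n\<close> to \<open>n\<close>.\<close>
  have "c = a n"
  proof -
    have "(f has_contour_integral (P (\<i> + 1) - P \<i>)) (linepath \<i> (\<i> + 1))"
    proof -
      have "path_image (linepath \<i> (\<i> + 1)) \<subseteq> ?H"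
        unfolding path_image_linepath by (rule closed_segment_subset) (use H in auto)
      from contour_integral_primitive [of ?H P f, OF _ valid_path_linepath this] show ?thesis
        using P by (auto intro: has_field_derivative_at_within)
    qed
    then have 1: "((\<lambda>t. f (linepath \<i> (\<i> + 1) t)) has_integral (P (\<i> + 1) - P \<i>)) {0..1}"
      by (simp add: has_contour_integral_linepath)
    define r where "r = exp (- 2 * pi)"
    have r: "0 < r" "r < 1" by (auto simp: r_def)
    have "F has_fps_expansion Abs_fps a"
    proof (rule has_fps_expansionI)
      have "eventually (\<lambda>u :: complex. u \<in> ball 0 1) (nhds 0)" by (intro eventually_nhds_in_open) auto
      then show "eventually (\<lambda>u. (\<lambda>n. fps_nth (Abs_fps a) n * u ^ n) sums F u) (nhds 0)"
        by eventually_elim (use sums in simp)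
    qed
    then have res: "residue (\<lambda>q. F q / q ^ Suc n) 0 = a n"
      using residue_fps_expansion_over_power_at_0 [of F "Abs_fps a" n] by simp
    have "(\<lambda>q. F q / q ^ Suc n) holomorphic_on ball 0 1 - {0}"
      by (intro holomorphic_on_divide holomorphic_on_power holomorphic_on_id
          holomorphic_on_subset [OF Fhol]) (auto simp: holomorphic_on_id [unfolded id_def])
    then have "((\<lambda>q. F q / q ^ Suc n) has_contour_integral (2 * of_real pi * \<i> * a n)) (circlepath 0 r)"
      using base_residue [of "ball 0 1" 0 r "\<lambda>q. F q / q ^ Suc n"] r res
      by (auto simp: cball_subset_ball_iff)
    then have "((\<lambda>t. F (circlepath 0 r t) / circlepath 0 r t ^ Suc n * vector_derivative (circlepath 0 r) (at t within {0..1}))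
        has_integral (2 * of_real pi * \<i> * a n)) {0..1}"
      by (simp add: has_contour_integral_def)
    then have "((\<lambda>t. 2 * of_real pi * \<i> * f (linepath \<i> (\<i> + 1) t)) has_integral (2 * of_real pi * \<i> * a n)) {0..1}"
    proof (rule has_integral_eq [rotated])
      fix t :: real assume t: "t \<in> {0..1}"
      define x where "x = linepath \<i> (\<i> + 1) t"
      define w where "w = exp (2 * of_real pi * \<i> * x)"
      have x: "x = \<i> + of_real t" by (simp add: x_def linepath_def algebra_simps scaleR_conv_of_real)
      have w: "circlepath 0 r t = w"
      proof -
        have "2 * of_real pi * \<i> * x = - 2 * of_real pi + 2 * of_real pi * \<i> * of_real t"
          by (simp add: x algebra_simps)
        then have "w = exp (- 2 * of_real pi) * exp (2 * of_real pi * \<i> * of_real t)"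
          unfolding w_def by (simp only: exp_add)
        also have "exp (- 2 * of_real pi) = complex_of_real r" by (simp add: r_def exp_of_real [symmetric])
        finally show ?thesis by (simp add: circlepath)
      qed
      have v: "vector_derivative (circlepath 0 r) (at t within {0..1}) = 2 * of_real pi * \<i> * w"
      proof -
        have "vector_derivative (circlepath 0 r) (at t within {0..1})
            = 2 * of_real pi * \<i> * (of_real r * exp (2 * of_real pi * \<i> * of_real t))"
          using vector_derivative_circlepath01 [of t 0 r] t by (simp add: mult.assoc)
        also have "of_real r * exp (2 * of_real pi * \<i> * of_real t) = w"
          using w by (simp add: circlepath)
        finally show ?thesis .
      qed
      have wn: "exp (- 2 * of_real pi * \<i> * of_nat n * x) = 1 / w ^ n"
      proof -
        have "- 2 * of_real pi * \<i> * of_nat n * x = - (of_nat n * (2 * of_real pi * \<i> * x))" by (simp add: algebra_simps)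
        then have "exp (- 2 * of_real pi * \<i> * of_nat n * x) = inverse (exp (of_nat n * (2 * of_real pi * \<i> * x)))"
          by (simp only: exp_minus)
        then show ?thesis by (simp only: exp_of_nat_mult w_def inverse_eq_divide)
      qed
      have "w \<noteq> 0" by (simp add: w_def)
      then show "F (circlepath 0 r t) / circlepath 0 r t ^ Suc n * vector_derivative (circlepath 0 r) (at t within {0..1})
          = 2 * of_real pi * \<i> * f (linepath \<i> (\<i> + 1) t)"
        unfolding w v x_def [symmetric] f_def wn w_def [symmetric] by simp
    qed
    moreover have "((\<lambda>t. 2 * of_real pi * \<i> * f (linepath \<i> (\<i> + 1) t)) has_integral (2 * of_real pi * \<i> * (P (\<i> + 1) - P \<i>))) {0..1}"
      using 1 by (rule has_integral_mult_right)
    ultimately have "2 * of_real pi * \<i> * a n = 2 * of_real pi * \<i> * (P (\<i> + 1) - P \<i>)"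
      by (rule has_integral_unique)
    then have "a n = P (\<i> + 1) - P \<i>" by simp
    then show ?thesis using c [of \<i>] by simp
  qed
  then show ?thesis
    using that [of P] P c unfolding f_def by (auto simp: algebra_simps)
qed

text \<open>Removing the constant term 1, which yields the main term, must leave something linear in
  \<open>norm q\<close>: this factor has to pay for the growth of the kernel. The derivative is
  bounded on a compact disc inside the unit disc.\<close>

lemma inverse_euler_fun_bound:
  assumes \<rho>: "0 < \<rho>" "\<rho> < 1"
  obtains D where "D \<ge> 0" "\<And>q. norm q \<le> \<rho> \<Longrightarrow> norm (1 / euler_fun q - 1) \<le> D * norm q"
proof -
  let ?h = "\<lambda>q. 1 / euler_fun q"
  have hol: "?h holomorphic_on ball 0 1"
    by (intro holomorphic_on_divide holomorphic_on_const euler_fun_holomorphic) (simp add: euler_fun_nonzero)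
  have sub: "cball 0 \<rho> \<subseteq> ball (0 :: complex) 1" using \<rho> by auto
  have "continuous_on (cball 0 \<rho>) (deriv ?h)"
    using holomorphic_deriv [OF hol open_ball] sub
    by (metis holomorphic_on_imp_continuous_on continuous_on_subset)
  then have "compact (deriv ?h ` cball 0 \<rho>)" by (intro compact_continuous_image) auto
  then obtain D where D: "D > 0" "\<And>q. q \<in> cball 0 \<rho> \<Longrightarrow> norm (deriv ?h q) \<le> D"
    using compact_imp_bounded bounded_pos by (metis imageI)
  have "norm (?h q - ?h 0) \<le> D * norm (q - 0)" if "norm q \<le> \<rho>" for q
  proof (rule field_differentiable_bound [of "cball 0 \<rho>" ?h "deriv ?h"])
    show "(?h has_field_derivative deriv ?h z) (at z within cball 0 \<rho>)" if "z \<in> cball 0 \<rho>" for z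
      using holomorphic_derivI [OF hol open_ball] that sub has_field_derivative_at_within by blast
  qed (use D that \<rho> in auto)
  then have "norm (?h q - 1) \<le> D * norm q" if "norm q \<le> \<rho>" for q
    using that by (simp add: euler_fun_0)
  then show ?thesis using that [of D] D(1) by auto
qed

lemma inverse_euler_fun_product_bound:
  assumes \<rho>: "0 < \<rho>" "\<rho> < 1"
  obtains D where "D \<ge> 0" "\<And>q q' r. norm q \<le> r \<Longrightarrow> norm q' \<le> r \<Longrightarrow> r \<le> \<rho> \<Longrightarrow>
     norm (1 / (euler_fun q * euler_fun q') - 1) \<le> D * r"
proof -
  obtain D where D: "D \<ge> 0" "\<And>q. norm q \<le> \<rho> \<Longrightarrow> norm (1 / euler_fun q - 1) \<le> D * norm q"
    using inverse_euler_fun_bound [OF \<rho>] by blast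
  have "norm (1 / (euler_fun q * euler_fun q') - 1) \<le> (D * (1 + D) + D) * r"
    if "norm q \<le> r" "norm q' \<le> r" "r \<le> \<rho>" for q q' r
  proof -
    define x y where "x = 1 / euler_fun q" and "y = 1 / euler_fun q'"
    have r: "0 \<le> r" using that(1) norm_ge_zero order_trans by blast
    have x: "norm (x - 1) \<le> D * r" and y: "norm (y - 1) \<le> D * r"
      unfolding x_def y_def using D that by (meson mult_left_mono order_trans)+
    have "norm y \<le> 1 + norm (y - 1)" using norm_triangle_ineq [of 1 "y - 1"] by simp
    also have "D * r \<le> D * 1" using that \<rho> D(1) by (intro mult_left_mono) auto
    then have "1 + norm (y - 1) \<le> 1 + D" using y by simp
    finally have ny: "norm y \<le> 1 + D" .
    have "1 / (euler_fun q * euler_fun q') - 1 = (x - 1) * y + (y - 1)" by (simp add: x_def y_def algebra_simps)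
    also have "norm \<dots> \<le> norm (x - 1) * norm y + norm (y - 1)" by (metis norm_mult norm_triangle_ineq)
    also have "\<dots> \<le> D * r * (1 + D) + D * r"
      using x y ny D(1) r by (intro add_mono mult_mono) auto
    also have "\<dots> = (D * (1 + D) + D) * r" by (simp add: algebra_simps)
    finally show ?thesis .
  qed
  then show ?thesis using that [of "D * (1 + D) + D"] D(1) by auto
qed

definition arc_factor :: "nat \<Rightarrow> nat \<Rightarrow> nat \<Rightarrow> nat \<Rightarrow> complex" where
  "arc_factor p n k h =
        exp (- (2 * of_real pi * of_nat n * of_nat h * \<i>) / of_nat k
             + of_real pi * of_real (dedekind_sum (int h) k) * \<i>
             + of_real pi
                 * of_real (dedekind_sum (int (p * h div gcd p k)) (k div gcd p k)) * \<i>)"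

lemma norm_arc_factor: "norm (arc_factor p n k h) = 1"
proof -
  have "- (2 * of_real pi * of_nat n * of_nat h * \<i>) / of_nat k = - (2 * of_real pi * of_nat n * of_nat h / of_nat k) * \<i>"
    by simp
  also have "\<dots> = of_real (- (2 * pi * real n * real h / real k)) * \<i>" by simp
  finally show ?thesis unfolding arc_factor_def norm_exp_eq_Re by simp
qed

lemma neg_inverse_mod:
  assumes "coprime (h :: int) m"
  obtains H where "[h * H = - 1] (mod m)"
proof -
  obtain x where "[h * x = 1] (mod m)" using cong_solve_coprime_int [OF assms] by blast
  then have "[- (h * x) = - 1] (mod m)" by (simp add: cong_minus_minus_iff)
  then have "[h * (- x) = - 1] (mod m)" by simp
  then show ?thesis by (rule that)
qed

text \<open>
  The transformation of both factors at the cusp \<open>h / k\<close>, with \<open>z = - i k u\<close>. Taking \<open>gcd p k\<close> out of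
  the second factor treats the cases \<open>p dvd k\<close> and \<open>\<not> p dvd k\<close> at once.
\<close>

lemma euler_product_at_cusp:
  fixes p n h k :: nat
  assumes p: "p > 0" and k: "k > 0" and hk: "coprime h k" and u: "Im u > 0"
  defines "g \<equiv> gcd p k"
  defines "q \<equiv> exp (2 * of_real pi * \<i> * (of_real (real h / real k) + u))"
  defines "X \<equiv> Im u / ((real k)\<^sup>2 * (norm u)\<^sup>2)"
  obtains q1 q2 where
    "norm q1 = exp (- 2 * pi * X)" "norm q2 = exp (- 2 * pi * ((real g)\<^sup>2 / real p) * X)"
    "1 / (euler_fun q * euler_fun (q ^ p)) * exp (- 2 * of_real pi * \<i> * of_nat n * (of_real (real h / real k) + u))
     = of_real (sqrt (real p / real g) * real k) * arc_factor p n k h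
       * bessel_kernel (pi * (1 + (real g)\<^sup>2 / real p) / (12 * (real k)\<^sup>2)) (pi * (24 * real n - real p - 1) / 12) u
       * (1 / (euler_fun q1 * euler_fun q2))"
proof -
  \<comment> \<open>In lowest terms \<open>p * h / k\<close> is \<open>m * h / K\<close>; this is
    the cusp seen by the second factor.\<close>
  define K where "K = k div g"
  define m where "m = p div g"
  define h' where "h' = p * h div g"
  have g0: "g > 0" using p by (simp add: g_def)
  have pk: "p = g * m" "k = g * K" by (simp_all add: g_def m_def K_def)
  have h': "h' = m * h" using g0 by (simp add: h'_def pk(1) mult.assoc)
  have m0: "m > 0" and K0: "K > 0" using pk p k by (auto intro: Nat.gr0I)
  have "coprime m K" unfolding m_def K_def g_def using p by (intro div_gcd_coprime) auto
  moreover have "coprime h K" using hk pk(2) by simp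
  ultimately have h'K: "coprime h' K" by (simp add: h')
  obtain H1 where H1: "[int h * H1 = - 1] (mod int k)" using neg_inverse_mod [of "int h" "int k"] hk by auto
  obtain H2 where H2: "[int h' * H2 = - 1] (mod int K)" using neg_inverse_mod [of "int h'" "int K"] h'K by auto
  define z where "z = - \<i> * of_nat k * u"
  \<comment> \<open>Chosen so that \<open>(h' + \<i> * z') / K\<close> equals
    \<open>p * (h / k + u)\<close>, which holds because \<open>K * p = k * m\<close>.\<close>
  define z' where "z' = of_nat m * z"
  have u0: "u \<noteq> 0" using u by auto
  have z: "Re z > 0" "z \<noteq> 0" using u u0 k by (auto simp: z_def)
  have z': "Re z' > 0" "z' \<noteq> 0" using z m0 by (auto simp: z'_def)
  have iz: "1 / z = \<i> / (of_nat k * u)" using u0 k by (simp add: z_def field_simps)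
  have iz': "1 / z' = 1 / of_nat m * (\<i> / (of_nat k * u))" by (simp add: z'_def flip: iz)
  define q1 where "q1 = exp (2 * of_real pi * \<i> * ((of_int H1 + \<i> / z) / of_nat k))"
  define q2 where "q2 = exp (2 * of_real pi * \<i> * ((of_int H2 + \<i> / z') / of_nat K))"
  have Re_iu: "Re (\<i> / u) = Im u / (norm u)\<^sup>2" by (simp add: Re_divide cmod_power2)
  have Re_lin: "Re (of_real x * \<i> - of_real y * w) = - y * Re w" for x y w by simp
  have n1: "norm q1 = exp (- 2 * pi * X)"
  proof -
    have "2 * of_real pi * \<i> * ((of_int H1 + \<i> / z) / of_nat k)
        = of_real (2 * pi * of_int H1 / real k) * \<i> - of_real (2 * pi / (real k)\<^sup>2) * (\<i> / u)"
    proof -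
      have eq: "\<i> / z = - (1 / (of_nat k * u))"
        using arg_cong [OF iz, of "\<lambda>x. \<i> * x"] by simp
      show ?thesis unfolding eq using k u0 by (simp add: field_simps power2_eq_square)
    qed
    then have "Re (2 * of_real pi * \<i> * ((of_int H1 + \<i> / z) / of_nat k)) = - 2 * pi * X"
      by (simp only: Re_lin Re_iu) (simp add: X_def)
    then show ?thesis by (simp only: q1_def norm_exp_eq_Re)
  qed
  have n2: "norm q2 = exp (- 2 * pi * ((real g)\<^sup>2 / real p) * X)"
  proof -
    have c: "1 / (real m * real k * real K) = (real g)\<^sup>2 / real p / (real k)\<^sup>2"
      using g0 m0 K0 unfolding pk of_nat_mult by (simp add: field_simps power2_eq_square)
    have "2 * of_real pi * \<i> * ((of_int H2 + \<i> / z') / of_nat K)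
        = of_real (2 * pi * of_int H2 / real K) * \<i> - of_real (2 * pi * (1 / (real m * real k * real K))) * (\<i> / u)"
    proof -
      have eq: "\<i> / z' = - (1 / (of_nat m * (of_nat k * u)))"
        using arg_cong [OF iz', of "\<lambda>x. \<i> * x"] by simp
      show ?thesis unfolding eq using m0 k K0 u0 by (simp add: field_simps)
    qed
    then have "Re (2 * of_real pi * \<i> * ((of_int H2 + \<i> / z') / of_nat K)) = - 2 * pi * ((real g)\<^sup>2 / real p) * X"
      unfolding c by (simp only: Re_lin Re_iu) (simp add: X_def)
    then show ?thesis by (simp only: q2_def norm_exp_eq_Re)
  qed
  let ?s1 = "dedekind_sum (int h) k" and ?s2 = "dedekind_sum (int h') K"
  let ?v = "of_real (real h / real k) + u"
  define x1 where "x1 = of_real pi / (12 * of_nat k) * (1 / z - z)"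
  define x2 where "x2 = of_real pi / (12 * of_nat K) * (1 / z' - z')"
  have iz0: "\<i> * z = of_nat k * u" by (simp add: z_def algebra_simps)
  have M1: "euler_fun q1 = exp (of_real pi * \<i> * of_real ?s1) * csqrt z * exp x1 * euler_fun q"
  proof -
    have "(of_int (int h) + \<i> * z) / of_nat k = ?v" unfolding iz0 using k by (simp add: field_simps)
    then show ?thesis
      using euler_fun_modular [OF k H1 z(1)] unfolding q1_def q_def x1_def by (simp only:)
  qed
  have M2: "euler_fun q2 = exp (of_real pi * \<i> * of_real ?s2) * csqrt z' * exp x2 * euler_fun (q ^ p)"
  proof -
    have "\<i> * z' = of_nat m * (of_nat k * u)" by (simp add: z'_def iz0 [symmetric])
    then have "(of_int (int h') + \<i> * z') / of_nat K = of_nat p * ?v"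
      using k K0 g0 by (simp add: h' pk field_simps)
    then have "2 * of_real pi * \<i> * ((of_int (int h') + \<i> * z') / of_nat K) = of_nat p * (2 * of_real pi * \<i> * ?v)"
      by (simp only: mult_ac)
    then have "exp (2 * of_real pi * \<i> * ((of_int (int h') + \<i> * z') / of_nat K)) = q ^ p"
      by (simp only: exp_of_nat_mult q_def)
    then show ?thesis
      using euler_fun_modular [OF K0 H2 z'(1)] unfolding q2_def x2_def by (simp only:)
  qed
  \<comment> \<open>The two weights of one half combine to a linear factor in \<open>z\<close>, so
    the transformed integrand extends to the whole punctured plane once the product is replaced by
    1.\<close>
  have root: "csqrt z * csqrt z' = of_real (sqrt (real m)) * z"
  proof -
    have "csqrt z * csqrt z' = csqrt (z * z')" by (rule csqrt_mult_right_halfplane [OF z(1) z'(1)])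
    also have "z * z' = (of_real (sqrt (real m)) * z)\<^sup>2"
    proof -
      have "(complex_of_real (sqrt (real m)))\<^sup>2 = of_real ((sqrt (real m))\<^sup>2)" by (simp only: of_real_power)
      then have "(complex_of_real (sqrt (real m)))\<^sup>2 = of_nat m" by simp
      then show ?thesis unfolding z'_def power_mult_distrib by (simp add: power2_eq_square)
    qed
    also have "csqrt \<dots> = of_real (sqrt (real m)) * z"
      using z m0 by (intro csqrt_square) simp
    finally show ?thesis .
  qed
  \<comment> \<open>\<open>A\<close> collects the terms \<open>1 / z\<close> and
    \<open>1 / z'\<close> of the two transformations; \<open>B\<close> collects their linear terms
    and the factor \<open>exp (- 2 * pi * \<i> * n * u)\<close>.\<close>
  define A where "A = pi * (1 + (real g)\<^sup>2 / real p) / (12 * (real k)\<^sup>2)"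
  define B where "B = pi * (24 * real n - real p - 1) / 12"
  define a1 where "a1 = pi / (12 * (real k)\<^sup>2)"
  define a2 where "a2 = pi / 12 * ((real g)\<^sup>2 / real p / (real k)\<^sup>2)"
  have e1: "x1 = \<i> * of_real a1 / u + \<i> * of_real (pi / 12) * u"
  proof -
    have "x1 = of_real pi / (12 * of_nat k) * (\<i> / (of_nat k * u) + \<i> * of_nat k * u)"
      unfolding x1_def iz by (simp add: z_def)
    then show ?thesis using k u0 by (simp add: a1_def field_simps power2_eq_square)
  qed
  have e2: "x2 = \<i> * of_real a2 / u + \<i> * of_real (pi / 12 * real p) * u"
  proof -
    have a2: "a2 = pi / 12 / (real m * real k * real K)"
      using g0 m0 K0 unfolding a2_def pk of_nat_mult by (simp add: field_simps power2_eq_square)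
    have pK: "real p = real m * real k / real K"
      using g0 K0 unfolding pk of_nat_mult by simp
    have "x2 = of_real pi / (12 * of_nat K) * (1 / of_nat m * (\<i> / (of_nat k * u)) + \<i> * of_nat m * of_nat k * u)"
      unfolding x2_def iz' by (simp add: z'_def z_def)
    then show ?thesis unfolding a2 pK using k K0 m0 u0 by (simp add: field_simps)
  qed
  have ex: "of_real pi * \<i> * of_real ?s1 + of_real pi * \<i> * of_real ?s2 + (x1 + x2) - 2 * of_real pi * \<i> * of_nat n * ?v
     = (- (2 * of_real pi * of_nat n * of_nat h * \<i>) / of_nat k + of_real pi * of_real ?s1 * \<i> + of_real pi * of_real ?s2 * \<i>)
       + (\<i> * of_real A / u - \<i> * of_real B * u)"
  proof -
    have "A = a1 + a2" by (simp add: A_def a1_def a2_def add_divide_distrib distrib_left)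
    then have 1: "\<i> * of_real A / u = \<i> * of_real a1 / u + \<i> * of_real a2 / u"
      by (simp add: distrib_left add_divide_distrib)
    have Beq: "B = 2 * pi * real n - pi / 12 - pi / 12 * real p" by (simp add: B_def field_simps)
    have Bc: "complex_of_real B = 2 * of_real pi * of_nat n - of_real (pi / 12) - of_real (pi / 12 * real p)"
      unfolding Beq by simp
    have 2: "\<i> * of_real B * u = 2 * of_real pi * \<i> * of_nat n * u - \<i> * of_real (pi / 12) * u - \<i> * of_real (pi / 12 * real p) * u"
      unfolding Bc by (simp only: algebra_simps)
    have 3: "2 * of_real pi * \<i> * of_nat n * ?v
        = (2 * of_real pi * of_nat n * of_nat h * \<i>) / of_nat k + 2 * of_real pi * \<i> * of_nat n * u"
      by (simp add: algebra_simps)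
    show ?thesis unfolding e1 e2 1 2 3 by (simp add: algebra_simps)
  qed
  have "1 / (euler_fun q * euler_fun (q ^ p))
     = exp (of_real pi * \<i> * of_real ?s1) * exp (of_real pi * \<i> * of_real ?s2) * (csqrt z * csqrt z') * (exp x1 * exp x2)
       * (1 / (euler_fun q1 * euler_fun q2))"
    unfolding M1 M2 using z z' by simp
  then have "1 / (euler_fun q * euler_fun (q ^ p)) * exp (- 2 * of_real pi * \<i> * of_nat n * ?v)
     = (of_real (sqrt (real m)) * z)
       * exp (of_real pi * \<i> * of_real ?s1 + of_real pi * \<i> * of_real ?s2 + (x1 + x2) - 2 * of_real pi * \<i> * of_nat n * ?v)
       * (1 / (euler_fun q1 * euler_fun q2))"
    unfolding root by (simp add: exp_add exp_diff exp_minus field_simps)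
  also have "\<dots> = of_real (sqrt (real m)) * z * (arc_factor p n k h * exp (\<i> * of_real A / u - \<i> * of_real B * u))
       * (1 / (euler_fun q1 * euler_fun q2))"
    unfolding ex by (simp only: exp_add arc_factor_def h'_def K_def g_def)
  also have "\<dots> = of_real (sqrt (real m) * real k) * arc_factor p n k h * bessel_kernel A B u
       * (1 / (euler_fun q1 * euler_fun q2))"
    by (simp add: bessel_kernel_def z_def)
  also have "real m = real p / real g" using g0 by (simp add: pk(1))
  finally show ?thesis using that [OF n1 n2] by (simp only: A_def B_def)
qed

subsection \<open>The circle method\<close>

text \<open>The closed-contour value of the main term on an arc with denominator \<open>k\<close>,
  up to the unimodular \<open>arc_factor\<close>; it is the same for all numerators.\<close>

definition arc_weight :: "nat \<Rightarrow> nat \<Rightarrow> nat \<Rightarrow> real" where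
  "arc_weight p n k =
     (let A = pi * (1 + (real (gcd p k))\<^sup>2 / real p) / (12 * (real k)\<^sup>2);
          B = pi * (24 * real n - real p - 1) / 12
      in sqrt (real p / real (gcd p k)) * real k * (2 * pi * (A / B) * bessel_I 2 (2 * sqrt (A * B))))"

text \<open>\<open>1 + x\<close> governs the growth of the kernel and \<open>24 * min 1 x\<close>
  the decay of the product. For \<open>x \<le> 1\<close> the last inequality amounts to
  \<open>x \<ge> 1 / 23\<close>, for \<open>x \<ge> 1\<close> to \<open>x \<le> 23\<close>.\<close>

lemma gcd_square_ratio_bounds:
  fixes p k :: nat
  assumes "0 < p" "p \<le> 23"
  defines "x \<equiv> (real (gcd p k))\<^sup>2 / real p"
  shows "1 / 23 \<le> x" "x \<le> 23" "1 + x \<le> 24 * min 1 x"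
proof -
  have g: "1 \<le> real (gcd p k)" "real (gcd p k) \<le> real p"
    using assms by (auto simp: Suc_le_eq intro: dvd_imp_le)
  have "1 / 23 \<le> 1 / real p" using assms by (intro divide_left_mono) auto
  also have "\<dots> \<le> x" unfolding x_def using g by (intro divide_right_mono) (auto simp: one_le_power)
  finally show 1: "1 / 23 \<le> x" .
  have "x \<le> (real p)\<^sup>2 / real p" unfolding x_def using g by (intro divide_right_mono power_mono) auto
  also have "\<dots> \<le> 23" using assms by (simp add: power2_eq_square)
  finally show 2: "x \<le> 23" .
  show "1 + x \<le> 24 * min 1 x" using 1 2 by (auto simp: min_def)
qed

text \<open>
  The hypothesis \<open>p \<le> 23\<close> makes the nonprincipal part of the transformed product small enough to
  compensate the exponential growth of the kernel.
\<close>

lemma arc_estimate: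
  fixes p n :: nat and P :: "complex \<Rightarrow> complex"
  assumes p: "0 < p" "p \<le> 23" and n: "24 * n > p + 1"
    and P: "\<And>\<tau>. Im \<tau> > 0 \<Longrightarrow> (P has_field_derivative
       1 / (euler_fun (exp (2 * of_real pi * \<i> * \<tau>)) * euler_fun (exp (2 * of_real pi * \<i> * \<tau>) ^ p))
         * exp (- 2 * of_real pi * \<i> * of_nat n * \<tau>)) (at \<tau>)"
  obtains D where "D \<ge> 0"
    "\<And>N k h t1 t2. \<lbrakk>1 \<le> k; k \<le> N; coprime h k;
        1 / (2 * real k * real N) \<le> t1; t1 \<le> 1 / (real k * real N);
        1 / (2 * real k * real N) \<le> t2; t2 \<le> 1 / (real k * real N)\<rbrakk> \<Longrightarrow>
      norm (P (Complex (real h / real k + t2) (1 / (real N)\<^sup>2)) - P (Complex (real h / real k - t1) (1 / (real N)\<^sup>2))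
             - of_real (arc_weight p n k) * arc_factor p n k h) \<le> D / (real k * (real N)\<^sup>2)"
proof -
  \<comment> \<open>The largest value of \<open>exp (- 2 * pi * \<mu> * X)\<close> allowed by
    \<open>\<mu> \<ge> 1 / 23\<close> and \<open>X \<ge> 1 / 2\<close>.\<close>
  define \<rho> where "\<rho> = exp (- (pi / 23))"
  have \<rho>: "0 < \<rho>" "\<rho> < 1" by (auto simp: \<rho>_def)
  obtain D0 where D0: "D0 \<ge> 0" "\<And>q q' r. norm q \<le> r \<Longrightarrow> norm q' \<le> r \<Longrightarrow> r \<le> \<rho> \<Longrightarrow>
     norm (1 / (euler_fun q * euler_fun q') - 1) \<le> D0 * r"
    using inverse_euler_fun_product_bound [OF \<rho>] by blast
  define B where "B = pi * (24 * real n - real p - 1) / 12"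
  have B: "B > 0" using n by (simp add: B_def)
  \<comment> \<open>The 5 bounds \<open>sqrt (p / g)\<close>. The first term is the error of
    replacing the product by 1, with a factor 2 each from \<open>norm u\<close> and from the length
    of the arc; the second comes from closing the contour.\<close>
  define D where "D = 5 * (4 * exp B * D0 + 12 * exp (8 * pi + B))"
  have "norm (P (Complex (real h / real k + t2) (1 / (real N)\<^sup>2)) - P (Complex (real h / real k - t1) (1 / (real N)\<^sup>2))
             - of_real (arc_weight p n k) * arc_factor p n k h) \<le> D / (real k * (real N)\<^sup>2)"
    if k: "1 \<le> k" "k \<le> N" and hk: "coprime h k"
      and t1: "1 / (2 * real k * real N) \<le> t1" "t1 \<le> 1 / (real k * real N)"
      and t2: "1 / (2 * real k * real N) \<le> t2" "t2 \<le> 1 / (real k * real N)" for N k h t1 t2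
  proof -
    define g where "g = gcd p k"
    define x where "x = (real g)\<^sup>2 / real p"
    define A where "A = pi * (1 + x) / (12 * (real k)\<^sup>2)"
    define C where "C = of_real (sqrt (real p / real g) * real k) * arc_factor p n k h"
    define \<Theta> where "\<Theta> = 1 / (real k * real N)"
    define e where "e = 1 / (real N)\<^sup>2"
    define v where "v = complex_of_real (real h / real k)"
    define l r where "l = Complex (- t1) e" and "r = Complex t2 e"
    have x: "1 / 23 \<le> x" "x \<le> 23" "1 + x \<le> 24 * min 1 x"
      using gcd_square_ratio_bounds [OF p, of k] by (auto simp: x_def g_def)
    have kN: "real k > 0" "real N > 0" "real k \<le> real N" using k by auto
    have A: "A > 0" unfolding A_def using x(1) kN by (intro divide_pos_pos mult_pos_pos) auto
    have e: "e > 0" using kN by (simp add: e_def)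
    have \<Theta>: "\<Theta> > 0" using kN by (simp add: \<Theta>_def)
    have e\<Theta>: "e \<le> \<Theta>" unfolding e_def \<Theta>_def power2_eq_square using kN
      by (intro divide_left_mono mult_right_mono mult_pos_pos) auto
    have e1: "e \<le> 1" unfolding e_def using k by simp
    have tpos: "t1 > 0" "t2 > 0" using t1(1) t2(1) kN by (auto intro: less_le_trans [rotated])
    have norm_C: "norm C \<le> 5 * real k"
    proof -
      have "real p / real g \<le> real p / 1"
        using p by (intro divide_left_mono) (auto simp: g_def Suc_le_eq)
      also have "\<dots> \<le> 5\<^sup>2" using p by simp
      finally have "sqrt (real p / real g) \<le> 5" by (rule real_le_lsqrt [rotated]) simp
      moreover have "norm C = sqrt (real p / real g) * real k"
        by (simp add: C_def norm_mult norm_arc_factor)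
      ultimately show ?thesis using kN by (simp add: mult_right_mono)
    qed
    let ?g = "bessel_kernel A B"
    define f where "f u = 1 / (euler_fun (exp (2 * of_real pi * \<i> * (v + u))) * euler_fun (exp (2 * of_real pi * \<i> * (v + u)) ^ p))
         * exp (- 2 * of_real pi * \<i> * of_nat n * (v + u))" for u
    have seg: "Im u = e" "- t1 \<le> Re u" "Re u \<le> t2" "norm u \<le> 2 * \<Theta>" "(norm u)\<^sup>2 \<le> \<Theta>\<^sup>2 + e\<^sup>2"
      if "u \<in> closed_segment l r" for u
    proof -
      show u: "Im u = e" "- t1 \<le> Re u" "Re u \<le> t2"
        using that tpos by (auto simp: l_def r_def closed_segment_same_Im closed_segment_eq_real_ivl)
      have re: "\<bar>Re u\<bar> \<le> \<Theta>" using u t1 t2 by (auto simp: \<Theta>_def)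
      show "norm u \<le> 2 * \<Theta>" using cmod_le [of u] re u(1) e e\<Theta> by linarith
      have "(Re u)\<^sup>2 \<le> \<Theta>\<^sup>2" using re \<Theta> by (metis abs_le_square_iff abs_of_pos)
      then show "(norm u)\<^sup>2 \<le> \<Theta>\<^sup>2 + e\<^sup>2" using u(1) by (simp add: cmod_power2)
    qed
    have fi: "(f has_contour_integral (P (v + r) - P (v + l))) (linepath l r)"
    proof -
      have "((\<lambda>u. P (v + u)) has_field_derivative f u) (at u within {u. Im u > 0})" if "u \<in> {u. Im u > 0}" for u
      proof -
        have "Im (u + v) > 0" using that by (simp add: v_def)
        then have "((\<lambda>u. P (u + v)) has_field_derivative f u) (at u)"
          using P [of "u + v"] by (simp add: DERIV_shift [symmetric] f_def add.commute)
        then show ?thesis by (simp add: add.commute has_field_derivative_at_within)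
      qed
      moreover have "path_image (linepath l r) \<subseteq> {u. Im u > 0}" using seg(1) e by auto
      ultimately show ?thesis
        using contour_integral_primitive [of "{u. Im u > 0}" "\<lambda>u. P (v + u)" f "linepath l r"] by simp
    qed
    have "?g contour_integrable_on linepath l r"
    proof (rule contour_integrable_continuous_linepath)
      have "0 \<notin> closed_segment l r" using seg(1) [of 0] e by auto
      then show "continuous_on (closed_segment l r) ?g"
        unfolding bessel_kernel_def by (intro continuous_intros) auto
    qed
    then have gi: "((\<lambda>u. C * ?g u) has_contour_integral (C * contour_integral (linepath l r) ?g)) (linepath l r)"
      by (intro has_contour_integral_lmul has_contour_integral_integral)
    have diff: "norm (f u - C * ?g u) \<le> 5 * real k * (2 * \<Theta> * exp B * D0)" if u: "u \<in> closed_segment l r" for u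
    proof -
      note u' = seg [OF u]
      have Im: "Im u > 0" using u'(1) e by simp
      then have nu: "norm u > 0" by auto
      define X where "X = Im u / ((real k)\<^sup>2 * (norm u)\<^sup>2)"
      obtain q1 q2 where q: "norm q1 = exp (- 2 * pi * X)" "norm q2 = exp (- 2 * pi * x * X)"
        and eq: "f u = C * ?g u * (1 / (euler_fun q1 * euler_fun q2))"
        using euler_product_at_cusp [of p k h u n] p k hk Im
        unfolding f_def v_def C_def A_def B_def X_def x_def g_def by (auto simp: mult.assoc)
      define \<mu> where "\<mu> = min 1 x"
      have \<mu>: "1 / 23 \<le> \<mu>" "\<mu> \<le> 1" "\<mu> \<le> x" "1 + x \<le> 24 * \<mu>" using x by (auto simp: \<mu>_def)
      \<comment> \<open>The height \<open>1 / N^2\<close> is matched to the arc length: both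
        \<open>k^2 * \<Theta>^2\<close> and \<open>k^2 * e^2\<close> are at most
        \<open>e\<close>.\<close>
      have X: "1 / 2 \<le> X"
      proof -
        have "(real k)\<^sup>2 * (norm u)\<^sup>2 \<le> (real k)\<^sup>2 * (\<Theta>\<^sup>2 + e\<^sup>2)"
          using u'(5) by (intro mult_left_mono) auto
        also have "\<dots> = e + (real k)\<^sup>2 * e\<^sup>2"
          using kN by (simp add: \<Theta>_def e_def distrib_left power_divide power_mult_distrib)
        also have "(real k)\<^sup>2 * e\<^sup>2 \<le> (real N)\<^sup>2 * e\<^sup>2" using kN by (intro mult_right_mono power_mono) auto
        also have "(real N)\<^sup>2 * e\<^sup>2 = e" using kN by (simp add: e_def power2_eq_square)
        finally have "(real k)\<^sup>2 * (norm u)\<^sup>2 \<le> 2 * e" by simp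
        then have "e / (2 * e) \<le> X" unfolding X_def u'(1) using e kN nu by (intro divide_left_mono mult_pos_pos) auto
        then show ?thesis using e by simp
      qed
      define R where "R = exp (- 2 * pi * \<mu> * X)"
      have mono: "exp (- 2 * pi * s) \<le> exp (- 2 * pi * t)" if "t \<le> s" for s t
        using that by simp
      have "norm (1 / (euler_fun q1 * euler_fun q2) - 1) \<le> D0 * R"
      proof (rule D0(2))
        show "norm q1 \<le> R" "norm q2 \<le> R"
          using mono [of "\<mu> * X" X] mono [of "\<mu> * X" "x * X"] \<mu> X mult_right_mono [of \<mu> 1 X] mult_right_mono [of \<mu> x X]
          by (auto simp: q R_def mult.assoc)
        have "1 / 23 * (1 / 2) \<le> \<mu> * X" using \<mu> X by (intro mult_mono) auto
        then have "pi * (1 / 23 * (1 / 2)) \<le> pi * (\<mu> * X)" by (intro mult_left_mono) auto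
        then show "R \<le> \<rho>" by (simp add: R_def \<rho>_def mult.assoc)
      qed
      moreover have "norm (?g u) \<le> 2 * \<Theta> * exp (pi * (1 + x) / 12 * X + B)"
      proof (rule norm_bessel_kernel_le [OF u'(4)])
        have "A * Im u / (norm u)\<^sup>2 = pi * (1 + x) / 12 * X" by (simp add: A_def X_def mult.commute)
        then show "A * Im u / (norm u)\<^sup>2 \<le> pi * (1 + x) / 12 * X" by simp
        show "B * Im u \<le> B" using u'(1) e1 B by simp
      qed
      ultimately have "norm C * norm (?g u) * norm (1 / (euler_fun q1 * euler_fun q2) - 1)
          \<le> 5 * real k * (2 * \<Theta> * exp (pi * (1 + x) / 12 * X + B)) * (D0 * R)"
        using norm_C \<Theta> D0(1) kN by (intro mult_mono) auto
      also have "\<dots> = 5 * real k * (2 * \<Theta> * exp B * D0) * (exp (pi * (1 + x) / 12 * X) * R)"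
        by (simp add: exp_add)
      \<comment> \<open>Growth and decay balance: the combined exponent is a nonpositive multiple of
        \<open>X\<close>, so the bound is uniform along the arc.\<close>
      also have "\<dots> \<le> 5 * real k * (2 * \<Theta> * exp B * D0) * 1"
      proof (rule mult_left_mono)
        have "pi * (1 + x) / 12 * X + - 2 * pi * \<mu> * X = - (pi * X / 12 * (24 * \<mu> - (1 + x)))"
          by (simp add: field_simps)
        also have "\<dots> \<le> 0" using \<mu>(4) X by simp
        finally have "exp (pi * (1 + x) / 12 * X + - 2 * pi * \<mu> * X) \<le> 1" by simp
        then show "exp (pi * (1 + x) / 12 * X) * R \<le> 1" unfolding R_def exp_add .
        show "0 \<le> 5 * real k * (2 * \<Theta> * exp B * D0)" using \<Theta> D0(1) by simp
      qed
      finally have "norm C * norm (?g u) * norm (1 / (euler_fun q1 * euler_fun q2) - 1) \<le> 5 * real k * (2 * \<Theta> * exp B * D0)"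
        by simp
      moreover have "f u - C * ?g u = C * ?g u * (1 / (euler_fun q1 * euler_fun q2) - 1)"
        unfolding eq by (simp only: right_diff_distrib mult_1_right)
      ultimately show ?thesis by (simp only: norm_mult)
    qed
    have 1: "norm (P (v + r) - P (v + l) - C * contour_integral (linepath l r) ?g)
        \<le> 5 * real k * (2 * \<Theta> * exp B * D0) * (2 * \<Theta>)"
    proof -
      have "norm (P (v + r) - P (v + l) - C * contour_integral (linepath l r) ?g)
          \<le> 5 * real k * (2 * \<Theta> * exp B * D0) * norm (r - l)"
        by (rule has_contour_integral_bound_linepath [OF has_contour_integral_diff [OF fi gi]])
           (use \<Theta> D0(1) diff in auto)
      also have "norm (r - l) \<le> 2 * \<Theta>"
      proof -
        have "norm (r - l) \<le> t2 + t1" using cmod_le [of "r - l"] tpos by (simp add: l_def r_def)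
        also have "\<dots> \<le> 2 * \<Theta>" using t1(2) t2(2) by (simp add: \<Theta>_def [symmetric])
        finally show ?thesis .
      qed
      finally show ?thesis using \<Theta> D0(1) by (simp add: mult_left_mono)
    qed
    have 2: "norm (contour_integral (linepath l r) ?g - of_real (2 * pi * (A / B) * bessel_I 2 (2 * sqrt (A * B))))
        \<le> 12 * \<Theta>\<^sup>2 * exp (8 * pi + B)"
      unfolding l_def r_def
    \<comment> \<open>The Farey lower bound on the half-arcs serves as \<open>\<eta>\<close>; it
      makes the exponent on the vertical sides independent of \<open>k\<close> and
      \<open>N\<close>.\<close>
    proof (rule bessel_kernel_segment [OF A B e, where \<eta> = "1 / (2 * real k * real N)"])
      have "A * e / (1 / (2 * real k * real N))\<^sup>2 = pi * (1 + x) / 3"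
        using kN by (simp add: A_def e_def field_simps power2_eq_square)
      also have "\<dots> \<le> 8 * pi" using x(2) by simp
      finally show "A * e / (1 / (2 * real k * real N))\<^sup>2 \<le> 8 * pi" .
      show "B * e \<le> B" using e1 B by simp
    qed (use t1 t2 e\<Theta> kN in \<open>auto simp: \<Theta>_def\<close>)
    have W: "of_real (arc_weight p n k) * arc_factor p n k h = C * of_real (2 * pi * (A / B) * bessel_I 2 (2 * sqrt (A * B)))"
      by (simp add: arc_weight_def Let_def C_def A_def B_def x_def g_def)
    have Cpl: "Complex (real h / real k + t2) (1 / (real N)\<^sup>2) = v + r" "Complex (real h / real k - t1) (1 / (real N)\<^sup>2) = v + l"
      by (simp_all add: v_def r_def l_def e_def complex_eq_iff)
    have "norm (P (v + r) - P (v + l) - of_real (arc_weight p n k) * arc_factor p n k h)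
        = norm ((P (v + r) - P (v + l) - C * contour_integral (linepath l r) ?g)
          + C * (contour_integral (linepath l r) ?g - of_real (2 * pi * (A / B) * bessel_I 2 (2 * sqrt (A * B)))))"
      unfolding W by (simp add: algebra_simps)
    also have "\<dots> \<le> 5 * real k * (2 * \<Theta> * exp B * D0) * (2 * \<Theta>) + 5 * real k * (12 * \<Theta>\<^sup>2 * exp (8 * pi + B))"
      by (rule norm_triangle_le, unfold norm_mult, intro add_mono 1 mult_mono norm_C 2) auto
    also have "\<dots> = D * (real k * \<Theta>\<^sup>2)" by (simp add: D_def algebra_simps power2_eq_square)
    also have "real k * \<Theta>\<^sup>2 = 1 / (real k * (real N)\<^sup>2)" using kN by (simp add: \<Theta>_def power2_eq_square)
    finally show ?thesis unfolding Cpl by simp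
  qed
  moreover have "D \<ge> 0" using D0(1) by (simp add: D_def)
  ultimately show ?thesis using that by blast
qed

lemma b_coeff_eq_sum_arc_factor: "b_coeff p k n = (\<Sum>h | h < k \<and> coprime h k. arc_factor p n k h)"
  by (simp add: b_coeff_def arc_factor_def)

lemma card_coprime_less_le: "card {h. h < k \<and> coprime h k} \<le> k"
  using card_mono [of "{..<k}" "{h. h < k \<and> coprime h k}"] by auto

lemma norm_b_coeff_le: "norm (b_coeff p k n) \<le> real k"
proof -
  have "norm (b_coeff p k n) \<le> (\<Sum>h | h < k \<and> coprime h k. 1)"
    unfolding b_coeff_eq_sum_arc_factor by (rule order_trans [OF norm_sum]) (simp add: norm_arc_factor)
  also have "\<dots> \<le> real k" using card_coprime_less_le [of k] by simp
  finally show ?thesis .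
qed

text \<open>At most \<open>k\<close> arcs have denominator \<open>k\<close>, each with error
  \<open>D / (k * N^2)\<close>, so the \<open>N\<close> denominators together cost
  \<open>D / N\<close>. The arcs change with \<open>N\<close> but their main terms do not, hence the
  main terms form partial sums of one series.\<close>

lemma circle_method_partial_sums:
  fixes p n :: nat and a :: "nat \<Rightarrow> complex"
  assumes p: "0 < p" "p \<le> 23"
    and a: "\<And>q. norm q < 1 \<Longrightarrow> (\<lambda>k. a k * q ^ k) sums (1 / (euler_fun q * euler_fun (q ^ p)))"
    and n: "24 * n > p + 1"
  shows "(\<lambda>N. \<Sum>k=1..N. of_real (arc_weight p n k) * b_coeff p k n) \<longlonglongrightarrow> a n"
proof -
  obtain P where P: "\<And>\<tau>. Im \<tau> > 0 \<Longrightarrow> (P has_field_derivative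
       1 / (euler_fun (exp (2 * of_real pi * \<i> * \<tau>)) * euler_fun (exp (2 * of_real pi * \<i> * \<tau>) ^ p))
         * exp (- 2 * of_real pi * \<i> * of_nat n * \<tau>)) (at \<tau>)"
    and per: "\<And>\<tau>. Im \<tau> > 0 \<Longrightarrow> P (\<tau> + 1) = P \<tau> + a n"
    using power_series_coefficient_primitive [of a "\<lambda>q. 1 / (euler_fun q * euler_fun (q ^ p))" n, OF a] by blast
  obtain D where D: "D \<ge> 0" and arc: "\<And>N k h t1 t2. \<lbrakk>1 \<le> k; k \<le> N; coprime h k;
        1 / (2 * real k * real N) \<le> t1; t1 \<le> 1 / (real k * real N);
        1 / (2 * real k * real N) \<le> t2; t2 \<le> 1 / (real k * real N)\<rbrakk> \<Longrightarrow>
      norm (P (Complex (real h / real k + t2) (1 / (real N)\<^sup>2)) - P (Complex (real h / real k - t1) (1 / (real N)\<^sup>2))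
             - of_real (arc_weight p n k) * arc_factor p n k h) \<le> D / (real k * (real N)\<^sup>2)"
    using arc_estimate [OF p n P] by blast
  have bound: "norm ((\<Sum>k=1..N. of_real (arc_weight p n k) * b_coeff p k n) - a n) \<le> D / real N" if N: "N \<ge> 1" for N
  proof -
    define G where "G x = P (Complex x (1 / (real N)\<^sup>2))" for x
    let ?S = "\<lambda>k. {h. h < k \<and> coprime h k}"
    let ?d = "\<lambda>k h. G (real h / real k + farey_right N k (int h)) - G (real h / real k - farey_right N k (- int h))"
    let ?t = "\<lambda>k h. of_real (arc_weight p n k) * arc_factor p n k h"
    have "G (x + 1) = G x + a n" for x
    proof -
      have "Complex (x + 1) (1 / (real N)\<^sup>2) = Complex x (1 / (real N)\<^sup>2) + 1" by (simp add: complex_eq_iff)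
      then show ?thesis using per [of "Complex x (1 / (real N)\<^sup>2)"] N by (simp add: G_def)
    qed
    then have "a n = (\<Sum>k=1..N. \<Sum>h\<in>?S k. ?d k h)" using farey_dissection [of G "a n" N] N by simp
    moreover have "(\<Sum>k=1..N. of_real (arc_weight p n k) * b_coeff p k n) = (\<Sum>k=1..N. \<Sum>h\<in>?S k. ?t k h)"
      by (simp add: b_coeff_eq_sum_arc_factor sum_distrib_left)
    ultimately have "(\<Sum>k=1..N. of_real (arc_weight p n k) * b_coeff p k n) - a n
        = - (\<Sum>k=1..N. \<Sum>h\<in>?S k. ?d k h - ?t k h)"
      by (simp only: sum_subtractf minus_diff_eq)
    then have "norm ((\<Sum>k=1..N. of_real (arc_weight p n k) * b_coeff p k n) - a n)
        = norm (\<Sum>k=1..N. \<Sum>h\<in>?S k. ?d k h - ?t k h)" by (simp only: norm_minus_cancel)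
    also have "\<dots> \<le> (\<Sum>k=1..N. D / (real N)\<^sup>2)"
    proof (rule sum_norm_le)
      fix k assume k: "k \<in> {1..N}"
      have "norm (\<Sum>h\<in>?S k. ?d k h - ?t k h) \<le> (\<Sum>h\<in>?S k. D / (real k * (real N)\<^sup>2))"
      proof (rule sum_norm_le)
        fix h assume h: "h \<in> ?S k"
        have c: "coprime (int h) (int k)" "coprime (- int h) (int k)" using h by auto
        have "0 < k" "k \<le> N" using k by auto
        then show "norm (?d k h - ?t k h) \<le> D / (real k * (real N)\<^sup>2)"
          unfolding G_def using k h farey_right_bounds [OF c(1)] farey_right_bounds [OF c(2)]
          by (intro arc) auto
      qed
      also have "\<dots> = real (card (?S k)) * (D / (real k * (real N)\<^sup>2))" by simp
      also have "\<dots> \<le> real k * (D / (real k * (real N)\<^sup>2))"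
        using card_coprime_less_le [of k] D by (intro mult_right_mono) auto
      also have "\<dots> = D / (real N)\<^sup>2" using k by simp
      finally show "norm (\<Sum>h\<in>?S k. ?d k h - ?t k h) \<le> D / (real N)\<^sup>2" .
    qed
    also have "\<dots> = D / real N" using N by (simp add: power2_eq_square)
    finally show ?thesis .
  qed
  have "(\<lambda>N. (\<Sum>k=1..N. of_real (arc_weight p n k) * b_coeff p k n) - a n) \<longlonglongrightarrow> 0"
  proof (rule Lim_null_comparison)
    show "eventually (\<lambda>N. norm ((\<Sum>k=1..N. of_real (arc_weight p n k) * b_coeff p k n) - a n) \<le> D / real N) sequentially"
      using eventually_ge_at_top [of 1] by eventually_elim (rule bound)
    show "(\<lambda>N. D / real N) \<longlonglongrightarrow> 0" by real_asymp
  qed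
  then show ?thesis by (simp add: LIM_zero_iff)
qed

section \<open>Absolute convergence and regrouping by residue classes\<close>

text \<open>The trivial bound \<open>m\<close> for \<open>b_coeff p m n\<close> is cancelled by the
  division by \<open>m\<close>, and the Bessel factor is \<open>O(1 / m^2)\<close>. The predicate
  \<open>Q\<close> covers the residue classes and the multiples of \<open>p\<close> at once.\<close>

lemma summable_bessel_b_coeff:
  assumes "\<alpha> \<ge> 0" "M \<ge> 0"
  shows "summable (\<lambda>m. if m \<ge> 1 \<and> Q m
      then of_real (bessel_I 2 (pi / (6 * real m) * sqrt (\<alpha> * M))) * (b_coeff p m n / of_nat m) else 0)"
proof -
  define c where "c = pi / 6 * sqrt (\<alpha> * M)"
  have c: "c \<ge> 0" using assms by (simp add: c_def)
  define K where "K = exp ((c / 2)\<^sup>2) * (c / 2)\<^sup>2"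
  have b: "norm (if m \<ge> 1 \<and> Q m
      then of_real (bessel_I 2 (pi / (6 * real m) * sqrt (\<alpha> * M))) * (b_coeff p m n / of_nat m) else 0)
      \<le> K / (real m)\<^sup>2" for m
  proof (cases "m \<ge> 1 \<and> Q m")
    case True
    then have m: "m \<ge> 1" by simp
    have x: "pi / (6 * real m) * sqrt (\<alpha> * M) = c / real m" by (simp add: c_def)
    have "c / real m \<le> c / 1" using m c by (intro divide_left_mono) auto
    then have "\<bar>bessel_I 2 (c / real m)\<bar> \<le> exp ((c / 2)\<^sup>2) * (c / real m / 2)\<^sup>2"
      using c by (intro bessel_I_2_bound) auto
    also have "\<dots> = K / (real m)\<^sup>2" by (simp add: K_def power_divide)
    finally have "\<bar>bessel_I 2 (c / real m)\<bar> \<le> K / (real m)\<^sup>2" .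
    moreover have "norm (b_coeff p m n / of_nat m) \<le> 1"
      using norm_b_coeff_le [of p m n] m by (simp add: norm_divide)
    ultimately have "\<bar>bessel_I 2 (c / real m)\<bar> * norm (b_coeff p m n / of_nat m) \<le> K / (real m)\<^sup>2 * 1"
      by (intro mult_mono) auto
    then show ?thesis unfolding if_P [OF True] x norm_mult norm_of_real by (simp only: mult_1_right)
  next
    case False
    show ?thesis unfolding if_not_P [OF False] by (simp add: K_def)
  qed
  have "summable (\<lambda>m. K / (real m)\<^sup>2)"
    using summable_inverse_square [of K] summable_Suc_iff [of "\<lambda>m. K / (real m)\<^sup>2"] by simp
  then show ?thesis by (rule summable_comparison_test' [where N = 0]) (rule b)
qed

text \<open>\<open>A / B\<close> carries \<open>1 / m^2\<close>, of which the outer factor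
  \<open>m\<close> leaves \<open>1 / m\<close>. For \<open>gcd p m = 1\<close> the prefactor becomes
  that of the first series; for \<open>gcd p m = p\<close> the square root is 1 and it becomes that
  of the second.\<close>

lemma arc_weight_eq:
  assumes m: "m \<ge> 1" and p: "p > 0" and n: "24 * n > p + 1"
  shows "arc_weight p n m = 2 * pi * sqrt (real p / real (gcd p m))
      * ((1 + (real (gcd p m))\<^sup>2 / real p) / (24 * real n - real p - 1))
      * (bessel_I 2 (pi / (6 * real m) * sqrt ((1 + (real (gcd p m))\<^sup>2 / real p) * (24 * real n - real p - 1))) / real m)"
proof -
  define M where "M = 24 * real n - real p - 1"
  define \<alpha> where "\<alpha> = 1 + (real (gcd p m))\<^sup>2 / real p"
  have M: "M > 0" using n by (simp add: M_def)
  have m0: "real m > 0" using m by simp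
  have 1: "pi * \<alpha> / (12 * (real m)\<^sup>2) / (pi * M / 12) = \<alpha> / M / (real m)\<^sup>2"
    using M m0 by (simp add: field_simps)
  have 2: "2 * sqrt (pi * \<alpha> / (12 * (real m)\<^sup>2) * (pi * M / 12)) = pi / (6 * real m) * sqrt (\<alpha> * M)"
  proof -
    have "pi * \<alpha> / (12 * (real m)\<^sup>2) * (pi * M / 12) = (pi / (12 * real m))\<^sup>2 * (\<alpha> * M)"
      by (simp add: power2_eq_square field_simps)
    then have "sqrt (pi * \<alpha> / (12 * (real m)\<^sup>2) * (pi * M / 12)) = pi / (12 * real m) * sqrt (\<alpha> * M)"
      using m0 by (simp add: real_sqrt_mult)
    then show ?thesis by simp
  qed
  show ?thesis
    unfolding arc_weight_def Let_def \<alpha>_def [symmetric] M_def [symmetric] 1 2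
    using m0 by (simp add: power2_eq_square)
qed

theorem theorem1p1:
  fixes p n :: nat and a :: "nat \<Rightarrow> complex"
  assumes "prime p" and "p \<le> 23"
    and "\<And>q. norm q < 1 \<Longrightarrow>
           (\<lambda>k. a k * q ^ k) sums (1 / (qpoch_inf q q * qpoch_inf (q ^ p) (q ^ p)))"
    and "n \<ge> 1" and "24 * n > p + 1"
  shows "(\<forall>j\<in>{1..p-1}. summable (\<lambda>m.
            if m \<ge> 1 \<and> [m = j] (mod p)
            then of_real (bessel_I 2 (pi / (6 * real m)
                   * sqrt ((1 + 1 / real p) * (24 * real n - real p - 1))))
                 * (b_coeff p m n / of_nat m)
            else 0))
       \<and> summable (\<lambda>m.
            if m \<ge> 1 \<and> p dvd m
            then of_real (bessel_I 2 (pi / (6 * real m)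
                   * sqrt ((1 + real p) * (24 * real n - real p - 1))))
                 * (b_coeff p m n / of_nat m)
            else 0)
       \<and> a n =
           of_real (2 * pi * sqrt (real p) * ((1 + 1 / real p) / (24 * real n - real p - 1)))
           * (\<Sum>j = 1..p-1. \<Sum>m.
                if m \<ge> 1 \<and> [m = j] (mod p)
                then of_real (bessel_I 2 (pi / (6 * real m)
                       * sqrt ((1 + 1 / real p) * (24 * real n - real p - 1))))
                     * (b_coeff p m n / of_nat m)
                else 0)
         + of_real (2 * pi * ((1 + real p) / (24 * real n - real p - 1)))
           * (\<Sum>m.
                if m \<ge> 1 \<and> p dvd m
                then of_real (bessel_I 2 (pi / (6 * real m)
                       * sqrt ((1 + real p) * (24 * real n - real p - 1))))
                     * (b_coeff p m n / of_nat m)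
                else 0)"
proof -
  have p0: "p > 0" using assms(1) by (rule prime_gt_0_nat)
  define M where "M = 24 * real n - real p - 1"
  have M: "M > 0" using assms(5) by (simp add: M_def)
  define F1 where "F1 j m = (if m \<ge> 1 \<and> [m = j] (mod p)
      then of_real (bessel_I 2 (pi / (6 * real m) * sqrt ((1 + 1 / real p) * M))) * (b_coeff p m n / of_nat m) else 0)"
    for j m
  define F2 where "F2 m = (if m \<ge> 1 \<and> p dvd m
      then of_real (bessel_I 2 (pi / (6 * real m) * sqrt ((1 + real p) * M))) * (b_coeff p m n / of_nat m) else 0)"
    for m
  define c1 where "c1 = complex_of_real (2 * pi * sqrt (real p) * ((1 + 1 / real p) / M))"
  define c2 where "c2 = complex_of_real (2 * pi * ((1 + real p) / M))"
  have s1: "summable (F1 j)" for j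
    unfolding F1_def using M by (intro summable_bessel_b_coeff) auto
  have s2: "summable F2"
    unfolding F2_def using M by (intro summable_bessel_b_coeff) auto
  \<comment> \<open>As \<open>p\<close> is prime the gcd is 1 or \<open>p\<close>: either exactly
    one residue class \<open>j\<close> contributes or only \<open>F2\<close> does.\<close>
  have split: "of_real (arc_weight p n m) * b_coeff p m n = (\<Sum>j=1..p-1. c1 * F1 j m) + c2 * F2 m"
    if m: "m \<ge> 1" for m
  proof (cases "p dvd m")
    case True
    have "F1 j m = 0" if "j \<in> {1..p-1}" for j
    proof -
      have "\<not> p dvd j" using that by (auto dest: dvd_imp_le)
      then have "\<not> [m = j] (mod p)" using True by (metis cong_dvd_iff)
      then show ?thesis by (simp add: F1_def)
    qed
    moreover have "gcd p m = p" using True by (simp add: gcd_nat.absorb1)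
    ultimately show ?thesis
      using arc_weight_eq [OF m p0 assms(5)] True m p0
      by (simp add: F2_def c2_def M_def power2_eq_square)
  next
    case False
    have "gcd p m = 1" using False assms(1) by (metis coprime_imp_gcd_eq_1 prime_imp_coprime)
    then have w: "arc_weight p n m = 2 * pi * sqrt (real p) * ((1 + 1 / real p) / M)
        * (bessel_I 2 (pi / (6 * real m) * sqrt ((1 + 1 / real p) * M)) / real m)"
      using arc_weight_eq [OF m p0 assms(5)] by (simp add: M_def)
    have r: "m mod p \<in> {1..p-1}"
    proof -
      have "m mod p \<noteq> 0" using False by (simp add: dvd_eq_mod_eq_0)
      moreover have "m mod p < p" using p0 by simp
      ultimately show ?thesis by auto
    qed
    have cong: "[m = j] (mod p) \<longleftrightarrow> j = m mod p" if "j \<in> {1..p-1}" for j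
      using that p0 by (auto simp: cong_def)
    have "(\<Sum>j=1..p-1. c1 * F1 j m) = (\<Sum>j=1..p-1. if j = m mod p then c1 * F1 (m mod p) m else 0)"
      by (rule sum.cong) (auto simp: F1_def cong)
    also have "\<dots> = c1 * F1 (m mod p) m" using r by (simp add: sum.delta)
    finally have "(\<Sum>j=1..p-1. c1 * F1 j m) = c1 * F1 (m mod p) m" .
    moreover have "F2 m = 0" using False by (simp add: F2_def)
    moreover have "F1 (m mod p) m = of_real (bessel_I 2 (pi / (6 * real m) * sqrt ((1 + 1 / real p) * M))) * (b_coeff p m n / of_nat m)"
      using m by (simp add: F1_def cong_def)
    ultimately show ?thesis unfolding w c1_def by simp
  qed
  \<comment> \<open>The guard \<open>m \<ge> 1\<close> makes index 0 contribute nothing, which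
    reconciles series from 0 with sums from 1.\<close>
  have zero: "(\<Sum>j=1..p-1. c1 * F1 j 0) + c2 * F2 0 = 0" by (simp add: F1_def F2_def)
  have "(\<lambda>N. \<Sum>k=1..N. of_real (arc_weight p n k) * b_coeff p k n) \<longlonglongrightarrow> a n"
    using assms(3) by (intro circle_method_partial_sums p0 assms(2,5)) (simp add: euler_fun_def)
  moreover have "(\<Sum>k=1..N. of_real (arc_weight p n k) * b_coeff p k n)
      = (\<Sum>m\<le>N. (\<Sum>j=1..p-1. c1 * F1 j m) + c2 * F2 m)" for N
  proof -
    have "(\<Sum>m\<le>N. (\<Sum>j=1..p-1. c1 * F1 j m) + c2 * F2 m) = (\<Sum>m=1..N. (\<Sum>j=1..p-1. c1 * F1 j m) + c2 * F2 m)"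
      using zero by (simp add: sum.atMost_shift sum.atLeast1_atMost_eq)
    then show ?thesis using split by simp
  qed
  ultimately have "(\<lambda>m. (\<Sum>j=1..p-1. c1 * F1 j m) + c2 * F2 m) sums a n"
    by (simp add: sums_def_le)
  \<comment> \<open>Each class converges on its own, so the single series over \<open>m\<close>
    splits into finitely many series with the same total.\<close>
  moreover have "(\<lambda>m. (\<Sum>j=1..p-1. c1 * F1 j m) + c2 * F2 m) sums ((\<Sum>j=1..p-1. c1 * suminf (F1 j)) + c2 * suminf F2)"
    by (intro sums_add sums_sum sums_mult summable_sums s1 s2)
  ultimately have "a n = c1 * (\<Sum>j=1..p-1. suminf (F1 j)) + c2 * suminf F2"
    using sums_unique2 by (simp add: sum_distrib_left) blast
  then show ?thesis
    using s1 s2 unfolding F1_def F2_def c1_def c2_def M_def by blast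
qed

end
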